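(* Let $T>0$ and let $\sigma\in BV_{\mathrm{loc}}(\mathbb{R})\cap L^\infty(\mathbb{R})$ be nonnegative $\mathcal{L}^1$-a.e. and such that $\frac1\sigma\in L^1_{\mathrm{loc}}(\mathbb{R})$. (i) The function $g(x)=\int_0^x\frac{dz}{\sigma(z)}$, $x\in\mathbb{R}$, is absolutely continuous and strictly increasing on $\mathbb{R}$. Its inverse $f:=g^{-1}$ is Lipschitz and satisfies $\sigma(f)=f'$ $\mathcal{L}^1$-a.e. on $\mathbb{R}$. (ii) Let $s\in(0,1)$, $\gamma\in(\frac1{1+s},1)$, $Y\in\mathcal{C}^\gamma([0,T])$ with $Y_0=0$ and $\mathring{x}\in\mathbb{R}$. Let $-\infty\le a<b\le+\infty$. Suppose that $$\sup_{x\in Y([0,T])\cap (g(a),g(b))}\int_0^T|Y_t-x|^{-s}\,dt<+\infty\quad\text{or that}\quad\sigma\text{ is upper }d\text{-regular on }(a,b)\text{ with some }d>s,$$ and similarly suppose that $$\sup_{x\in Y([0,T])\cap(\mathbb{R}\setminus (g(a),g(b)))}\int_0^T|Y_t-x|^{-s}\,dt<+\infty\quad\text{or that}\quad\sigma\text{ is upper }d\text{-regular on }\mathbb{R}\setminus(a,b)\text{ with some }d>s.$$ Then the function $X\in\mathcal{C}^\gamma([0,T])$ defined by $$X_t=f(Y_t+g(\mathring{x})),\quad t\in[0,T],$$ satisfies $X_t=\mathring{x}+\int_0^t\sigma(X_u)\,dY_u$, $t\in[0,T]$. If $\frac1\sigma\in L^\infty_{\mathrm{loc}}(\mathbb{R})$,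 then $X\in\mathcal{C}^\gamma([0,T])\cap V(\sigma,s)$ is a variability solution for $\sigma$ and $Y$ started at $\mathring{x}$.
   Context: (Dimension $n=1$ throughout.) For $a=-\infty$ or $b=+\infty$, $g(a)$, $g(b)$ denote the corresponding limits of $g$. **BV, variability.** $\sigma\in L^1_{\mathrm{loc}}(\mathbb{R})$ is in $BV_{\mathrm{loc}}(\mathbb{R})$ if its distributional derivative $D\sigma$ is a signed Radon measure; $\|D\sigma\|$ is its total variation measure. For $s\in(0,1)$, $V(\sigma,s)$ is the set of continuous $X:[0,T]\to\mathbb{R}$ for which there is a relatively compact open neighborhood $\mathcal{U}$ of $X([0,T])$ with $\int_0^T\int_{\mathcal{U}}|X_t-z|^{-s}\|D\sigma\|(dz)\,dt<\infty$ ("$(s,1)$-variable"). **Upper regularity.** $\sigma$ is upper $d$-regular on a Borel set $B$ if there are $c,r_0>0$ such that $\|D\sigma\|((x-r,x+r))\le cr^d$ for all $x\in B\cap\operatorname{supp}\|D\sigma\|$ and $0<r<r_0$. The supremum over an empty set is regarded as finite. **Composition.** $\sigma$ has approximate limit $\lambda_\sigma(x)$ at $x$ if $\lim_{r\to0}\frac1{2r}\int_{x-r}^{x+r}|\sigma(y)-\lambda_\sigma(x)|dy=0$; $S_\sigma$ is the set of points without approximate limit; a Lebesgue representative is a Borel function $\widetilde\sigma$ with $\widetilde\sigma=\lambda_\sigma$ off $S_\sigma$. $\sigma(X)$ is the $\mathcal{L}^1$-a.e. class of $t\mapsto\widetilde\sigma(X_t)$, where $\widetilde\sigma$ is a Lebesgue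 representative (for $X\in V(\sigma,s)$ this is independent of the choice of $\widetilde\sigma$). **Integral.** $W^{\theta,1}_0(0,T)$: measurable $h$ with $\int_0^T\frac{|h(t)|}{t^\theta}dt+\int_0^T\int_0^T\frac{|h(t)-h(u)|}{|t-u|^{1+\theta}}du\,dt<\infty$. $W^{\theta,\infty}_T(0,T)$: measurable $k$ such that $k(T-)$ exists and $\sup_t\frac{|k(T-)-k(t)|}{(T-t)^\theta}+\sup_t\int_t^T\frac{|k(t)-k(u)|}{|t-u|^{1+\theta}}du<\infty$. For $h\in W_0^{\theta,1}(0,T)$, $k\in W_T^{1-\theta,\infty}(0,T)$, $\theta\in(0,1)$, $$\int_0^Th_t\,dk_t=(-1)^\theta\int_0^TD^\theta_{0+}h(t)\,D^{1-\theta}_{T-}(k-k(T-))(t)\,dt,$$ with $D^\theta_{0+}h(t)=\frac1{\Gamma(1-\theta)}\Big(\frac{h(t)}{t^\theta}+\theta\int_0^t\frac{h(t)-h(r)}{(t-r)^{\theta+1}}dr\Big)$ and $D^\theta_{T-}k(t)=\frac{(-1)^\theta}{\Gamma(1-\theta)}\Big(\frac{k(t)}{(T-t)^\theta}+\theta\int_t^T\frac{k(t)-k(r)}{(r-t)^{\theta+1}}dr\Big)$ (complex prefactors combine to $-1$; the value is independent of admissible $\theta$); $\int_0^th\,dk:=\int_0^T\mathbf{1}_{[0,t]}h\,dk$. **Variability solution.** A path $X:[0,T]\to\mathbb{R}$ is a variability solution for $\sigma$ and $Y\in\mathcal{C}^\gamma([0,T])$ started at $\mathring{x}$ if $X_0=\mathring{x}$,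 $X\in\mathcal{C}^\alpha([0,T])\cap V(\sigma,s')$ for some $\alpha\in(0,1)$ and $s'\in(\frac{1-\gamma}\alpha,1)$, and $X_t=\mathring{x}+\int_0^t\sigma(X_u)\,dY_u$ for all $t\in[0,T]$. $\mathcal{C}^\gamma$ denotes Hölder functions of order $\gamma$.
   Formalization: In both sup-conditions of (ii), Y is replaced by the shifted path Y+g(x̊), the argument of f; as printed, the mixed case (sup-condition on one part, regularity on the other) fails for x̊≠0. Absolute continuity of g on ℝ is read as on every compact interval. *)

theory Defs
  imports "HOL-Analysis.Analysis"
begin

section \<open>Local function spaces on the real line\<close>

text \<open>
  Elements of \<open>L\<^sup>1\<^sub>l\<^sub>o\<^sub>c\<close> are represented by Lebesgue measurable functions; all notions below are
  invariant under changes on Lebesgue null sets.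
\<close>

definition L1_loc :: "(real \<Rightarrow> real) \<Rightarrow> bool" where
  "L1_loc \<sigma> \<longleftrightarrow> (\<forall>K. compact K \<longrightarrow> set_integrable lebesgue K \<sigma>)"

definition Linfty :: "(real \<Rightarrow> real) \<Rightarrow> bool" where
  "Linfty \<sigma> \<longleftrightarrow> \<sigma> \<in> borel_measurable lebesgue \<and> (\<exists>C. AE x in lebesgue. \<bar>\<sigma> x\<bar> \<le> C)"

definition Linfty_loc :: "(real \<Rightarrow> real) \<Rightarrow> bool" where
  "Linfty_loc \<sigma> \<longleftrightarrow> \<sigma> \<in> borel_measurable lebesgue \<and>
     (\<forall>K. compact K \<longrightarrow> (\<exists>C. AE x in lebesgue. x \<in> K \<longrightarrow> \<bar>\<sigma> x\<bar> \<le> C))"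

text \<open>
  Mathematically \<open>1 / 0 = \<infinity>\<close>, so that \<open>1 / \<sigma> \<in> L\<^sup>1\<^sub>l\<^sub>o\<^sub>c\<close> (or \<open>L\<^sup>\<infinity>\<^sub>l\<^sub>o\<^sub>c\<close>) includes that \<open>\<sigma>\<close> vanishes only
  on a null set. Since \<open>1 / 0 = 0\<close> in HOL, this has to be stated separately.
\<close>

definition recip_L1_loc :: "(real \<Rightarrow> real) \<Rightarrow> bool" where
  "recip_L1_loc \<sigma> \<longleftrightarrow> (AE x in lebesgue. \<sigma> x \<noteq> 0) \<and> L1_loc (\<lambda>x. 1 / \<sigma> x)"

definition recip_Linfty_loc :: "(real \<Rightarrow> real) \<Rightarrow> bool" where
  "recip_Linfty_loc \<sigma> \<longleftrightarrow> (AE x in lebesgue. \<sigma> x \<noteq> 0) \<and> Linfty_loc (\<lambda>x. 1 / \<sigma> x)"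

definition holder_on :: "real \<Rightarrow> real set \<Rightarrow> (real \<Rightarrow> real) \<Rightarrow> bool" where
  "holder_on \<gamma> S X \<longleftrightarrow> (\<exists>C. \<forall>t\<in>S. \<forall>u\<in>S. \<bar>X t - X u\<bar> \<le> C * \<bar>t - u\<bar> powr \<gamma>)"

definition abs_continuous_on_Icc :: "real \<Rightarrow> real \<Rightarrow> (real \<Rightarrow> real) \<Rightarrow> bool" where
  "abs_continuous_on_Icc c d g \<longleftrightarrow>
     (\<forall>\<epsilon>>0. \<exists>\<delta>>0. \<forall>I. finite I \<longrightarrow>
        (\<forall>(u, v)\<in>I. c \<le> u \<and> u \<le> v \<and> v \<le> d) \<longrightarrow>
        disjoint_family_on (\<lambda>(u, v). {u<..<v}) I \<longrightarrow>
        (\<Sum>(u, v)\<in>I. v - u) < \<delta> \<longrightarrow>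
        (\<Sum>(u, v)\<in>I. \<bar>g v - g u\<bar>) < \<epsilon>)"

text \<open>
  Absolute continuity on the whole line is understood on every compact interval, as usual for
  primitives of locally integrable functions.
\<close>

definition abs_continuous :: "(real \<Rightarrow> real) \<Rightarrow> bool" where
  "abs_continuous g \<longleftrightarrow> (\<forall>c d. abs_continuous_on_Icc c d g)"


section \<open>Functions of locally bounded variation\<close>

definition test_function :: "(real \<Rightarrow> real) \<Rightarrow> bool" where
  "test_function \<phi> \<longleftrightarrow>
     (\<forall>n x. (deriv ^^ n) \<phi> field_differentiable (at x)) \<and> compact (closure {x. \<phi> x \<noteq> 0})"

text \<open>
  The distributional derivative of \<open>\<sigma>\<close> is the signed Radon measure \<open>P - N\<close> with Jordan decomposition
  \<open>(P, N)\<close>. A signed Radon measure is only locally finite, so \<open>P\<close> and \<open>N\<close> may both be infinite.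
\<close>

definition distr_deriv :: "(real \<Rightarrow> real) \<Rightarrow> real measure \<times> real measure \<Rightarrow> bool" where
  "distr_deriv \<sigma> = (\<lambda>(P, N).
     sets P = sets borel \<and> sets N = sets borel \<and>
     (\<forall>K. compact K \<longrightarrow> emeasure P K < \<infinity> \<and> emeasure N K < \<infinity>) \<and>
     (\<exists>A\<in>sets borel. emeasure P A = 0 \<and> emeasure N (- A) = 0) \<and>
     (\<forall>\<phi>. test_function \<phi> \<longrightarrow>
        (LINT x|lebesgue. \<sigma> x * deriv \<phi> x) = - ((LINT x|P. \<phi> x) - (LINT x|N. \<phi> x))))"

definition BV_loc :: "(real \<Rightarrow> real) \<Rightarrow> bool" where
  "BV_loc \<sigma> \<longleftrightarrow> L1_loc \<sigma> \<and> (\<exists>D. distr_deriv \<sigma> D)"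

text \<open>
  The total variation measure is the sum of the two parts of the Jordan decomposition. The pair
  chosen here is unique for \<open>\<sigma>\<close> in \<open>BV_loc\<close>.
\<close>

definition tv_measure :: "(real \<Rightarrow> real) \<Rightarrow> real measure" where
  "tv_measure \<sigma> = (let (P, N) = (SOME D. distr_deriv \<sigma> D) in
     measure_of UNIV (sets borel) (\<lambda>B. emeasure P B + emeasure N B))"

definition measure_support :: "real measure \<Rightarrow> real set" where
  "measure_support M = {x. \<forall>U. open U \<longrightarrow> x \<in> U \<longrightarrow> emeasure M U > 0}"

definition upper_regular :: "real \<Rightarrow> (real \<Rightarrow> real) \<Rightarrow> real set \<Rightarrow> bool" where
  "upper_regular d \<sigma> B \<longleftrightarrow>
     (\<exists>c>0. \<exists>r\<^sub>0>0. \<forall>x \<in> B \<inter> measure_support (tv_measure \<sigma>). \<forall>r. 0 < r \<and> r < r\<^sub>0 \<longrightarrow>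
        emeasure (tv_measure \<sigma>) {x - r<..<x + r} \<le> ennreal (c * r powr d))"

text \<open>
  The kernel \<open>\<bar>x\<bar>\<^sup>-\<^sup>s\<close> for \<open>s > 0\<close>, with the value \<open>\<infinity>\<close> at the origin; note that \<open>0 powr (- s) = 0\<close>.
\<close>

definition riesz :: "real \<Rightarrow> real \<Rightarrow> ennreal" where
  "riesz s x = inverse (ennreal (\<bar>x\<bar> powr s))"

definition variable :: "real \<Rightarrow> (real \<Rightarrow> real) \<Rightarrow> real \<Rightarrow> (real \<Rightarrow> real) set" where
  "variable T \<sigma> s = {X. continuous_on {0..T} X \<and>
     (\<exists>U. open U \<and> compact (closure U) \<and> X ` {0..T} \<subseteq> U \<and>
        (\<integral>\<^sup>+t\<in>{0..T}. (\<integral>\<^sup>+z\<in>U. riesz s (X t - z) \<partial>tv_measure \<sigma>) \<partial>lebesgue) < \<infinity>)}"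

text \<open>
  A supremum over the empty set is \<open>0\<close> in \<open>ennreal\<close>, hence finite. The path \<open>Z\<close> is the argument of
  \<open>f\<close> in \<open>X = f \<circ> Z\<close>, that is \<open>Z = Y + g(x\<^sub>0)\<close> rather than \<open>Y\<close>: only then do \<open>Z\<close> in \<open>(g(a), g(b))\<close>
  and \<open>X\<close> in \<open>(a, b)\<close> correspond, as a case distinction along \<open>(a, b)\<close> requires. Both paths agree if
  \<open>g(x\<^sub>0) = 0\<close>.
\<close>

definition bounded_potential :: "real \<Rightarrow> real \<Rightarrow> (real \<Rightarrow> real) \<Rightarrow> real set \<Rightarrow> bool" where
  "bounded_potential T s Z B \<longleftrightarrow>
     (SUP x \<in> Z ` {0..T} \<inter> B. (\<integral>\<^sup>+t\<in>{0..T}. riesz s (Z t - x) \<partial>lebesgue)) < \<infinity>"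

text \<open>
  The value of \<open>g\<close> at an extended real, given by the limit of \<open>g\<close> at \<open>\<plusminus>\<infinity>\<close>.
\<close>

definition ext_value :: "(real \<Rightarrow> real) \<Rightarrow> ereal \<Rightarrow> ereal" where
  "ext_value g a = (case a of
     ereal r \<Rightarrow> ereal (g r)
   | PInfty \<Rightarrow> Lim at_top (\<lambda>x. ereal (g x))
   | MInfty \<Rightarrow> Lim at_bot (\<lambda>x. ereal (g x)))"


section \<open>Composition\<close>

definition approx_limit :: "(real \<Rightarrow> real) \<Rightarrow> real \<Rightarrow> real \<Rightarrow> bool" where
  "approx_limit \<sigma> x l \<longleftrightarrow>
     ((\<lambda>r. 1 / (2 * r) * (LINT y:{x - r..x + r}|lebesgue. \<bar>\<sigma> y - l\<bar>)) \<longlongrightarrow> 0) (at_right 0)"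

definition lebesgue_representative :: "(real \<Rightarrow> real) \<Rightarrow> (real \<Rightarrow> real) \<Rightarrow> bool" where
  "lebesgue_representative \<sigma> \<sigma>' \<longleftrightarrow>
     \<sigma>' \<in> borel_measurable borel \<and> (\<forall>x l. approx_limit \<sigma> x l \<longrightarrow> \<sigma>' x = l)"


section \<open>The fractional Stieltjes integral\<close>

definition W_0 :: "real \<Rightarrow> real \<Rightarrow> (real \<Rightarrow> real) set" where
  "W_0 T \<theta> = {h. h \<in> borel_measurable (lebesgue_on {0<..<T}) \<and>
     (\<integral>\<^sup>+t\<in>{0<..<T}. ennreal (\<bar>h t\<bar> / t powr \<theta>) \<partial>lebesgue) +
     (\<integral>\<^sup>+t\<in>{0<..<T}. (\<integral>\<^sup>+u\<in>{0<..<T}.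
        ennreal (\<bar>h t - h u\<bar> / \<bar>t - u\<bar> powr (1 + \<theta>)) \<partial>lebesgue) \<partial>lebesgue) < \<infinity>}"

abbreviation left_limit :: "(real \<Rightarrow> real) \<Rightarrow> real \<Rightarrow> real" where
  "left_limit k T \<equiv> Lim (at_left T) k"

definition W_T :: "real \<Rightarrow> real \<Rightarrow> (real \<Rightarrow> real) set" where
  "W_T T \<theta> = {k. k \<in> borel_measurable (lebesgue_on {0<..<T}) \<and>
     (\<exists>l. (k \<longlongrightarrow> l) (at_left T)) \<and>
     (SUP t\<in>{0<..<T}. ennreal (\<bar>left_limit k T - k t\<bar> / (T - t) powr \<theta>)) +
     (SUP t\<in>{0<..<T}. (\<integral>\<^sup>+u\<in>{t<..<T}.
        ennreal (\<bar>k t - k u\<bar> / \<bar>t - u\<bar> powr (1 + \<theta>)) \<partial>lebesgue)) < \<infinity>}"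

text \<open>
  Left- and right-sided Weyl-Marchaud derivatives on \<open>(0, T)\<close>, the latter without its complex
  prefactor \<open>(-1)\<^sup>\<theta>\<close>.
\<close>

definition frac_deriv_left :: "real \<Rightarrow> (real \<Rightarrow> real) \<Rightarrow> real \<Rightarrow> real" where
  "frac_deriv_left \<theta> h t = 1 / Gamma (1 - \<theta>) *
     (h t / t powr \<theta> + \<theta> * (LINT r:{0<..<t}|lebesgue. (h t - h r) / (t - r) powr (\<theta> + 1)))"

definition frac_deriv_right :: "real \<Rightarrow> real \<Rightarrow> (real \<Rightarrow> real) \<Rightarrow> real \<Rightarrow> real" where
  "frac_deriv_right T \<theta> k t = 1 / Gamma (1 - \<theta>) *
     (k t / (T - t) powr \<theta> + \<theta> * (LINT r:{t<..<T}|lebesgue. (k t - k r) / (r - t) powr (\<theta> + 1)))"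

text \<open>
  The leading minus sign is the product \<open>(-1)\<^sup>\<theta> (-1)\<^sup>1\<^sup>-\<^sup>\<theta>\<close> of the complex prefactors. The integral is a
  relation, so that it asserts the admissibility of some order \<open>\<theta>\<close>; its value does not depend on
  the admissible order.
\<close>

definition has_frac_integral ::
    "real \<Rightarrow> (real \<Rightarrow> real) \<Rightarrow> (real \<Rightarrow> real) \<Rightarrow> real \<Rightarrow> bool" where
  "has_frac_integral T h k I \<longleftrightarrow>
     (\<exists>\<theta>. 0 < \<theta> \<and> \<theta> < 1 \<and> h \<in> W_0 T \<theta> \<and> k \<in> W_T T (1 - \<theta>) \<and>
        I = - (LINT t:{0<..<T}|lebesgue.
                 frac_deriv_left \<theta> h t *
                 frac_deriv_right T (1 - \<theta>) (\<lambda>u. k u - left_limit k T) t))"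


section \<open>Solutions\<close>

text \<open>
  The equation \<open>X\<^sub>t = x\<^sub>0 + \<integral>\<^sub>0\<^sup>t \<sigma>(X\<^sub>u) dY\<^sub>u\<close> on \<open>[0, T]\<close>, required for every choice of the Lebesgue
  representative in the composition \<open>\<sigma>(X)\<close>.
\<close>

definition solves :: "real \<Rightarrow> (real \<Rightarrow> real) \<Rightarrow> (real \<Rightarrow> real) \<Rightarrow> real \<Rightarrow> (real \<Rightarrow> real) \<Rightarrow> bool" where
  "solves T \<sigma> Y x\<^sub>0 X \<longleftrightarrow>
     (\<forall>\<sigma>'. lebesgue_representative \<sigma> \<sigma>' \<longrightarrow>
        (\<forall>t\<in>{0..T}. has_frac_integral T (\<lambda>u. indicator {0..t} u * \<sigma>' (X u)) Y (X t - x\<^sub>0)))"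

definition variability_solution ::
    "real \<Rightarrow> (real \<Rightarrow> real) \<Rightarrow> real \<Rightarrow> (real \<Rightarrow> real) \<Rightarrow> real \<Rightarrow> (real \<Rightarrow> real) \<Rightarrow> bool" where
  "variability_solution T \<sigma> \<gamma> Y x\<^sub>0 X \<longleftrightarrow>
     holder_on \<gamma> {0..T} Y \<and> X 0 = x\<^sub>0 \<and>
     (\<exists>\<alpha> s'. 0 < \<alpha> \<and> \<alpha> < 1 \<and> (1 - \<gamma>) / \<alpha> < s' \<and> s' < 1 \<and>
        holder_on \<alpha> {0..T} X \<and> X \<in> variable T \<sigma> s') \<and>
     solves T \<sigma> Y x\<^sub>0 X"

end

theory Submission
  imports Defs
begin

text \<open>
  By the du Bois-Reymond lemma \<open>\<sigma>\<close> agrees almost everywhere with a function \<open>F\<close> such that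
  \<open>\<bar>F y - F x\<bar> \<le> \<mu> (x, y]\<close> for \<open>\<mu> = \<parallel>D\<sigma>\<parallel>\<close>. Since \<open>y - x\<close> is the integral of \<open>F \<cdot> (1 / F)\<close> over \<open>(x, y]\<close>,
  the deviation \<open>\<bar>(y - x) - F x (g y - g x)\<bar>\<close> is at most the oscillation of \<open>F\<close> on \<open>[x, y]\<close> times
  \<open>g y - g x\<close>. This replaces the chain rule: it gives \<open>f' = F \<circ> f\<close> wherever \<open>F\<close> is continuous at \<open>f\<close>,
  and along the path \<open>X = f \<circ> Z\<close> it reduces everything to the measure of the segment between
  \<open>X u\<close> and \<open>X v\<close>. Either hypothesis, on the potentials of \<open>Z\<close> or on the regularity of \<open>\<mu>\<close>, bounds this measure
  by \<open>\<bar>u - v\<bar>\<^sup>\<gamma>\<^sup>s V u\<close> with an integrable \<open>V\<close>. Taking \<open>u = v\<close> shows that \<open>X\<close> avoids the jumps of \<open>F\<close> at almost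
  all times, so all Lebesgue representatives agree along \<open>X\<close>.

  The fractional integral is the limit of the integrals of \<open>h\<close> against \<open>k\<^sub>\<epsilon>'\<close>, where \<open>k\<^sub>\<epsilon>\<close> is the twofold
  Steklov mean of the integrator \<open>k\<close>. For such smooth integrators it is an ordinary integral, by Fubini's theorem and
  Euler's Beta integral. As \<open>\<gamma> (1 + s) > 1\<close>, replacing \<open>F (X u) (Z v - Z u)\<close> by \<open>X v - X u\<close> is harmless
  in the limit, and what remains is a second difference quotient that converges to \<open>X t - X 0\<close>.
\<close>

section \<open>Smooth bump functions\<close>

text \<open>The coefficient may jump on a dense set, so \<sigma>(X) has no Hoelder modulus that is
  uniform in time: the factor \<open>V u\<close> is merely integrable and depends on one of the two
  times only. The estimates are therefore asymmetric throughout: the base point \<open>u\<close> is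
  one of almost all times, the other time \<open>v\<close> is arbitrary. Fractional Sobolev norms
  and Marchaud derivatives tolerate this, because they integrate the increments over both times. The
  order \<theta> of the integral has to exceed 1 - \<gamma> for the sake of the Hoelder integrator
  and to stay below \<gamma> s for the sake of the integrand; the hypothesis on \<gamma> says
  precisely that this range is not empty. Working on the whole line instead of (0, T), with paths
  extended by constants and integrands by 0, keeps boundary terms out of the Fubini
  arguments.\<close>

lemma power_le_fact_exp:
  fixes x :: real assumes "0 \<le> x" shows "x ^ m \<le> fact m * exp x"
proof -
  have "(\<Sum>n\<in>{m}. x ^ n /\<^sub>R fact n) \<le> (\<Sum>n. x ^ n /\<^sub>R fact n)"
    by (intro sum_le_suminf summable_exp_generic) (use assms in auto)
  then have "x ^ m / fact m \<le> exp x"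
    by (simp add: exp_def divide_inverse mult.commute)
  then show ?thesis by (simp add: field_simps)
qed

text \<open>One term of the exponential series at c / y suffices. The flatness of exp (- c / y) at 0
  is used with \<open>p = 0\<close> for boundedness and with \<open>p = 2\<close> for a vanishing
  derivative.\<close>

lemma exp_neg_inverse_bound:
  fixes c y :: real assumes "c > 0" "y > 0"
  shows "exp (- c / y) / y ^ m \<le> fact (m + p) / c ^ (m + p) * y ^ p"
proof -
  have "(c / y) ^ (m + p) \<le> fact (m + p) * exp (c / y)"
    using assms by (intro power_le_fact_exp) simp
  then have "c ^ (m + p) * exp (- (c / y)) \<le> fact (m + p) * y ^ (m + p)"
    using assms by (simp add: power_divide exp_minus field_simps)
  then show ?thesis using assms by (simp add: field_simps power_add)
qed

text \<open>The inverse powers make the family closed under differentiation up to linear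
  combinations; \<open>i = j = 0\<close> is the usual mollifier on (a, b). The rate \<open>c\<close>
  is a parameter because letting it tend to 0 turns the mollifier into the indicator of (a,
  b).\<close>

definition bump :: "real \<Rightarrow> real \<Rightarrow> real \<Rightarrow> nat \<Rightarrow> nat \<Rightarrow> real \<Rightarrow> real" where
  "bump a b c i j x = (if a < x \<and> x < b
     then (exp (- c / (x - a)) / (x - a) ^ i) * (exp (- c / (b - x)) / (b - x) ^ j) else 0)"

lemma bump_nonneg: "0 \<le> bump a b c i j x"
  by (simp add: bump_def)

text \<open>One factor decays quadratically at the end point of (a, b) that lies on the side of
  \<open>x\<close>, the other is bounded. As \<open>x\<close> is any point off (a, b), end points
  and exterior points are covered at once when differentiating.\<close>

lemma bump_quadratic_bound:
  assumes "c > 0"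
  obtains K where "\<And>x y. \<not> (a < x \<and> x < b) \<Longrightarrow> bump a b c i j y \<le> K * (y - x)\<^sup>2"
proof -
  define A where "A = (\<lambda>m. fact (m + 0) / c ^ (m + 0) :: real)"
  define B where "B = (\<lambda>m. fact (m + 2) / c ^ (m + 2) :: real)"
  have nn: "A m \<ge> 0" "B m \<ge> 0" for m using assms by (simp_all add: A_def B_def)
  have bA: "exp (- c / y) / y ^ m \<le> A m" and bB: "exp (- c / y) / y ^ m \<le> B m * y\<^sup>2"
    if "y > 0" for y m
    using exp_neg_inverse_bound[OF assms that, of m 0] exp_neg_inverse_bound[OF assms that, of m 2]
    unfolding A_def B_def by simp_all
  show thesis
  proof
    fix x y assume x: "\<not> (a < x \<and> x < b)"
    show "bump a b c i j y \<le> (B i * A j + A i * B j) * (y - x)\<^sup>2"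
    proof (cases "a < y \<and> y < b")
      case False
      then show ?thesis unfolding bump_def if_not_P[OF False] by (simp add: nn)
    next
      case True
      define u where "u = (exp (- c / (y - a)) / (y - a) ^ i)"
      define v where "v = (exp (- c / (b - y)) / (b - y) ^ j)"
      have uv: "0 \<le> u" "0 \<le> v" "u \<le> A i" "v \<le> A j" "u \<le> B i * (y - a)\<^sup>2" "v \<le> B j * (b - y)\<^sup>2"
        using True bA[of "y - a"] bB[of "y - a"] bA[of "b - y"] bB[of "b - y"]
        by (auto simp: u_def v_def)
      have "u * v \<le> (B i * A j + A i * B j) * (y - x)\<^sup>2"
      proof (cases "x \<le> a")
        case xa: True
        have "(y - a)\<^sup>2 \<le> (y - x)\<^sup>2" using True xa by (intro power_mono) auto
        then have "B i * (y - a)\<^sup>2 \<le> B i * (y - x)\<^sup>2" using nn by (intro mult_left_mono) auto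
        then have "u * v \<le> (B i * (y - x)\<^sup>2) * A j" using uv nn by (intro mult_mono) auto
        moreover have "0 \<le> A i * B j * (y - x)\<^sup>2" using nn by simp
        ultimately show ?thesis by (simp add: algebra_simps)
      next
        case False
        have "(b - y)\<^sup>2 \<le> (x - y)\<^sup>2" using True False x by (intro power_mono) auto
        then have "B j * (b - y)\<^sup>2 \<le> B j * (y - x)\<^sup>2"
          using nn by (intro mult_left_mono) (auto simp: power2_commute)
        then have "u * v \<le> A i * (B j * (y - x)\<^sup>2)" using uv nn by (intro mult_mono) auto
        moreover have "0 \<le> B i * A j * (y - x)\<^sup>2" using nn by simp
        ultimately show ?thesis by (simp add: algebra_simps)
      qed
      then show ?thesis using True by (simp add: bump_def u_def v_def)
    qed
  qed
qed

lemma DERIV_zero_if_quadratic: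
  fixes f :: "real \<Rightarrow> real"
  assumes "\<And>y. \<bar>f y\<bar> \<le> K * (y - x)\<^sup>2"
  shows "(f has_real_derivative 0) (at x)"
proof -
  have f0: "f x = 0" using assms[of x] by simp
  have "((\<lambda>y. (f y - f x) / (y - x)) \<longlongrightarrow> 0) (at x)"
  proof (rule Lim_null_comparison)
    show "\<forall>\<^sub>F y in at x. norm ((f y - f x) / (y - x)) \<le> K * \<bar>y - x\<bar>"
      unfolding eventually_at_filter
    proof (intro always_eventually allI impI)
      fix y assume "y \<noteq> x"
      then show "norm ((f y - f x) / (y - x)) \<le> K * \<bar>y - x\<bar>"
        using assms[of y] f0 by (simp add: field_simps power2_eq_square abs_mult[symmetric])
    qed
    have "((\<lambda>y. K * \<bar>y - x\<bar>) \<longlongrightarrow> K * \<bar>x - x\<bar>) (at x)" by (intro tendsto_intros)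
    then show "((\<lambda>y. K * \<bar>y - x\<bar>) \<longlongrightarrow> 0) (at x)" by simp
  qed
  then show ?thesis by (simp add: has_field_derivative_iff)
qed

lemma bump_has_derivative:
  assumes "c > 0"
  shows "(bump a b c i j has_real_derivative
     c * bump a b c (i + 2) j x + - c * bump a b c i (j + 2) x
     + (- real i * bump a b c (i + 1) j x + real j * bump a b c i (j + 1) x)) (at x)"
proof (cases "a < x \<and> x < b")
  case False
  obtain K where K: "\<And>y. bump a b c i j y \<le> K * (y - x)\<^sup>2"
    using bump_quadratic_bound[OF assms] False by metis
  have "(bump a b c i j has_real_derivative 0) (at x)"
    by (rule DERIV_zero_if_quadratic) (use K bump_nonneg in auto)
  moreover have "bump a b c k l x = 0" for k l unfolding bump_def if_not_P[OF False] ..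
  ultimately show ?thesis by simp
next
  case True
  let ?f = "\<lambda>x. (exp (- c / (x - a)) / (x - a) ^ i) * (exp (- c / (b - x)) / (b - x) ^ j)"
  define p where "p = x - a"
  define q where "q = b - x"
  have pq: "p > 0" "q > 0" using True by (auto simp: p_def q_def)
  have d1: "((\<lambda>x. exp (- c / (x - a))) has_real_derivative exp (- c / p) * (c / p\<^sup>2)) (at x)"
    using pq unfolding p_def by (auto intro!: derivative_eq_intros simp: power2_eq_square)
  have d2: "((\<lambda>x. (x - a) ^ i) has_real_derivative real i * p ^ (i - 1)) (at x)"
    unfolding p_def by (auto intro!: derivative_eq_intros)
  have d3: "((\<lambda>x. exp (- c / (b - x))) has_real_derivative exp (- c / q) * (- c / q\<^sup>2)) (at x)"
    using pq unfolding q_def by (auto intro!: derivative_eq_intros simp: power2_eq_square)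
  have d4: "((\<lambda>x. (b - x) ^ j) has_real_derivative - (real j * q ^ (j - 1))) (at x)"
    unfolding q_def by (auto intro!: derivative_eq_intros)
  have dp: "((\<lambda>x. exp (- c / (x - a)) / (x - a) ^ i) has_real_derivative
       (c * (exp (- c / p) / p ^ (i + 2)) - real i * (exp (- c / p) / p ^ (i + 1)))) (at x)"
  proof (rule DERIV_cong[OF DERIV_divide[OF d1 d2]])
    \<comment> \<open>\<open>i - 1\<close> is truncated at 0; the factor \<open>real i\<close> makes
      the identity hold for \<open>i = 0\<close> as well.\<close>
    have "exp (- c / p) * (real i * p ^ (i - 1)) * (p * p) = exp (- c / p) * real i * p ^ i * p"
      by (cases i) auto
    then show "(exp (- c / p) * (c / p\<^sup>2) * (x - a) ^ i - exp (- c / (x - a)) * (real i * p ^ (i - 1))) /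
        ((x - a) ^ i * (x - a) ^ i) =
      c * (exp (- c / p) / p ^ (i + 2)) - real i * (exp (- c / p) / p ^ (i + 1))"
      using pq unfolding p_def[symmetric] by (auto simp: field_simps power2_eq_square)
  qed (use pq p_def in auto)
  have dq: "((\<lambda>x. exp (- c / (b - x)) / (b - x) ^ j) has_real_derivative
       (- c * (exp (- c / q) / q ^ (j + 2)) + real j * (exp (- c / q) / q ^ (j + 1)))) (at x)"
  proof (rule DERIV_cong[OF DERIV_divide[OF d3 d4]])
    have "exp (- c / q) * (real j * q ^ (j - 1)) * (q * q) = exp (- c / q) * real j * q ^ j * q"
      by (cases j) auto
    then show "(exp (- c / q) * (- c / q\<^sup>2) * (b - x) ^ j - exp (- c / (b - x)) * - (real j * q ^ (j - 1))) /
        ((b - x) ^ j * (b - x) ^ j) =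
      - c * (exp (- c / q) / q ^ (j + 2)) + real j * (exp (- c / q) / q ^ (j + 1))"
      using pq unfolding q_def[symmetric] by (auto simp: field_simps power2_eq_square)
  qed (use pq q_def in auto)
  have "(?f has_real_derivative
     c * bump a b c (i + 2) j x + - c * bump a b c i (j + 2) x
     + (- real i * bump a b c (i + 1) j x + real j * bump a b c i (j + 1) x)) (at x)"
    by (rule DERIV_cong[OF DERIV_mult[OF dp dq]])
       (use True in \<open>simp add: bump_def p_def[symmetric] q_def[symmetric] algebra_simps\<close>)
  moreover have "\<forall>\<^sub>F y in nhds x. bump a b c i j y = ?f y"
  proof -
    have "\<forall>\<^sub>F y in nhds x. y \<in> {a<..<b}" using True by (intro eventually_nhds_in_open) auto
    then show ?thesis by eventually_elim (simp add: bump_def)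
  qed
  ultimately show ?thesis using DERIV_cong_ev[of x x "bump a b c i j" ?f] by blast
qed

text \<open>The linear span, on which \<open>deriv\<close> acts. Since \<open>test_function\<close>
  speaks of all iterates of \<open>deriv\<close>, smoothness then follows by one induction instead
  of a formula for the n-th derivative.\<close>

inductive_set bumps :: "(real \<Rightarrow> real) set" where
  bump: "c > 0 \<Longrightarrow> bump a b c i j \<in> bumps"
| add: "\<phi> \<in> bumps \<Longrightarrow> \<psi> \<in> bumps \<Longrightarrow> (\<lambda>x. \<phi> x + \<psi> x) \<in> bumps"
| scale: "\<phi> \<in> bumps \<Longrightarrow> (\<lambda>x. k * \<phi> x) \<in> bumps"

lemma bumps_derivative:
  assumes "\<phi> \<in> bumps"
  shows "\<exists>\<phi>'\<in>bumps. \<forall>x. (\<phi> has_real_derivative \<phi>' x) (at x)"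
  using assms
proof induction
  case (bump c a b i j)
  show ?case
    by (rule bexI, rule allI, rule bump_has_derivative[OF bump]) (intro bumps.intros bump)
next
  case (add \<phi> \<psi>)
  then obtain \<phi>' \<psi>' where "\<phi>' \<in> bumps" "\<psi>' \<in> bumps" and
    "\<And>x. (\<phi> has_real_derivative \<phi>' x) (at x)" "\<And>x. (\<psi> has_real_derivative \<psi>' x) (at x)" by blast
  then show ?case by (intro bexI[of _ "\<lambda>x. \<phi>' x + \<psi>' x"] allI DERIV_add bumps.add)
next
  case (scale \<phi> k)
  then obtain \<phi>' where "\<phi>' \<in> bumps" "\<And>x. (\<phi> has_real_derivative \<phi>' x) (at x)" by blast
  then show ?case by (intro bexI[of _ "\<lambda>x. k * \<phi>' x"] allI DERIV_cmult bumps.scale)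
qed

lemma bumps_higher_deriv:
  assumes "\<phi> \<in> bumps" shows "(deriv ^^ n) \<phi> \<in> bumps"
proof (induction n)
  case 0 then show ?case using assms by simp
next
  case (Suc n)
  from bumps_derivative[OF this] obtain \<phi>' where "\<phi>' \<in> bumps"
    "\<And>x. ((deriv ^^ n) \<phi> has_real_derivative \<phi>' x) (at x)" by blast
  moreover then have "(deriv ^^ Suc n) \<phi> = \<phi>'" by (auto intro: DERIV_imp_deriv)
  ultimately show ?case by simp
qed

lemma bumps_smooth:
  assumes "\<phi> \<in> bumps" shows "(deriv ^^ n) \<phi> field_differentiable (at x)"
  using bumps_derivative[OF bumps_higher_deriv[OF assms, of n]]
  by (auto simp: field_differentiable_def)

lemma bumps_continuous: "\<phi> \<in> bumps \<Longrightarrow> isCont \<phi> x"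
  using bumps_derivative DERIV_isCont by blast

text \<open>Made for antiderivatives: they need not lie in \<open>bumps\<close>, only their
  derivatives do.\<close>

lemma smooth_if_deriv_in_bumps:
  assumes "\<psi> \<in> bumps" "\<And>x. (\<phi> has_real_derivative \<psi> x) (at x)"
  shows "(deriv ^^ n) \<phi> field_differentiable (at x)"
proof (cases n)
  case 0 then show ?thesis using assms(2) by (auto simp: field_differentiable_def)
next
  case (Suc m)
  have "deriv \<phi> = \<psi>" using assms(2) by (auto intro: DERIV_imp_deriv)
  then have "(deriv ^^ n) \<phi> = (deriv ^^ m) \<psi>" unfolding Suc funpow_Suc_right by simp
  then show ?thesis using bumps_smooth[OF assms(1)] by simp
qed

section \<open>The du Bois-Reymond lemma\<close>

text \<open>On (-n, n] both functions are densities of finite measures. These agree on all rays,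
  hence coincide, and densities are unique almost everywhere.\<close>

lemma AE_eq_if_integrals_Ioc_eq:
  fixes p q :: "real \<Rightarrow> real"
  assumes p: "\<And>R. set_integrable lborel {-R..R} p" and q: "\<And>R. set_integrable lborel {-R..R} q"
    and [measurable]: "p \<in> borel_measurable borel" "q \<in> borel_measurable borel"
    and p0: "\<And>x. 0 \<le> p x" and q0: "\<And>x. 0 \<le> q x"
    and eq: "\<And>a b. a < b \<Longrightarrow> (LBINT x:{a<..b}. p x) = (LBINT x:{a<..b}. q x)"
  shows "AE x in lborel. p x = q x"
proof -
  have sub: "set_integrable lborel {a<..b} f" if "\<And>R. set_integrable lborel {-R..R} f"
    for a b and f :: "real \<Rightarrow> real"
    by (rule set_integrable_subset[OF that[of "max \<bar>a\<bar> \<bar>b\<bar>"]]) auto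
  have nn: "(\<integral>\<^sup>+x. ennreal (f x) * indicator {a<..b} x \<partial>lborel) = ennreal (LBINT x:{a<..b}. f x)"
    if "\<And>R. set_integrable lborel {-R..R} f" "\<And>x. 0 \<le> f x" for a b and f :: "real \<Rightarrow> real"
  proof -
    have "(\<integral>\<^sup>+x. ennreal (f x) * indicator {a<..b} x \<partial>lborel)
        = (\<integral>\<^sup>+x. ennreal (indicator {a<..b} x *\<^sub>R f x) \<partial>lborel)"
      by (intro nn_integral_cong) (auto simp: indicator_def)
    also have "\<dots> = ennreal (LBINT x:{a<..b}. f x)"
      unfolding set_lebesgue_integral_def
      by (intro nn_integral_eq_integral) (use sub[of f] that in \<open>auto simp: set_integrable_def\<close>)
    finally show ?thesis .
  qed
  have "AE x in lborel. x \<in> {-real n<..real n} \<longrightarrow> p x = q x" for n :: nat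
  proof -
    let ?M = "\<lambda>f::real\<Rightarrow>real. density lborel (\<lambda>x. ennreal (f x) * indicator {-real n<..real n} x)"
    have em: "emeasure (?M f) {x<..} = ennreal (LBINT x:{max x (-real n)<..real n}. f x)"
      if "\<And>R. set_integrable lborel {-R..R} f" "\<And>x. 0 \<le> f x"
        and [measurable]: "f \<in> borel_measurable borel" for x and f :: "real \<Rightarrow> real"
    proof -
      have "emeasure (?M f) {x<..} = (\<integral>\<^sup>+y. ennreal (f y) * indicator {max x (-real n)<..real n} y \<partial>lborel)"
        by (subst emeasure_density) (auto simp: indicator_def intro!: nn_integral_cong)
      then show ?thesis using nn[of f] that by simp
    qed
    have "?M p = ?M q"
    proof (rule measure_eqI_lessThan)
      fix x
      show "emeasure (?M p) {x<..} < \<infinity>" using em[OF p p0] by simp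
      show "emeasure (?M p) {x<..} = emeasure (?M q) {x<..}"
      proof (cases "max x (- real n) < real n")
        case True
        then show ?thesis using em[OF p p0] em[OF q q0] eq by simp
      next
        case False
        then have "{max x (- real n)<..real n} = {}" by auto
        then show ?thesis using em[OF p p0, of x] em[OF q q0, of x]
          by (simp only: set_lebesgue_integral_def) simp
      qed
    qed auto
    then have "AE x in lborel. ennreal (p x) * indicator {-real n<..real n} x
        = ennreal (q x) * indicator {-real n<..real n} x"
      by (subst (asm) sigma_finite_measure.density_unique_iff[OF lborel.sigma_finite_measure_axioms]) auto
    then show ?thesis by eventually_elim (use p0 q0 in \<open>auto simp: indicator_def split: if_splits\<close>)
  qed
  then have "AE x in lborel. \<forall>n::nat. x \<in> {-real n<..real n} \<longrightarrow> p x = q x"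
    by (simp only: AE_all_countable) simp
  then show ?thesis
  proof eventually_elim
    case (elim x)
    obtain n :: nat where "\<bar>x\<bar> < real n" using reals_Archimedean2 by blast
    then show ?case using elim[rule_format, of n] by (auto simp: abs_less_iff)
  qed
qed

text \<open>Positive and negative part have equal integrals over every interval, so they agree
  almost everywhere and both vanish.\<close>

lemma AE_zero_if_integrals_Ioc_zero:
  fixes v :: "real \<Rightarrow> real"
  assumes v: "\<And>R. set_integrable lborel {-R..R} v" and [measurable]: "v \<in> borel_measurable borel"
    and eq: "\<And>a b. a < b \<Longrightarrow> (LBINT x:{a<..b}. v x) = 0"
  shows "AE x in lborel. v x = 0"
proof -
  have i1: "set_integrable lborel {-R..R} (\<lambda>x. max 0 (v x))" for R
  proof -
    have "integrable lborel (\<lambda>x. max 0 (indicator {-R..R} x *\<^sub>R v x))"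
      using v[of R] by (auto simp: set_integrable_def)
    then show ?thesis unfolding set_integrable_def
      by (rule Bochner_Integration.integrable_cong[THEN iffD1, rotated 2]) (auto simp: indicator_def)
  qed
  have i2: "set_integrable lborel {-R..R} (\<lambda>x. max 0 (- v x))" for R
  proof -
    have "integrable lborel (\<lambda>x. max 0 (- (indicator {-R..R} x *\<^sub>R v x)))"
      using v[of R] by (auto simp: set_integrable_def)
    then show ?thesis unfolding set_integrable_def
      by (rule Bochner_Integration.integrable_cong[THEN iffD1, rotated 2]) (auto simp: indicator_def)
  qed
  have "AE x in lborel. max 0 (v x) = max 0 (- v x)"
  proof (rule AE_eq_if_integrals_Ioc_eq)
    fix a b :: real assume ab: "a < b"
    have sub: "set_integrable lborel {a<..b} f" if "\<And>R. set_integrable lborel {-R..R} f"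
      for f :: "real \<Rightarrow> real"
      by (rule set_integrable_subset[OF that[of "max \<bar>a\<bar> \<bar>b\<bar>"]]) auto
    have "(LBINT x:{a<..b}. max 0 (v x)) - (LBINT x:{a<..b}. max 0 (- v x))
        = (LBINT x:{a<..b}. max 0 (v x) - max 0 (- v x))"
      by (intro set_integral_diff(2)[symmetric] sub i1 i2)
    also have "\<dots> = (LBINT x:{a<..b}. v x)" by (intro set_lebesgue_integral_cong) auto
    finally show "(LBINT x:{a<..b}. max 0 (v x)) = (LBINT x:{a<..b}. max 0 (- v x))"
      using eq[OF ab] by simp
  qed (use i1 i2 in auto)
  then show ?thesis by eventually_elim (auto simp: max_def split: if_splits)
qed

section \<open>Test functions as antiderivatives of bumps of mean zero\<close>

lemma continuous_antiderivative:
  fixes f :: "real \<Rightarrow> real"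
  assumes "\<And>x. isCont f x"
  obtains F where "\<And>x. (F has_real_derivative f x) (at x)"
  using einterval_antiderivative[of "-\<infinity>" "\<infinity>" f] assms
  by (auto simp: has_real_derivative_iff_has_vector_derivative)

text \<open>The primitive started at -R is constant beyond R, with the total integral as its value
  there; mean zero is thus exactly what gives compact support.\<close>

lemma test_function_primitive:
  assumes \<psi>: "\<psi> \<in> bumps" and supp: "\<And>x. R \<le> \<bar>x\<bar> \<Longrightarrow> \<psi> x = 0" and "R > 0"
    and int0: "(LBINT x. \<psi> x) = 0"
  obtains \<phi> where "test_function \<phi>" "deriv \<phi> = \<psi>"
proof -
  obtain G where G: "\<And>x. (G has_real_derivative \<psi> x) (at x)"
    using continuous_antiderivative[of \<psi>] bumps_continuous[OF \<psi>] by blast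
  define \<phi> where "\<phi> = (\<lambda>x. G x - G (-R))"
  have d: "(\<phi> has_real_derivative \<psi> x) (at x)" for x
    unfolding \<phi>_def using DERIV_diff[OF G DERIV_const] by simp
  have "G R - G (-R) = (LBINT x. \<psi> x * indicator {-R..R} x)"
    by (subst integral_FTC_Icc_real[of "-R" R G \<psi>]) (use \<open>R > 0\<close> G bumps_continuous[OF \<psi>] in auto)
  also have "\<dots> = (LBINT x. \<psi> x)"
  proof (intro Bochner_Integration.integral_cong refl)
    fix x show "\<psi> x * indicator {-R..R} x = \<psi> x"
      using supp[of x] by (cases "R \<le> \<bar>x\<bar>") (auto simp: indicator_def)
  qed
  finally have GR: "G R = G (-R)" using int0 by simp
  have contG: "continuous_on S G" for S
    using G by (meson DERIV_continuous continuous_at_imp_continuous_on)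
  have z: "\<phi> x = 0" if xR: "R \<le> \<bar>x\<bar>" for x
  proof -
    have d0: "(G has_real_derivative 0) (at y)" if "R \<le> \<bar>y\<bar>" for y
      using G[of y] supp[OF that] by simp
    consider "x < -R" | "x = -R" | "x = R" | "x > R" using xR by linarith
    then have "G x = G (-R)"
    proof cases
      case 1
      then have "G (-R) = G x"
        by (intro DERIV_isconst_end contG d0) (use \<open>R > 0\<close> in auto)
      then show ?thesis by simp
    next
      case 4
      then have "G x = G R" by (intro DERIV_isconst_end contG d0) (use \<open>R > 0\<close> in auto)
      then show ?thesis using GR by simp
    qed (use GR in auto)
    then show ?thesis by (simp add: \<phi>_def)
  qed
  show thesis
  proof
    show "deriv \<phi> = \<psi>" using d by (auto intro: DERIV_imp_deriv)
    have "closure {x. \<phi> x \<noteq> 0} \<subseteq> {-R..R}" by (intro closure_minimal) (use z in \<open>force+\<close>)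
    then have "compact (closure {x. \<phi> x \<noteq> 0})"
      by (metis bounded_closed_interval bounded_subset closed_closure compact_eq_bounded_closed)
    then show "test_function \<phi>"
      unfolding test_function_def using smooth_if_deriv_in_bumps[OF \<psi> d] by blast
  qed
qed

lemma bump_le_indicator: "c > 0 \<Longrightarrow> bump a b c 0 0 x \<le> indicator {a<..<b} x"
proof -
  assume "c > 0"
  then have "exp (- c / (x - a)) * exp (- c / (b - x)) \<le> 1 * 1" if "a < x" "x < b"
    using that by (intro mult_mono) auto
  then show ?thesis by (auto simp: bump_def indicator_def)
qed

lemma bump_tendsto_indicator:
  "(\<lambda>n. bump a b (1 / real (Suc n)) 0 0 x) \<longlonglongrightarrow> indicator {a<..<b} x"
proof (cases "a < x \<and> x < b")
  case True
  have "(\<lambda>n. 1 / real (Suc n)) \<longlonglongrightarrow> 0" by (rule LIMSEQ_Suc[OF lim_1_over_n])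
  then have "(\<lambda>n. exp (- (1 / real (Suc n)) / (x - a)) * exp (- (1 / real (Suc n)) / (b - x)))
      \<longlonglongrightarrow> exp (- 0 / (x - a)) * exp (- 0 / (b - x))"
    using True by (intro tendsto_intros) auto
  then show ?thesis using True by (simp add: bump_def)
qed (auto simp: bump_def)

lemma bump_measurable [measurable]: "c > 0 \<Longrightarrow> bump a b c i j \<in> borel_measurable borel"
  by (intro borel_measurable_continuous_onI continuous_at_imp_continuous_on ballI
      bumps_continuous bumps.bump)

lemma integrable_mult_compact_support:
  fixes w \<psi> :: "real \<Rightarrow> real"
  assumes w: "\<And>R. set_integrable lborel {-R..R} w" and [measurable]: "w \<in> borel_measurable borel"
    "\<psi> \<in> borel_measurable borel"
    and B: "\<And>x. \<bar>\<psi> x\<bar> \<le> B" and supp: "\<And>x. R < \<bar>x\<bar> \<Longrightarrow> \<psi> x = 0"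
  shows "integrable lborel (\<lambda>x. w x * \<psi> x)"
proof (rule Bochner_Integration.integrable_bound)
  show "integrable lborel (\<lambda>x. B * (indicator {-R..R} x *\<^sub>R w x))"
    using w[of R] by (simp add: set_integrable_def)
  have "\<bar>w x * \<psi> x\<bar> \<le> \<bar>B * (indicator {-R..R} x * w x)\<bar>" for x
  proof (cases "R < \<bar>x\<bar>")
    case False
    then have "x \<in> {-R..R}" by auto
    moreover have "\<bar>w x\<bar> * \<bar>\<psi> x\<bar> \<le> \<bar>w x\<bar> * \<bar>B\<bar>" using B[of x] by (intro mult_left_mono) auto
    ultimately show ?thesis by (simp add: abs_mult mult.commute)
  qed (simp add: supp)
  then show "AE x in lborel. norm (w x * \<psi> x) \<le> norm (B * (indicator {-R..R} x *\<^sub>R w x))"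
    by simp
qed measurable

text \<open>
  Two bumps, scaled to equal integrals, differ by the derivative of a test function. As the bumps tend to
  indicators, the integral of \<open>w\<close> over an interval is proportional to its length.
\<close>

theorem du_Bois_Reymond:
  fixes w :: "real \<Rightarrow> real"
  assumes w: "\<And>R. set_integrable lborel {-R..R} w" and [measurable]: "w \<in> borel_measurable borel"
    and test: "\<And>\<phi>. test_function \<phi> \<Longrightarrow> (LBINT x. w x * deriv \<phi> x) = 0"
  obtains m where "AE x in lborel. w x = m"
proof -
  define \<beta> where "\<beta> = (\<lambda>a b n. bump a b (1 / real (Suc n)) 0 0)"
  have [measurable]: "\<beta> a b n \<in> borel_measurable borel" for a b n
    unfolding \<beta>_def by (rule bump_measurable) simp
  have \<beta>_nn: "0 \<le> \<beta> a b n x" for a b n x unfolding \<beta>_def by (rule bump_nonneg)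
  have \<beta>_le: "\<beta> a b n x \<le> indicator {a<..<b} x" for a b n x
    unfolding \<beta>_def by (rule bump_le_indicator) simp
  have \<beta>_supp: "\<beta> a b n x = 0" if "\<bar>a\<bar> + \<bar>b\<bar> < \<bar>x\<bar>" for a b n x
    using that by (auto simp: \<beta>_def bump_def)
  have \<beta>_1: "\<bar>\<beta> a b n x\<bar> \<le> 1" for a b n x
    using \<beta>_nn[of a b n x] \<beta>_le[of a b n x] by (cases "x \<in> {a<..<b}") auto
  have lim: "(\<lambda>n. LBINT x. v x * \<beta> a b n x) \<longlonglongrightarrow> (LBINT x:{a<..<b}. v x)"
    if v: "\<And>R. set_integrable lborel {-R..R} v" and [measurable]: "v \<in> borel_measurable borel"
    for v a b
    unfolding set_lebesgue_integral_def
  proof (rule integral_dominated_convergence[where w = "\<lambda>x. \<bar>indicator {-(\<bar>a\<bar>+\<bar>b\<bar>)..\<bar>a\<bar>+\<bar>b\<bar>} x *\<^sub>R v x\<bar>"])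
    show "integrable lborel (\<lambda>x. \<bar>indicator {-(\<bar>a\<bar>+\<bar>b\<bar>)..\<bar>a\<bar>+\<bar>b\<bar>} x *\<^sub>R v x\<bar>)"
      using v[of "\<bar>a\<bar>+\<bar>b\<bar>"] unfolding set_integrable_def by (rule integrable_abs)
    show "AE x in lborel. (\<lambda>n. v x * \<beta> a b n x) \<longlonglongrightarrow> indicator {a<..<b} x *\<^sub>R v x"
    proof (rule AE_I2)
      fix x
      have "(\<lambda>n. v x * \<beta> a b n x) \<longlonglongrightarrow> v x * indicator {a<..<b} x"
        unfolding \<beta>_def by (intro tendsto_mult tendsto_const bump_tendsto_indicator)
      then show "(\<lambda>n. v x * \<beta> a b n x) \<longlonglongrightarrow> indicator {a<..<b} x *\<^sub>R v x" by (simp add: mult.commute)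
    qed
    fix n
    have "\<bar>v x * \<beta> a b n x\<bar> \<le> \<bar>indicator {-(\<bar>a\<bar>+\<bar>b\<bar>)..\<bar>a\<bar>+\<bar>b\<bar>} x * v x\<bar>" for x
    proof (cases "\<bar>a\<bar> + \<bar>b\<bar> < \<bar>x\<bar>")
      case False
      then have "x \<in> {-(\<bar>a\<bar>+\<bar>b\<bar>)..\<bar>a\<bar>+\<bar>b\<bar>}" by auto
      moreover have "\<bar>v x\<bar> * \<bar>\<beta> a b n x\<bar> \<le> \<bar>v x\<bar> * 1" using \<beta>_1 by (intro mult_left_mono) auto
      ultimately show ?thesis by (simp add: abs_mult)
    next
      case True
      from \<beta>_supp[OF this] show ?thesis by simp
    qed
    then show "AE x in lborel. norm (v x * \<beta> a b n x) \<le> \<bar>indicator {-(\<bar>a\<bar>+\<bar>b\<bar>)..\<bar>a\<bar>+\<bar>b\<bar>} x *\<^sub>R v x\<bar>"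
      unfolding real_norm_def real_scaleR_def by (intro AE_I2)
  qed (measurable)
  have one: "set_integrable lborel {-R..R} (\<lambda>x. 1 :: real)" for R :: real
    by (rule borel_integrable_atLeastAtMost') simp
  have swap: "(b - a) * (LBINT x:{c<..<d}. w x) = (d - c) * (LBINT x:{a<..<b}. w x)"
    if ab: "a < b" "c < d" for a b c d
  proof -
    define R where "R = \<bar>a\<bar> + \<bar>b\<bar> + \<bar>c\<bar> + \<bar>d\<bar> + 1"
    define A where "A = (\<lambda>n. LBINT x. 1 * \<beta> a b n x)"
    define C where "C = (\<lambda>n. LBINT x. 1 * \<beta> c d n x)"
    have "A n * (LBINT x. w x * \<beta> c d n x) = C n * (LBINT x. w x * \<beta> a b n x)" for n
    proof -
      define \<psi> where "\<psi> = (\<lambda>x. A n * \<beta> c d n x + - C n * \<beta> a b n x)"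
      have i: "integrable lborel (\<lambda>x. v x * \<beta> a b n x)"
        if "\<And>R. set_integrable lborel {-R..R} v" "v \<in> borel_measurable borel" for v a b
        by (rule integrable_mult_compact_support[OF that, of _ 1 "\<bar>a\<bar> + \<bar>b\<bar>"])
           (use \<beta>_1 \<beta>_supp in auto)
      have "\<psi> \<in> bumps" unfolding \<psi>_def \<beta>_def by (intro bumps.intros) simp_all
      moreover have "\<psi> x = 0" if "R \<le> \<bar>x\<bar>" for x
      proof -
        have "\<beta> a b n x = 0" "\<beta> c d n x = 0" by (rule \<beta>_supp; use that in \<open>simp add: R_def\<close>)+
        then show ?thesis by (simp add: \<psi>_def)
      qed
      moreover have "R > 0" by (simp add: R_def)
      moreover have "(LBINT x. \<psi> x) = A n * (LBINT x. 1 * \<beta> c d n x) - C n * (LBINT x. 1 * \<beta> a b n x)"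
        unfolding \<psi>_def using i[OF one, of a b] i[OF one, of c d] by simp
      then have "(LBINT x. \<psi> x) = 0" by (simp add: A_def C_def)
      ultimately obtain \<phi> where "test_function \<phi>" "deriv \<phi> = \<psi>"
        by (rule test_function_primitive)
      then have "(LBINT x. w x * \<psi> x) = 0" using test by metis
      also have "(\<lambda>x. w x * \<psi> x) = (\<lambda>x. A n * (w x * \<beta> c d n x) - C n * (w x * \<beta> a b n x))"
        by (simp add: \<psi>_def algebra_simps)
      also have "(LBINT x. A n * (w x * \<beta> c d n x) - C n * (w x * \<beta> a b n x))
          = A n * (LBINT x. w x * \<beta> c d n x) - C n * (LBINT x. w x * \<beta> a b n x)"
        using i[OF w, of a b] i[OF w, of c d] by simp
      finally show ?thesis by simp
    qed
    moreover have "(\<lambda>n. A n * (LBINT x. w x * \<beta> c d n x)) \<longlonglongrightarrow>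
        (LBINT x:{a<..<b}. 1) * (LBINT x:{c<..<d}. w x)"
      unfolding A_def by (intro tendsto_mult lim w one) auto
    moreover have "(\<lambda>n. C n * (LBINT x. w x * \<beta> a b n x)) \<longlonglongrightarrow>
        (LBINT x:{c<..<d}. 1) * (LBINT x:{a<..<b}. w x)"
      unfolding C_def by (intro tendsto_mult lim w one) auto
    ultimately have "(LBINT x:{a<..<b}. 1) * (LBINT x:{c<..<d}. w x)
        = (LBINT x:{c<..<d}. 1) * (LBINT x:{a<..<b}. w x)"
      using LIMSEQ_unique by (metis (no_types, lifting) ext)
    then show ?thesis using ab by (simp add: set_lebesgue_integral_def)
  qed
  \<comment> \<open>The unit interval serves as reference: \<open>swap\<close> turns the integral
    over (a, b) into (b - a) m.\<close>
  define m where "m = (LBINT x:{0<..<1}. w x)"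
  have "AE x in lborel. w x - m = 0"
  proof (rule AE_zero_if_integrals_Ioc_zero)
    show wm: "set_integrable lborel {-R..R} (\<lambda>x. w x - m)" for R
      by (intro set_integral_diff w borel_integrable_atLeastAtMost') simp
    fix a b :: real assume ab: "a < b"
    have sub: "set_integrable lborel {a<..<b} w"
      by (rule set_integrable_subset[OF w[of "max \<bar>a\<bar> \<bar>b\<bar>"]]) auto
    have "(LBINT x:{a<..b}. w x - m) = (LBINT x:{a<..<b}. w x - m)"
      unfolding set_lebesgue_integral_def
    proof (rule integral_cong_AE)
      show "AE x in lborel. indicator {a<..b} x *\<^sub>R (w x - m) = indicator {a<..<b} x *\<^sub>R (w x - m)"
        using AE_lborel_singleton[of b] by eventually_elim (auto simp: indicator_def)
    qed measurable
    also have "\<dots> = (LBINT x:{a<..<b}. w x) - (LBINT x:{a<..<b}. m)"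
      by (intro set_integral_diff sub set_integrable_subset[OF borel_integrable_atLeastAtMost'[of a b]]) auto
    also have "(LBINT x:{a<..<b}. m) = (b - a) * m" using ab by (simp add: set_lebesgue_integral_def)
    also have "(LBINT x:{a<..<b}. w x) = (b - a) * m" using swap[OF ab, of 0 1] by (simp add: m_def)
    finally show "(LBINT x:{a<..b}. w x - m) = 0" by simp
  qed measurable
  then have "AE x in lborel. w x = m" by simp
  then show thesis by (rule that)
qed

section \<open>Functions of bounded variation\<close>

definition stieltjes :: "real measure \<Rightarrow> real \<Rightarrow> real" where
  "stieltjes P x = (if 0 \<le> x then measure P {0<..x} else - measure P {x<..0})"

locale radon_measure =
  fixes P :: "real measure"
  assumes sets_eq [measurable_cong, simp]: "sets P = sets borel"
    and finite_Icc: "emeasure P {a..b} < \<infinity>"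
begin

lemma space_eq [simp]: "space P = UNIV"
  using sets_eq_imp_space_eq[OF sets_eq] by simp

lemma finite_subset_Icc: "A \<subseteq> {a..b} \<Longrightarrow> emeasure P A < \<infinity>"
  using emeasure_mono[of A "{a..b}" P] finite_Icc[of a b] by (auto intro: order.strict_trans1)

lemma finite_Ioc: "emeasure P {a<..b} < \<infinity>"
  by (rule finite_subset_Icc[of _ a b]) auto

lemma measure_Ioc_add: "a \<le> b \<Longrightarrow> b \<le> c \<Longrightarrow> measure P {a<..c} = measure P {a<..b} + measure P {b<..c}"
proof -
  assume ab: "a \<le> b" "b \<le> c"
  have "measure P ({a<..b} \<union> {b<..c}) = measure P {a<..b} + measure P {b<..c}"
    by (intro measure_Union) (use finite_Ioc[of a b] finite_Ioc[of b c] in \<open>auto simp: less_top\<close>)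
  moreover have "{a<..b} \<union> {b<..c} = {a<..c}" using ab by auto
  ultimately show ?thesis by simp
qed

lemma stieltjes_diff: "x \<le> y \<Longrightarrow> stieltjes P y - stieltjes P x = measure P {x<..y}"
  using measure_Ioc_add[of x 0 y] measure_Ioc_add[of 0 x y] measure_Ioc_add[of x y 0]
  by (auto simp: stieltjes_def)

lemma mono_stieltjes: "mono (stieltjes P)"
  by (metis diff_ge_0_iff_ge measure_nonneg monoI stieltjes_diff)

lemma stieltjes_measurable [measurable]: "stieltjes P \<in> borel_measurable borel"
  by (rule borel_measurable_mono[OF mono_stieltjes])

lemma stieltjes_set_integrable: "set_integrable lborel {-R..R} (stieltjes P)"
proof (rule set_integrable_bound[where f = "\<lambda>_. \<bar>stieltjes P (-R)\<bar> + \<bar>stieltjes P R\<bar>"])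
  show "set_integrable lborel {- R..R} (\<lambda>_. \<bar>stieltjes P (- R)\<bar> + \<bar>stieltjes P R\<bar>)"
    by (rule borel_integrable_atLeastAtMost') simp
  have "norm (stieltjes P x) \<le> norm (\<bar>stieltjes P (- R)\<bar> + \<bar>stieltjes P R\<bar>)" if "x \<in> {-R..R}" for x
  proof -
    have "stieltjes P (- R) \<le> stieltjes P x" "stieltjes P x \<le> stieltjes P R"
      using that by (auto intro: monoD[OF mono_stieltjes])
    then show ?thesis by auto
  qed
  then show "AE x in lborel. x \<in> {- R..R} \<longrightarrow>
      norm (stieltjes P x) \<le> norm (\<bar>stieltjes P (- R)\<bar> + \<bar>stieltjes P R\<bar>)" by simp
qed (simp add: set_borel_measurable_def)

end

lemma test_functionD:
  assumes "test_function \<phi>"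
  obtains R where "R > 0" "\<And>x. R \<le> \<bar>x\<bar> \<Longrightarrow> \<phi> x = 0" "\<And>x. R \<le> \<bar>x\<bar> \<Longrightarrow> deriv \<phi> x = 0"
    "\<And>x. (\<phi> has_real_derivative deriv \<phi> x) (at x)" "\<And>x. isCont (deriv \<phi>) x"
proof -
  have d: "(\<phi> has_real_derivative deriv \<phi> x) (at x)" for x
    using assms unfolding test_function_def by (metis DERIV_deriv_iff_field_differentiable funpow_0)
  have "deriv \<phi> field_differentiable (at x)" for x
    using assms[unfolded test_function_def, THEN conjunct1, rule_format, of 1 x] by simp
  then have c: "isCont (deriv \<phi>) x" for x by (rule field_differentiable_imp_continuous_at)
  have "bounded {x. \<phi> x \<noteq> 0}"
    using assms compact_imp_bounded bounded_subset closure_subset unfolding test_function_def by blast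
  then obtain B where B: "B > 0" "\<And>x. \<phi> x \<noteq> 0 \<Longrightarrow> \<bar>x\<bar> \<le> B"
    unfolding bounded_pos by auto
  show thesis
  proof
    show "B + 1 > 0" using B by simp
    show z: "\<phi> x = 0" if "B + 1 \<le> \<bar>x\<bar>" for x using B(2)[of x] that by force
    show "deriv \<phi> x = 0" if "B + 1 \<le> \<bar>x\<bar>" for x
    proof -
      have "\<forall>\<^sub>F y in nhds x. y \<in> - {-B..B}"
        using that by (intro eventually_nhds_in_open open_Compl closed_atLeastAtMost) (auto simp: abs_if split: if_splits)
      then have "\<forall>\<^sub>F y in nhds x. \<phi> y = 0" by eventually_elim (use B in force)
      then have "deriv \<phi> x = deriv (\<lambda>_. 0) x" by (intro deriv_cong_ev) auto
      then show ?thesis by simp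
    qed
  qed (use d c in auto)
qed

context radon_measure
begin

text \<open>In other words, the distributional derivative of \<open>stieltjes P\<close> is
  \<open>P\<close>. As \<phi> vanishes from \<open>R\<close> on, \<phi> z is minus the integral of
  its derivative over [z, R]; Fubini exchanges this integral with the one over
  \<open>z\<close>.\<close>

lemma stieltjes_integration_by_parts:
  assumes "test_function \<phi>"
  shows "(LBINT x. stieltjes P x * deriv \<phi> x) = - (LINT x|P. \<phi> x)"
    and "integrable lborel (\<lambda>x. stieltjes P x * deriv \<phi> x)"
proof -
  obtain R where R: "R > 0" "\<And>x. R \<le> \<bar>x\<bar> \<Longrightarrow> \<phi> x = 0" "\<And>x. R \<le> \<bar>x\<bar> \<Longrightarrow> deriv \<phi> x = 0"
    "\<And>x. (\<phi> has_real_derivative deriv \<phi> x) (at x)" "\<And>x. isCont (deriv \<phi>) x"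
    using test_functionD[OF assms] by metis
  have [measurable]: "deriv \<phi> \<in> borel_measurable borel"
    using R by (auto intro!: borel_measurable_continuous_onI continuous_at_imp_continuous_on)
  have [measurable]: "\<phi> \<in> borel_measurable borel"
    using R(4) by (auto intro!: borel_measurable_continuous_onI continuous_at_imp_continuous_on DERIV_isCont)
  have "compact (deriv \<phi> ` {-R..R})"
    by (intro compact_continuous_image continuous_at_imp_continuous_on) (use R(5) in auto)
  then obtain B where B: "\<And>x. x \<in> {-R..R} \<Longrightarrow> \<bar>deriv \<phi> x\<bar> \<le> B"
    unfolding compact_eq_bounded_closed bounded_iff by (metis image_eqI real_norm_def)
  have B': "\<bar>deriv \<phi> x\<bar> \<le> \<bar>B\<bar>" for x
    using B[of x] R(3)[of x] by (cases "R \<le> \<bar>x\<bar>") (auto simp: not_le abs_less_iff)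
  show int: "integrable lborel (\<lambda>x. stieltjes P x * deriv \<phi> x)"
    by (rule integrable_mult_compact_support[OF stieltjes_set_integrable _ _ B', where R = R])
       (use R(3) in auto)
  \<comment> \<open>\<open>P\<close> may be infinite, but \<phi> vanishes outside (-R, R].
    Restricting to this interval gives a finite measure, for which a bounded kernel of compact
    support in \<open>x\<close> is integrable.\<close>
  define M where "M = density P (\<lambda>z. ennreal (indicator {-R<..R} z))"
  have setsM [measurable_cong]: "sets M = sets borel" by (simp add: M_def)
  interpret M: finite_measure M
    by standard (use finite_Ioc[of "-R" R] in \<open>auto simp: M_def emeasure_density ennreal_indicator less_top\<close>)
  interpret pair_sigma_finite lborel M ..
  let ?f = "\<lambda>x z. indicator {z..R} x * deriv \<phi> x"
  have [measurable]: "case_prod ?f \<in> borel_measurable (lborel \<Otimes>\<^sub>M M)"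
  proof -
    have "(\<lambda>(x, z). indicator {p. snd p \<le> fst p \<and> fst p \<le> R} (x, z) * deriv \<phi> x) \<in> borel_measurable (borel \<Otimes>\<^sub>M borel)"
      by measurable
    also have "(\<lambda>(x, z). indicator {p. snd p \<le> fst p \<and> fst p \<le> R} (x, z) * deriv \<phi> x) = case_prod ?f"
      by (auto simp: fun_eq_iff indicator_def)
    finally show ?thesis by (simp add: setsM cong: measurable_cong_sets)
  qed
  have "integrable (lborel \<Otimes>\<^sub>M M) (case_prod ?f)"
  proof (rule Bochner_Integration.integrable_bound)
    show "integrable (lborel \<Otimes>\<^sub>M M) (\<lambda>p. indicator {-R..R} (fst p) * \<bar>B\<bar>)"
      by (rule Fubini_integrable) (auto intro!: integrable_mult_left integrable_real_indicator simp: emeasure_lborel_Icc_eq)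
    show "AE p in lborel \<Otimes>\<^sub>M M. norm (case_prod ?f p) \<le> norm (indicator {-R..R} (fst p) * \<bar>B\<bar>)"
    proof (rule AE_I2)
      fix p :: "real \<times> real"
      show "norm (case_prod ?f p) \<le> norm (indicator {-R..R} (fst p) * \<bar>B\<bar>)"
        using R(3)[of "fst p"] B'[of "fst p"]
        by (cases "R \<le> \<bar>fst p\<bar>") (auto simp: indicator_def split_beta abs_less_iff)
    qed
  qed measurable
  then have "(LINT z|M. (LBINT x. ?f x z)) = (LBINT x. (LINT z|M. ?f x z))"
    by (rule Fubini_integral)
  also have "(LINT z|M. (LBINT x. ?f x z)) = (LINT z|M. - \<phi> z)"
  proof (rule integral_cong_AE)
    have "AE z in M. z \<in> {-R<..R}" unfolding M_def by (subst AE_density) (auto simp: indicator_def)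
    then show "AE z in M. (LBINT x. ?f x z) = - \<phi> z"
    proof eventually_elim
      case (elim z)
      have "(LBINT x. ?f x z) = (LBINT x. deriv \<phi> x * indicator {z..R} x)" by (simp add: mult.commute)
      also have "\<dots> = \<phi> R - \<phi> z" by (rule integral_FTC_Icc_real) (use elim R in auto)
      finally show ?case using R(2)[of R] R(1) by simp
    qed
  qed measurable
  also have "\<dots> = - (LINT z|P. \<phi> z)"
  proof -
    have "(LINT z|M. - \<phi> z) = (LINT z|P. indicator {-R<..R} z *\<^sub>R (- \<phi> z))"
      unfolding M_def by (rule integral_density) auto
    also have "\<dots> = (LINT z|P. - \<phi> z)"
    proof (intro Bochner_Integration.integral_cong refl)
      fix z show "indicator {-R<..R} z *\<^sub>R (- \<phi> z) = - \<phi> z"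
        using R(2)[of z] by (cases "R \<le> \<bar>z\<bar>") (auto simp: indicator_def abs_less_iff)
    qed
    finally show ?thesis by simp
  qed
  \<comment> \<open>The inner integral counts the mass of (-R, x], an increment of
    \<open>stieltjes P\<close>. The constant \<open>stieltjes P (-R)\<close> disappears below
    because the derivative of \<phi> has integral 0.\<close>
  also have "(LBINT x. (LINT z|M. ?f x z))
      = (LBINT x. stieltjes P x * deriv \<phi> x - stieltjes P (-R) * deriv \<phi> x)"
  proof (intro Bochner_Integration.integral_cong refl)
    fix x
    show "(LINT z|M. ?f x z) = stieltjes P x * deriv \<phi> x - stieltjes P (-R) * deriv \<phi> x"
    proof (cases "R \<le> \<bar>x\<bar>")
      case True then show ?thesis by (simp add: R(3))
    next
      case False
      have "(LINT z|M. ?f x z) = (LINT z|M. indicator {..x} z * deriv \<phi> x)"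
        by (intro Bochner_Integration.integral_cong refl) (use False in \<open>auto simp: indicator_def\<close>)
      also have "\<dots> = measure M {..x} * deriv \<phi> x" by simp
      also have "emeasure M {..x} = emeasure P {-R<..x}"
      proof -
        have "emeasure M {..x} = (\<integral>\<^sup>+z. indicator {-R<..x} z \<partial>P)"
          unfolding M_def using False
          by (subst emeasure_density, simp, simp, intro nn_integral_cong) (auto simp: indicator_def)
        then show ?thesis by simp
      qed
      then have "measure M {..x} = stieltjes P x - stieltjes P (-R)"
        using stieltjes_diff[of "-R" x] False by (simp add: measure_def)
      finally show ?thesis by (simp add: algebra_simps)
    qed
  qed
  also have "\<dots> = (LBINT x. stieltjes P x * deriv \<phi> x) - (LBINT x. stieltjes P (-R) * deriv \<phi> x)"
  proof (rule Bochner_Integration.integral_diff[OF int])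
    have "integrable lborel (\<lambda>x. stieltjes P (-R) * deriv \<phi> x)"
      by (rule integrable_mult_compact_support[OF _ _ _ B', where R = R])
         (use R(3) in \<open>auto intro!: borel_integrable_atLeastAtMost'\<close>)
    then show "integrable lborel (\<lambda>x. stieltjes P (-R) * deriv \<phi> x)" .
  qed
  also have "(LBINT x. deriv \<phi> x) = (LBINT x. deriv \<phi> x * indicator {-R..R} x)"
  proof (intro Bochner_Integration.integral_cong refl)
    fix x show "deriv \<phi> x = deriv \<phi> x * indicator {-R..R} x"
      using R(3)[of x] by (cases "R \<le> \<bar>x\<bar>") (auto simp: indicator_def abs_less_iff)
  qed
  then have "(LBINT x. deriv \<phi> x) = 0"
    using integral_FTC_Icc_real[where F = \<phi> and f = "deriv \<phi>" and a = "-R" and b = R] R by simp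
  then have "(LBINT x. stieltjes P (-R) * deriv \<phi> x) = 0" by simp
  finally show "(LBINT x. stieltjes P x * deriv \<phi> x) = - (LINT x|P. \<phi> x)" by simp
qed
end

text \<open>\<sigma> and the difference of the distribution functions of \<open>P\<close> and
  \<open>N\<close> have the same distributional derivative, so they differ by a constant;
  \<open>F\<close> is that difference plus the constant. Its increments are P - N on half-open
  intervals, bounded by P + N.\<close>

lemma tv_measure_representation:
  assumes "BV_loc \<sigma>"
  obtains F where "radon_measure (tv_measure \<sigma>)" "F \<in> borel_measurable borel"
    "AE x in lborel. \<sigma> x = F x" "\<And>x y. x \<le> y \<Longrightarrow> \<bar>F y - F x\<bar> \<le> measure (tv_measure \<sigma>) {x<..y}"
proof -
  have ex: "\<exists>D. distr_deriv \<sigma> D" and L1: "L1_loc \<sigma>" using assms by (auto simp: BV_loc_def)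
  obtain P N where PN: "(SOME D. distr_deriv \<sigma> D) = (P, N)" by (cases "SOME D. distr_deriv \<sigma> D")
  then have dd: "distr_deriv \<sigma> (P, N)" using someI_ex[OF ex] by simp
  then interpret P: radon_measure P
    by unfold_locales (auto simp: distr_deriv_def)
  interpret N: radon_measure N
    using dd by unfold_locales (auto simp: distr_deriv_def)
  define \<mu> where "\<mu> = tv_measure \<sigma>"
  have \<mu>_def': "\<mu> = measure_of UNIV (sets borel) (\<lambda>B. emeasure P B + emeasure N B)"
    by (simp add: \<mu>_def tv_measure_def PN)
  have sets\<mu>: "sets \<mu> = sets borel"
    unfolding \<mu>_def' using sets.sigma_sets_eq[of "borel :: real measure"] by (subst sets_measure_of) auto
  have em: "emeasure \<mu> B = emeasure P B + emeasure N B" if "B \<in> sets borel" for B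
  proof (rule emeasure_measure_of[OF \<mu>_def'])
    show "countably_additive (sets \<mu>) (\<lambda>B. emeasure P B + emeasure N B)"
    proof (rule countably_additiveI)
      fix A :: "nat \<Rightarrow> real set" assume "range A \<subseteq> sets \<mu>" "disjoint_family A"
      then have "(\<Sum>i. emeasure P (A i)) = emeasure P (\<Union>i. A i)" "(\<Sum>i. emeasure N (A i)) = emeasure N (\<Union>i. A i)"
        by (auto intro!: suminf_emeasure simp: sets\<mu>)
      then show "(\<Sum>i. emeasure P (A i) + emeasure N (A i)) = emeasure P (\<Union>i. A i) + emeasure N (\<Union>i. A i)"
        by (simp add: suminf_add[symmetric])
    qed
  qed (use that sets\<mu> in \<open>auto simp: positive_def\<close>)
  interpret \<mu>: radon_measure \<mu>
    by unfold_locales (use sets\<mu> em P.finite_Icc N.finite_Icc in \<open>auto simp: ennreal_add_less_top\<close>)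
  have me: "measure \<mu> {x<..y} = measure P {x<..y} + measure N {x<..y}" for x y
    using em[of "{x<..y}"] P.finite_Ioc[of x y] N.finite_Ioc[of x y]
    by (auto simp: measure_def enn2real_plus)
  have L1': "integrable lebesgue (\<lambda>x. indicator {-R..R} x * \<sigma> x)" for R
    using L1 compact_Icc[of "-R" R] by (auto simp: L1_loc_def set_integrable_def)
  have "\<sigma> \<in> borel_measurable lebesgue"
  proof (rule borel_measurable_LIMSEQ_real[where u = "\<lambda>n x. indicator {-real n..real n} x * \<sigma> x"])
    fix x
    obtain n0 :: nat where n0: "\<bar>x\<bar> < real n0" using reals_Archimedean2 by blast
    show "(\<lambda>n. indicator {-real n..real n} x * \<sigma> x) \<longlonglongrightarrow> \<sigma> x"
      by (rule tendsto_eventually, rule eventually_sequentiallyI[of n0])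
         (use n0 in \<open>auto simp: indicator_def\<close>)
  qed (use L1' borel_measurable_integrable in blast)
  \<comment> \<open>\<sigma> is only Lebesgue measurable, whereas the du Bois-Reymond lemma and
    Fubini are stated for Borel functions and \<open>lborel\<close>.\<close>
  then obtain \<sigma>\<^sub>0 where [measurable]: "\<sigma>\<^sub>0 \<in> borel_measurable borel" and eq: "AE x in lborel. \<sigma> x = \<sigma>\<^sub>0 x"
    using completion_ex_borel_measurable_real[of \<sigma> lborel] by auto
  have \<sigma>m: "\<sigma>\<^sub>0 \<in> borel_measurable lebesgue" "\<sigma> \<in> borel_measurable lebesgue"
    using measurable_completion[of \<sigma>\<^sub>0 lborel borel] \<open>\<sigma> \<in> borel_measurable lebesgue\<close> by simp_all
  have int: "set_integrable lborel {-R..R} \<sigma>\<^sub>0" for R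
  proof -
    have "integrable lebesgue (\<lambda>x. indicator {-R..R} x *\<^sub>R \<sigma>\<^sub>0 x)"
    proof (rule integrable_cong_AE_imp[OF L1'[of R]])
      show "AE x in lebesgue. indicator {-R..R} x * \<sigma> x = indicator {-R..R} x *\<^sub>R \<sigma>\<^sub>0 x"
        using AE_completion[OF eq] by eventually_elim simp
    qed (intro borel_measurable_scaleR borel_measurable_indicator \<sigma>m, simp)
    then show ?thesis by (simp add: set_integrable_def integrable_completion)
  qed
  define w where "w = (\<lambda>x. \<sigma>\<^sub>0 x - (stieltjes P x - stieltjes N x))"
  obtain m where m: "AE x in lborel. w x = m"
  proof (rule du_Bois_Reymond[where w = w])
    show "set_integrable lborel {-R..R} w" for R
      unfolding w_def by (intro set_integral_diff int P.stieltjes_set_integrable N.stieltjes_set_integrable)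
    show "w \<in> borel_measurable borel" unfolding w_def by measurable
    fix \<phi> assume \<phi>: "test_function \<phi>"
    obtain R where R: "\<And>x. R \<le> \<bar>x\<bar> \<Longrightarrow> deriv \<phi> x = 0" "\<And>x. isCont (deriv \<phi>) x"
      using test_functionD[OF \<phi>] by metis
    have [measurable]: "deriv \<phi> \<in> borel_measurable borel"
      using R by (auto intro!: borel_measurable_continuous_onI continuous_at_imp_continuous_on)
    have "compact (deriv \<phi> ` {-R..R})"
      by (intro compact_continuous_image continuous_at_imp_continuous_on) (use R(2) in auto)
    then obtain B where B: "\<And>x. x \<in> {-R..R} \<Longrightarrow> \<bar>deriv \<phi> x\<bar> \<le> B"
      unfolding compact_eq_bounded_closed bounded_iff by (metis image_eqI real_norm_def)
    have B': "\<bar>deriv \<phi> x\<bar> \<le> \<bar>B\<bar>" for x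
      using B[of x] R(1)[of x] by (cases "R \<le> \<bar>x\<bar>") (auto simp: not_le abs_less_iff)
    have i0: "integrable lborel (\<lambda>x. \<sigma>\<^sub>0 x * deriv \<phi> x)"
      by (rule integrable_mult_compact_support[OF int _ _ B', where R = R]) (use R(1) in auto)
    have "(LINT x|lebesgue. \<sigma> x * deriv \<phi> x) = (LINT x|lebesgue. \<sigma>\<^sub>0 x * deriv \<phi> x)"
    proof (rule integral_cong_AE)
      show "AE x in lebesgue. \<sigma> x * deriv \<phi> x = \<sigma>\<^sub>0 x * deriv \<phi> x"
        using AE_completion[OF eq] by eventually_elim simp
    qed (intro borel_measurable_times \<sigma>m, use measurable_completion[of "deriv \<phi>" lborel borel] in simp)+
    also have "\<dots> = (LBINT x. \<sigma>\<^sub>0 x * deriv \<phi> x)" by (rule integral_completion) measurable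
    finally have "(LBINT x. \<sigma>\<^sub>0 x * deriv \<phi> x) = - ((LINT x|P. \<phi> x) - (LINT x|N. \<phi> x))"
      using dd \<phi> by (auto simp: distr_deriv_def)
    moreover have "(LBINT x. w x * deriv \<phi> x) = (LBINT x. \<sigma>\<^sub>0 x * deriv \<phi> x
        - (stieltjes P x * deriv \<phi> x - stieltjes N x * deriv \<phi> x))"
      by (intro Bochner_Integration.integral_cong refl) (simp add: w_def algebra_simps)
    ultimately show "(LBINT x. w x * deriv \<phi> x) = 0"
      using i0 P.stieltjes_integration_by_parts[OF \<phi>] N.stieltjes_integration_by_parts[OF \<phi>] by simp
  qed
  show thesis
  proof
    show "radon_measure (tv_measure \<sigma>)" using \<mu>.radon_measure_axioms by (simp add: \<mu>_def)
    show "(\<lambda>x. m + (stieltjes P x - stieltjes N x)) \<in> borel_measurable borel" by measurable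
    show "AE x in lborel. \<sigma> x = m + (stieltjes P x - stieltjes N x)"
      using m eq by eventually_elim (simp add: w_def)
    fix x y :: real assume xy: "x \<le> y"
    then show "\<bar>m + (stieltjes P y - stieltjes N y) - (m + (stieltjes P x - stieltjes N x))\<bar>
        \<le> measure (tv_measure \<sigma>) {x<..y}"
      using P.stieltjes_diff[OF xy] N.stieltjes_diff[OF xy] me[of x y] measure_nonneg[of P "{x<..y}"]
        measure_nonneg[of N "{x<..y}"] unfolding \<mu>_def by linarith
  qed
qed

section \<open>The primitive of the reciprocal and its inverse\<close>

locale reciprocal_primitive =
  fixes F g :: "real \<Rightarrow> real" and C :: real
  assumes F_measurable [measurable]: "F \<in> borel_measurable borel"
    and F_pos: "AE x in lborel. 0 < F x"
    and F_le: "AE x in lborel. F x \<le> C"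
    and int: "\<And>R. set_integrable lborel {-R..R} (\<lambda>x. 1 / F x)"
    and g_diff: "\<And>x y. x \<le> y \<Longrightarrow> g y - g x = (LBINT z:{x<..y}. 1 / F z)"
begin

definition f :: "real \<Rightarrow> real" where "f = inv g"

lemma C_pos: "0 < C"
proof (rule ccontr)
  assume "\<not> 0 < C"
  have "AE x in (lborel :: real measure). False"
    using F_pos F_le by eventually_elim (use \<open>\<not> 0 < C\<close> in linarith)
  then show False
    using ae_filter_eq_bot_iff[of "lborel :: real measure"] by (simp add: eventually_False)
qed

lemma set_integrable_Ioc: "set_integrable lborel {x<..y} (\<lambda>z. 1 / F z)"
  by (rule set_integrable_subset[OF int[of "max \<bar>x\<bar> \<bar>y\<bar>"]]) auto

lemma set_integrable_const: "set_integrable lborel {x<..y} (\<lambda>z::real. c :: real)"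
  by (rule set_integrable_subset[OF borel_integrable_atLeastAtMost'[of x y]]) auto

lemma integral_const: "x \<le> y \<Longrightarrow> (LBINT z:{x<..y}. c) = (y - x) * (c::real)"
  by (simp add: set_lebesgue_integral_def)

text \<open>Since 1 / F is at least 1 / C. This one bound yields strict monotonicity of
  \<open>g\<close>, its unboundedness in both directions and the Lipschitz constant \<open>C\<close>
  of the inverse.\<close>

lemma g_diff_ge: "x \<le> y \<Longrightarrow> (y - x) / C \<le> g y - g x"
proof -
  assume xy: "x \<le> y"
  have "(y - x) * (1 / C) = (LBINT z:{x<..y}. 1 / C)" using xy by (simp add: integral_const)
  also have "\<dots> \<le> (LBINT z:{x<..y}. 1 / F z)"
  proof (rule set_integral_mono_AE[OF set_integrable_const set_integrable_Ioc])
    show "AE z in lborel. z \<in> {x<..y} \<longrightarrow> 1 / C \<le> 1 / F z"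
      using F_pos F_le by eventually_elim (simp add: frac_le)
  qed
  finally show ?thesis using g_diff[OF xy] by simp
qed

lemma strict_mono_g: "strict_mono g"
proof (rule strict_monoI)
  fix x y :: real assume "x < y"
  then have "0 < (y - x) / C" using C_pos by simp
  then show "g x < g y" using g_diff_ge[of x y] \<open>x < y\<close> by linarith
qed

text \<open>The integrand 1 - c / F equals (F - c) / F, which is bounded by S / F because
  \<open>F\<close> is positive. The constant \<open>c\<close> is free so that the value of
  \<open>F\<close> at either end point can be the reference.\<close>

lemma deviation_bound:
  assumes xy: "x \<le> y" and S: "\<And>z. x < z \<Longrightarrow> z \<le> y \<Longrightarrow> \<bar>F z - c\<bar> \<le> S"
  shows "\<bar>(y - x) - c * (g y - g x)\<bar> \<le> S * (g y - g x)"
proof -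
  have "(y - x) - c * (g y - g x) = (LBINT z:{x<..y}. 1) - (LBINT z:{x<..y}. c * (1 / F z))"
    unfolding set_integral_mult_right integral_const[OF xy] g_diff[OF xy] by simp
  also have "\<dots> = (LBINT z:{x<..y}. 1 - c * (1 / F z))"
    by (intro set_integral_diff(2)[symmetric] set_integrable_const set_integrable_mult_right set_integrable_Ioc)
  finally have *: "(y - x) - c * (g y - g x) = (LBINT z:{x<..y}. 1 - c * (1 / F z))" .
  have "\<bar>LBINT z:{x<..y}. 1 - c * (1 / F z)\<bar> \<le> (LBINT z:{x<..y}. \<bar>1 - c * (1 / F z)\<bar>)"
  proof -
    have "set_integrable lborel {x<..y} (\<lambda>z. 1 - c * (1 / F z))"
      by (intro set_integral_diff(1) set_integrable_const set_integrable_mult_right set_integrable_Ioc)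
    from set_integral_norm_bound[OF this] show ?thesis by simp
  qed
  also have "\<dots> \<le> (LBINT z:{x<..y}. S * (1 / F z))"
  proof (rule set_integral_mono_AE)
    show "AE z in lborel. z \<in> {x<..y} \<longrightarrow> \<bar>1 - c * (1 / F z)\<bar> \<le> S * (1 / F z)"
      using F_pos
    proof eventually_elim
      case (elim z)
      then have "1 - c * (1 / F z) = (F z - c) / F z" by (simp add: diff_divide_distrib)
      then have "\<bar>1 - c * (1 / F z)\<bar> = \<bar>F z - c\<bar> / F z" using elim by (simp add: abs_divide)
      then show ?case using elim S[of z] by (simp add: divide_right_mono)
    qed
  qed (intro set_integrable_abs set_integral_diff set_integrable_const set_integrable_mult_right set_integrable_Ioc)+
  also have "\<dots> = S * (g y - g x)" unfolding set_integral_mult_right g_diff[OF xy] ..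
  finally show ?thesis using * by simp
qed

text \<open>Uniform integrability of a single function: 1 / F is split at height \<open>n\<close>.
  The part below contributes at most \<open>n\<close> times the total length, and the excess
  \<open>W n\<close> has small integral by dominated convergence, whatever the intervals.\<close>

lemma abs_continuous_g: "abs_continuous g"
  unfolding abs_continuous_def abs_continuous_on_Icc_def
proof (intro allI impI)
  fix c d \<epsilon> :: real assume "0 < \<epsilon>"
  define U where "U = (\<lambda>x. indicator {c..d} x *\<^sub>R (1 / F x))"
  have "set_integrable lborel {c..d} (\<lambda>x. 1 / F x)"
    by (rule set_integrable_subset[OF int[of "max \<bar>c\<bar> \<bar>d\<bar>"]]) auto
  then have U: "integrable lborel U" unfolding U_def set_integrable_def .
  have [measurable]: "U \<in> borel_measurable borel" unfolding U_def by measurable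
  define W where "W = (\<lambda>n x. max 0 (\<bar>U x\<bar> - real n))"
  have [measurable]: "W n \<in> borel_measurable borel" for n unfolding W_def by measurable
  have Wi: "integrable lborel (W n)" for n
    by (rule Bochner_Integration.integrable_bound[OF integrable_abs[OF U]]) (auto simp: W_def)
  have "(\<lambda>n. LBINT x. W n x) \<longlonglongrightarrow> (LBINT x::real. 0)"
  proof (rule integral_dominated_convergence[OF _ _ integrable_abs[OF U]])
    show "AE x in lborel. (\<lambda>n. W n x) \<longlonglongrightarrow> 0"
    proof (rule AE_I2)
      fix x
      obtain n0 :: nat where "\<bar>U x\<bar> < real n0" using reals_Archimedean2 by blast
      then have "W n x = 0" if "n \<ge> n0" for n using that by (auto simp: W_def)
      then show "(\<lambda>n. W n x) \<longlonglongrightarrow> 0"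
        by (intro tendsto_eventually eventually_sequentiallyI)
    qed
  qed (auto simp: W_def)
  then have "\<forall>\<^sub>F n in sequentially. (LBINT x. W n x) < \<epsilon> / 2"
    using \<open>0 < \<epsilon>\<close> by (intro order_tendstoD(2)[where y = 0]) auto
  then obtain n where n: "(LBINT x. W n x) < \<epsilon> / 2" by (auto simp: eventually_sequentially)
  \<comment> \<open>Chosen so that n \<delta> is at most half of \<epsilon>; the summand 1 covers
    \<open>n = 0\<close>.\<close>
  define \<delta> where "\<delta> = \<epsilon> / (2 * (real n + 1))"
  show "\<exists>\<delta>>0. \<forall>I. finite I \<longrightarrow> (\<forall>(u, v)\<in>I. c \<le> u \<and> u \<le> v \<and> v \<le> d) \<longrightarrow>
      disjoint_family_on (\<lambda>(u, v). {u<..<v}) I \<longrightarrow> (\<Sum>(u, v)\<in>I. v - u) < \<delta> \<longrightarrow>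
      (\<Sum>(u, v)\<in>I. \<bar>g v - g u\<bar>) < \<epsilon>"
  proof (intro exI[of _ \<delta>] conjI allI impI)
    show "0 < \<delta>" using \<open>0 < \<epsilon>\<close> by (simp add: \<delta>_def)
    fix I :: "(real \<times> real) set"
    assume fin: "finite I" and I: "\<forall>(u, v)\<in>I. c \<le> u \<and> u \<le> v \<and> v \<le> d"
      and disj: "disjoint_family_on (\<lambda>(u, v). {u<..<v}) I" and len: "(\<Sum>(u, v)\<in>I. v - u) < \<delta>"
    let ?A = "\<lambda>(u, v). {u<..<v :: real}"
    have WA: "integrable lborel (\<lambda>x. indicator (?A p) x * W n x)" for p
      using integrable_mult_indicator[OF _ Wi[of n], of "?A p"] by (auto simp: split_beta)
    have "(\<Sum>(u, v)\<in>I. \<bar>g v - g u\<bar>) \<le> (\<Sum>p\<in>I. real n * (snd p - fst p) + (LBINT x. indicator (?A p) x * W n x))"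
    proof (rule sum_mono)
      fix p assume p: "p \<in> I"
      obtain u v where uv: "p = (u, v)" by force
      then have uv': "c \<le> u" "u \<le> v" "v \<le> d" using I p by auto
      have "\<bar>g v - g u\<bar> = (LBINT z:{u<..v}. 1 / F z)"
        using g_diff[OF uv'(2)] strict_mono_less_eq[OF strict_mono_g, of u v] uv'(2) by simp
      also have "\<dots> \<le> (LBINT z. real n * indicator {u<..v} z + indicator (?A p) z * W n z)"
        unfolding set_lebesgue_integral_def
      proof (rule integral_mono_AE)
        show "integrable lborel (\<lambda>z. indicator {u<..v} z *\<^sub>R (1 / F z))"
          using set_integrable_Ioc unfolding set_integrable_def .
        show "integrable lborel (\<lambda>z. real n * indicator {u<..v} z + indicator (?A p) z * W n z)"
          using WA by (intro Bochner_Integration.integrable_add integrable_mult_right integrable_real_indicator)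
            (auto simp: uv'(2))
        show "AE z in lborel. indicator {u<..v} z *\<^sub>R (1 / F z) \<le> real n * indicator {u<..v} z + indicator (?A p) z * W n z"
          using AE_lborel_singleton[of v]
        proof eventually_elim
          case (elim z)
          show ?case
          proof (cases "u < z \<and> z \<le> v")
            case True
            then have "U z = 1 / F z" using uv' by (simp add: U_def)
            then show ?thesis using True elim abs_ge_self[of "1 / F z"] by (auto simp: uv W_def max_def)
          qed (auto simp: uv W_def indicator_def)
        qed
      qed
      also have "\<dots> = real n * (v - u) + (LBINT x. indicator (?A p) x * W n x)"
        using WA uv' by (subst Bochner_Integration.integral_add)
          (auto intro!: integrable_mult_right integrable_real_indicator)
      finally show "(case p of (u, v) \<Rightarrow> \<bar>g v - g u\<bar>) \<le> real n * (snd p - fst p) + (LBINT x. indicator (?A p) x * W n x)"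
        by (simp add: uv)
    qed
    also have "\<dots> = real n * (\<Sum>(u, v)\<in>I. v - u) + (LBINT x. (\<Sum>p\<in>I. indicator (?A p) x * W n x))"
      using WA by (simp add: sum.distrib sum_distrib_left split_beta)
    also have "\<dots> \<le> real n * \<delta> + (LBINT x. W n x)"
    proof (intro add_mono mult_left_mono integral_mono)
      fix x
      have "(\<Sum>p\<in>I. indicator (?A p) x * W n x) = indicator (\<Union>p\<in>I. ?A p) x * W n x"
        by (subst indicator_UN_disjoint[OF fin disj]) (simp add: sum_distrib_right)
      also have "\<dots> \<le> W n x" by (auto simp: indicator_def W_def)
      finally show "(\<Sum>p\<in>I. indicator (?A p) x * W n x) \<le> W n x" .
    qed (use len WA Wi in auto)
    also have "real n * \<delta> \<le> \<epsilon> / 2" using \<open>0 < \<epsilon>\<close> by (simp add: \<delta>_def field_simps)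
    finally show "(\<Sum>(u, v)\<in>I. \<bar>g v - g u\<bar>) < \<epsilon>" using n by simp
  qed
qed

lemma isCont_g: "isCont g x"
  unfolding isCont_def LIM_eq
proof (intro allI impI)
  fix \<epsilon> :: real assume "0 < \<epsilon>"
  then obtain \<delta> where \<delta>: "\<delta> > 0" and
    *: "\<And>I. finite I \<Longrightarrow> (\<forall>(u, v)\<in>I. x - 1 \<le> u \<and> u \<le> v \<and> v \<le> x + 1) \<Longrightarrow>
        disjoint_family_on (\<lambda>(u, v). {u<..<v}) I \<Longrightarrow> (\<Sum>(u, v)\<in>I. v - u) < \<delta> \<Longrightarrow>
        (\<Sum>(u, v)\<in>I. \<bar>g v - g u\<bar>) < \<epsilon>"
    using abs_continuous_g[unfolded abs_continuous_def abs_continuous_on_Icc_def,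
        rule_format, of \<epsilon> "x - 1" "x + 1"] by blast
  show "\<exists>s>0. \<forall>y. y \<noteq> x \<and> norm (y - x) < s \<longrightarrow> norm (g y - g x) < \<epsilon>"
  proof (intro exI[of _ "min 1 \<delta>"] conjI allI impI)
    fix y assume "y \<noteq> x \<and> norm (y - x) < min 1 \<delta>"
    then show "norm (g y - g x) < \<epsilon>"
      using *[of "{(x, y)}"] *[of "{(y, x)}"]
      by (cases "x \<le> y") (auto simp: disjoint_family_on_def abs_minus_commute)
  qed (use \<delta> in auto)
qed

lemma bij_g: "bij g"
proof (rule bijI)
  show "inj g" by (rule strict_mono_imp_inj_on[OF strict_mono_g])
  show "surj g"
    unfolding surj_def
  proof (rule allI)
    fix y
    \<comment> \<open>Then \<open>M / C\<close> is the distance from \<open>y\<close> to g 0, so the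
      linear growth of \<open>g\<close> puts \<open>y\<close> between g (-M) and g M.\<close>
    define M where "M = C * (\<bar>y - g 0\<bar>)"
    have M: "0 \<le> M" "M / C = \<bar>y - g 0\<bar>" using C_pos by (auto simp: M_def)
    have "g (-M) \<le> y" using g_diff_ge[of "-M" 0] M by simp
    moreover have "y \<le> g M" using g_diff_ge[of 0 M] M by simp
    ultimately obtain x where "g x = y"
      using IVT[of g "-M" y M] isCont_g M by auto
    then show "\<exists>x. y = g x" by blast
  qed
qed

lemma f_g [simp]: "f (g x) = x" and g_f [simp]: "g (f y) = y"
  using bij_g by (auto simp: f_def bij_is_inj bij_is_surj surj_f_inv_f)

lemma f_le_iff: "f y \<le> x \<longleftrightarrow> y \<le> g x"
  using strict_mono_less_eq[OF strict_mono_g, of "f y" x] by simp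

lemma less_f_iff: "x < f y \<longleftrightarrow> g x < y"
  using f_le_iff[of y x] by linarith

lemma lipschitz_f: "C-lipschitz_on UNIV f"
proof (rule lipschitz_onI)
  have *: "f y - f x \<le> C * (y - x)" if "x \<le> y" for x y
    using g_diff_ge[of "f x" "f y"] that C_pos by (simp add: f_le_iff field_simps)
  fix x y
  have mono: "f x \<le> f y" if "x \<le> y" for x y using that by (simp add: f_le_iff)
  then show "dist (f x) (f y) \<le> C * dist x y"
    using *[of x y] *[of y x] mono[of x y] mono[of y x] by (cases "x \<le> y") (auto simp: dist_real_def)
qed (use C_pos in simp)

lemma isCont_f: "isCont f x"
  using lipschitz_on_continuous_on[OF lipschitz_f] by (simp add: continuous_on_eq_continuous_at)

lemma f_measurable [measurable]: "f \<in> borel_measurable borel"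
  using lipschitz_on_continuous_on[OF lipschitz_f] by (rule borel_measurable_continuous_onI)

lemma g_measurable [measurable]: "g \<in> borel_measurable borel"
  using isCont_g by (auto intro!: borel_measurable_continuous_onI continuous_at_imp_continuous_on)

text \<open>
  The image of Lebesgue measure under \<open>f\<close> has density \<open>1 / F\<close>, so \<open>f\<close> pulls null sets back to null sets.
\<close>

lemma AE_compose_f:
  assumes "AE x in lborel. Q x"
  shows "AE y in lborel. Q (f y)"
proof -
  obtain N where N: "N \<in> sets borel" "emeasure lborel N = 0" "{x. \<not> Q x} \<subseteq> N"
    using assms by (auto elim!: AE_E)
  have "AE y in lborel. y \<in> {g (- real n)<..g (real n)} \<longrightarrow> f y \<notin> N" for n :: nat
  proof -
    \<comment> \<open>Between g (-n) and g n both measures are finite, so agreement on rays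
      suffices. On the ray from \<open>x\<close> both give the increment of \<open>g\<close> from
      max (-n) x to max n x, which is 0 once \<open>x\<close> exceeds \<open>n\<close>.\<close>
    let ?M = "distr (density lborel (indicator {g (- real n)<..g (real n)})) borel f"
    let ?D = "density lborel (\<lambda>x. ennreal (1 / F x) * indicator {- real n<..real n} x)"
    have mono: "g x \<le> g y" if "x \<le> y" for x y
      using that strict_mono_g by (simp add: strict_mono_less_eq)
    have M: "emeasure ?M {x<..} = ennreal (g (max (real n) x) - g (max (- real n) x))" for x
    proof -
      have "emeasure ?M {x<..} = emeasure (density lborel (indicator {g (- real n)<..g (real n)})) (f -` {x<..})"
        by (subst emeasure_distr) auto
      also have "\<dots> = (\<integral>\<^sup>+y. indicator {g (max (- real n) x)<..g (real n)} y \<partial>lborel)"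
        by (subst emeasure_density, simp, simp add: measurable_sets_borel[OF f_measurable], intro nn_integral_cong)
           (auto simp: indicator_def less_f_iff max_def not_le dest: mono order.strict_implies_order[THEN mono])
      also have "\<dots> = emeasure lborel {g (max (- real n) x)<..g (real n)}" by simp
      also have "\<dots> = ennreal (g (max (real n) x) - g (max (- real n) x))"
      proof (cases "x \<le> real n")
        case True
        then show ?thesis using mono[of "max (- real n) x" "real n"] by (simp add: max_def)
      next
        case False
        then have "{g (max (- real n) x)<..g (real n)} = {}" using mono[of "real n" x] by auto
        then show ?thesis using False by (simp add: max_def)
      qed
      finally show ?thesis .
    qed
    have D: "emeasure ?D {x<..} = ennreal (g (max (real n) x) - g (max (- real n) x))" for x
    proof -
      have "emeasure ?D {x<..} = (\<integral>\<^sup>+z. ennreal (1 / F z) * indicator {max (- real n) x<..max (real n) x} z \<partial>lborel)"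
        if "x \<le> real n"
        using that by (subst emeasure_density, simp, simp, intro nn_integral_cong) (auto simp: indicator_def)
      moreover have "emeasure ?D {x<..} = (\<integral>\<^sup>+z. 0 \<partial>(lborel :: real measure))" if "\<not> x \<le> real n"
        using that by (subst emeasure_density, simp, simp, intro nn_integral_cong) (auto simp: indicator_def)
      moreover have "(\<integral>\<^sup>+z. ennreal (1 / F z) * indicator {a<..b} z \<partial>lborel) = ennreal (g b - g a)"
        if "a \<le> b" for a b
      proof -
        have "(\<integral>\<^sup>+z. ennreal (1 / F z) * indicator {a<..b} z \<partial>lborel)
            = (\<integral>\<^sup>+z. ennreal (indicator {a<..b} z *\<^sub>R (1 / F z)) \<partial>lborel)"
          by (intro nn_integral_cong) (auto simp: indicator_def)
        also have "\<dots> = ennreal (LBINT z:{a<..b}. 1 / F z)"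
          unfolding set_lebesgue_integral_def
        proof (rule nn_integral_eq_integral)
          show "integrable lborel (\<lambda>z. indicator {a<..b} z *\<^sub>R (1 / F z))"
            using set_integrable_Ioc unfolding set_integrable_def .
          show "AE z in lborel. 0 \<le> indicator {a<..b} z *\<^sub>R (1 / F z)"
            using F_pos by eventually_elim simp
        qed
        finally show ?thesis using g_diff[OF that] by simp
      qed
      ultimately show ?thesis by (cases "x \<le> real n") (auto simp: max_def)
    qed
    have "?M = ?D"
      by (rule measure_eqI_lessThan) (simp_all add: M D)
    then have "emeasure ?M N = emeasure ?D N" by simp
    also have "\<dots> = 0"
    proof -
      have "N \<in> null_sets lborel" using N by (auto simp: null_sets_def)
      then have "N \<in> null_sets ?D"
        by (subst null_sets_density_iff) (auto dest: AE_not_in elim: eventually_mono)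
      then show ?thesis by (rule null_setsD1)
    qed
    finally have "f -` N \<in> null_sets (density lborel (indicator {g (- real n)<..g (real n)}))"
      using N(1) measurable_sets_borel[OF f_measurable N(1)] by (subst (asm) emeasure_distr) (auto simp: null_sets_def)
    then show ?thesis
      by (subst (asm) null_sets_density_iff) (auto simp: indicator_def elim: eventually_mono)
  qed
  then have "AE y in lborel. \<forall>n::nat. y \<in> {g (- real n)<..g (real n)} \<longrightarrow> f y \<notin> N"
    by (simp only: AE_all_countable) simp
  then show ?thesis
  proof eventually_elim
    case (elim y)
    obtain n :: nat where "\<bar>f y\<bar> < real n" using reals_Archimedean2 by blast
    then have "f y \<notin> N" using elim[rule_format, of n]
      by (auto simp: less_f_iff[symmetric] f_le_iff[symmetric] abs_less_iff)
    then show ?case using N by auto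
  qed
qed

lemma deviation_bound_abs:
  assumes S: "\<And>z. z \<in> closed_segment x y \<Longrightarrow> \<bar>F z - F x\<bar> \<le> S"
  shows "\<bar>(y - x) - F x * (g y - g x)\<bar> \<le> S * \<bar>g y - g x\<bar>"
proof (cases "x \<le> y")
  case True
  have "g x \<le> g y" using True strict_mono_g by (simp add: strict_mono_less_eq)
  then show ?thesis
    using deviation_bound[OF True, of "F x" S] S True by (auto simp: closed_segment_eq_real_ivl)
next
  case False
  have "g y \<le> g x" using False strict_mono_g by (simp add: strict_mono_less_eq)
  moreover have "\<bar>(x - y) - F x * (g x - g y)\<bar> \<le> S * (g x - g y)"
    by (rule deviation_bound) (use False S in \<open>auto simp: closed_segment_eq_real_ivl\<close>)
  moreover have "(x - y) - F x * (g x - g y) = - ((y - x) - F x * (g y - g x))" by (simp add: algebra_simps)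
  ultimately show ?thesis by (simp add: abs_minus_commute)
qed

lemma f_has_derivative:
  assumes "isCont F (f y)"
  shows "(f has_real_derivative F (f y)) (at y)"
  unfolding has_field_derivative_iff LIM_eq
proof (intro allI impI)
  fix \<epsilon> :: real assume "0 < \<epsilon>"
  then obtain \<delta> where \<delta>: "\<delta> > 0" "\<And>z. \<bar>z - f y\<bar> < \<delta> \<Longrightarrow> \<bar>F z - F (f y)\<bar> \<le> \<epsilon> / 2"
  proof -
    have "\<exists>s>0. \<forall>z. dist z (f y) < s \<longrightarrow> dist (F z) (F (f y)) < \<epsilon> / 2"
      using assms \<open>0 < \<epsilon>\<close> unfolding continuous_at_eps_delta by (metis half_gt_zero)
    then show thesis using that by (force simp: dist_real_def)
  qed
  show "\<exists>s>0. \<forall>w. w \<noteq> y \<and> norm (w - y) < s \<longrightarrow> norm ((f w - f y) / (w - y) - F (f y)) < \<epsilon>"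
  \<comment> \<open>\<open>C\<close> is the Lipschitz constant of \<open>f\<close>: for
    \<open>w\<close> within \<delta> / C of \<open>y\<close> the segment from f y to f w stays
    within \<delta> of f y.\<close>
  proof (intro exI[of _ "\<delta> / C"] conjI allI impI)
    show "0 < \<delta> / C" using \<delta> C_pos by simp
    fix w assume w: "w \<noteq> y \<and> norm (w - y) < \<delta> / C"
    have "\<bar>f w - f y\<bar> \<le> C * \<bar>w - y\<bar>"
      using lipschitz_onD[OF lipschitz_f, of w y] by (simp add: dist_real_def)
    also have "\<dots> < \<delta>" using w C_pos by (simp add: field_simps)
    finally have "\<bar>F z - F (f y)\<bar> \<le> \<epsilon> / 2" if "z \<in> closed_segment (f y) (f w)" for z
      using that by (intro \<delta>) (auto simp: closed_segment_eq_real_ivl split: if_splits)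
    then have "\<bar>(f w - f y) - F (f y) * (w - y)\<bar> \<le> \<epsilon> / 2 * \<bar>w - y\<bar>"
      using deviation_bound_abs[of "f y" "f w" "\<epsilon> / 2"] by simp
    moreover have "\<bar>(f w - f y) / (w - y) - F (f y)\<bar> = \<bar>(f w - f y) - F (f y) * (w - y)\<bar> / \<bar>w - y\<bar>"
      using w by (simp add: abs_divide[symmetric] diff_divide_distrib)
    ultimately have "\<bar>(f w - f y) / (w - y) - F (f y)\<bar> \<le> \<epsilon> / 2"
      using w by (simp add: pos_divide_le_eq)
    then show "norm ((f w - f y) / (w - y) - F (f y)) < \<epsilon>" using \<open>0 < \<epsilon>\<close> by simp
  qed
qed

end

section \<open>Fractional integrals and Marchaud derivatives\<close>

lemma nn_integral_powr_from_0:
  fixes a c :: real assumes "a > -1" "c \<ge> 0"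
  shows "(\<integral>\<^sup>+q. ennreal (indicator {0..c} q * q powr a) \<partial>lborel) = ennreal (c powr (a + 1) / (a + 1))"
  by (rule nn_integral_has_integral_lebesgue[OF _ has_integral_powr_from_0[OF assms]]) simp

lemma nn_integral_powr_to_inf:
  fixes a e :: real assumes "e < -1" "a > 0"
  shows "(\<integral>\<^sup>+q. ennreal (indicator {a..} q * q powr e) \<partial>lborel) = ennreal (- (a powr (e + 1)) / (e + 1))"
  by (rule nn_integral_has_integral_lebesgue[OF _ has_integral_powr_to_inf[OF assms]]) simp

lemma integrable_powr_from_0:
  fixes a c :: real assumes "a > -1" shows "integrable lborel (\<lambda>q. indicator {0..c} q * q powr a)"
proof (cases "c \<ge> 0")
  case True
  show ?thesis by (rule integrableI_nonneg) (use nn_integral_powr_from_0[OF assms True] in auto)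
qed (auto simp: indicator_def)

lemma integral_powr_from_0:
  fixes a c :: real assumes "a > -1" "c \<ge> 0"
  shows "(LBINT q. indicator {0..c} q * q powr a) = c powr (a + 1) / (a + 1)"
  by (rule integral_eq_nn_integral[THEN trans])
     (use assms nn_integral_powr_from_0[OF assms] in auto)

lemma integrable_powr_to_inf:
  fixes a e :: real assumes "e < -1" "a > 0" shows "integrable lborel (\<lambda>q. indicator {a..} q * q powr e)"
  by (rule integrableI_nonneg) (use nn_integral_powr_to_inf[OF assms] in auto)

lemma integral_powr_to_inf:
  fixes a e :: real assumes "e < -1" "a > 0"
  shows "(LBINT q. indicator {a..} q * q powr e) = - (a powr (e + 1)) / (e + 1)"
  by (rule integral_eq_nn_integral[THEN trans])
     (use assms nn_integral_powr_to_inf[OF assms] in \<open>auto simp: divide_nonneg_neg\<close>)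

lemma lborel_Fubini:
  fixes f :: "real \<Rightarrow> real \<Rightarrow> real"
  assumes [measurable]: "case_prod f \<in> borel_measurable (borel \<Otimes>\<^sub>M borel)"
    and fin: "(\<integral>\<^sup>+x. (\<integral>\<^sup>+y. ennreal \<bar>f x y\<bar> \<partial>lborel) \<partial>lborel) < \<infinity>"
  shows "(LBINT x. (LBINT y. f x y)) = (LBINT y. (LBINT x. f x y))"
    and "AE x in lborel. integrable lborel (f x)"
    and "integrable lborel (\<lambda>x. LBINT y. f x y)"
proof -
  have int: "integrable (lborel \<Otimes>\<^sub>M lborel) (case_prod f)"
  proof (rule integrableI_bounded)
    show "case_prod f \<in> borel_measurable (lborel \<Otimes>\<^sub>M lborel)" by measurable
    have "(\<integral>\<^sup>+p. ennreal (norm (case_prod f p)) \<partial>(lborel \<Otimes>\<^sub>M lborel))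
        = (\<integral>\<^sup>+x. (\<integral>\<^sup>+y. ennreal \<bar>f x y\<bar> \<partial>lborel) \<partial>lborel)"
      by (subst lborel.nn_integral_fst[symmetric]) (auto simp: split_beta)
    then show "(\<integral>\<^sup>+p. ennreal (norm (case_prod f p)) \<partial>(lborel \<Otimes>\<^sub>M lborel)) < \<infinity>"
      using fin by simp
  qed
  show "(LBINT x. (LBINT y. f x y)) = (LBINT y. (LBINT x. f x y))"
    by (rule lborel_pair.Fubini_integral[OF int, symmetric])
  show "AE x in lborel. integrable lborel (f x)" by (rule lborel_pair.AE_integrable_fst[OF int])
  show "integrable lborel (\<lambda>x. LBINT y. f x y)" by (rule lborel_pair.integrable_fst[OF int])
qed

text \<open>
  Unnormalised operators: \<open>frac_int \<alpha>\<close> is \<open>\<Gamma> (1 - \<alpha>)\<close> times the right-sided fractional integral of order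
  \<open>1 - \<alpha>\<close>, and the Marchaud derivatives of order \<open>\<alpha>\<close> lack the factor \<open>\<alpha> / \<Gamma> (1 - \<alpha>)\<close>. The boundary terms of the
  Weyl-Marchaud derivatives on \<open>(0, T)\<close> are the contributions of the half-lines on which the function vanishes.
\<close>

definition frac_int :: "real \<Rightarrow> (real \<Rightarrow> real) \<Rightarrow> real \<Rightarrow> real" where
  "frac_int \<alpha> w t = (LBINT q. indicator {0<..} q * (w (t + q) * q powr (- \<alpha>)))"

definition marchaud :: "real \<Rightarrow> (real \<Rightarrow> real) \<Rightarrow> real \<Rightarrow> real" where
  "marchaud \<alpha> \<phi> t = (LBINT r. indicator {0<..} r * ((\<phi> t - \<phi> (t + r)) * r powr (- 1 - \<alpha>)))"

definition marchaud_left :: "real \<Rightarrow> (real \<Rightarrow> real) \<Rightarrow> real \<Rightarrow> real" where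
  "marchaud_left \<alpha> h t = (LBINT r. indicator {0<..} r * ((h t - h (t - r)) * r powr (- 1 - \<alpha>)))"

locale frac_order =
  fixes \<alpha> T :: real
  assumes \<alpha>: "0 < \<alpha>" "\<alpha> < 1" and T: "0 < T"
begin

lemma frac_int_dominated:
  assumes W: "\<And>t. 0 \<le> t \<Longrightarrow> \<bar>w t\<bar> \<le> W" and z: "\<And>t. T \<le> t \<Longrightarrow> w t = 0" and "0 \<le> t"
  shows "\<bar>indicator {0<..} q * (w (t + q) * q powr (- \<alpha>))\<bar> \<le> W * (indicator {0..T} q * q powr (- \<alpha>))"
proof (cases "0 < q \<and> q \<le> T")
  case True
  then show ?thesis using W[of "t + q"] \<open>0 \<le> t\<close> by (simp add: abs_mult mult_right_mono)
next
  case False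
  have "0 \<le> W" using W[of 0] by simp
  then show ?thesis using False z[of "t + q"] \<open>0 \<le> t\<close> by (auto simp: indicator_def)
qed

lemma
  assumes [measurable]: "w \<in> borel_measurable borel"
    and W: "\<And>t. 0 \<le> t \<Longrightarrow> \<bar>w t\<bar> \<le> W" and z: "\<And>t. T \<le> t \<Longrightarrow> w t = 0" and t: "0 \<le> t"
  shows frac_int_integrable: "integrable lborel (\<lambda>q. indicator {0<..} q * (w (t + q) * q powr (- \<alpha>)))"
    and frac_int_bound: "\<bar>frac_int \<alpha> w t\<bar> \<le> W * (T powr (1 - \<alpha>) / (1 - \<alpha>))"
    and frac_int_measurable: "frac_int \<alpha> w \<in> borel_measurable borel"
proof -
  have dom: "\<bar>indicator {0<..} q * (w (t + q) * q powr (- \<alpha>))\<bar> \<le> W * (indicator {0..T} q * q powr (- \<alpha>))" for q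
    by (rule frac_int_dominated) (use W z t in auto)
  have i: "integrable lborel (\<lambda>q. W * (indicator {0..T} q * q powr (- \<alpha>)))"
    using integrable_powr_from_0[of "- \<alpha>" T] \<alpha> by simp
  show i2: "integrable lborel (\<lambda>q. indicator {0<..} q * (w (t + q) * q powr (- \<alpha>)))"
    by (rule Bochner_Integration.integrable_bound[OF i]) (use dom in \<open>auto intro: order_trans[OF _ abs_ge_self]\<close>)
  have "\<bar>frac_int \<alpha> w t\<bar> \<le> (LBINT q. \<bar>indicator {0<..} q * (w (t + q) * q powr (- \<alpha>))\<bar>)"
    unfolding frac_int_def by (rule integral_abs_bound)
  also have "\<dots> \<le> (LBINT q. W * (indicator {0..T} q * q powr (- \<alpha>)))"
    by (rule integral_mono[OF integrable_abs[OF i2] i]) (use dom in auto)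
  also have "\<dots> = W * (T powr (1 - \<alpha>) / (1 - \<alpha>))"
    using integral_powr_from_0[of "- \<alpha>" T] \<alpha> T by simp
  finally show "\<bar>frac_int \<alpha> w t\<bar> \<le> W * (T powr (1 - \<alpha>) / (1 - \<alpha>))" .
  show "frac_int \<alpha> w \<in> borel_measurable borel" unfolding frac_int_def by measurable
qed

lemma frac_int_zero:
  assumes z: "\<And>t. T \<le> t \<Longrightarrow> w t = 0" and "T \<le> t"
  shows "frac_int \<alpha> w t = 0"
proof -
  have "(\<lambda>q. indicator {0<..} q * (w (t + q) * q powr (- \<alpha>))) = (\<lambda>q. 0)"
    using assms by (auto simp: indicator_def fun_eq_iff)
  then show ?thesis unfolding frac_int_def by simp
qed

text \<open>Fubini, using \<open>\<integral>\<^sub>q\<^sup>\<infinity> r\<^sup>-\<^sup>1\<^sup>-\<^sup>\<alpha> dr = q\<^sup>-\<^sup>\<alpha> / \<alpha>\<close>.\<close>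

lemma marchaud_eq_frac_int:
  assumes [measurable]: "w \<in> borel_measurable borel"
    and W: "\<And>t. 0 \<le> t \<Longrightarrow> \<bar>w t\<bar> \<le> W" and z: "\<And>t. T \<le> t \<Longrightarrow> w t = 0" and t: "0 \<le> t"
    and prim: "\<And>r. 0 < r \<Longrightarrow> \<phi> (t + r) - \<phi> t = (LBINT q. indicator {0<..r} q * w (t + q))"
  shows "marchaud \<alpha> \<phi> t = - frac_int \<alpha> w t / \<alpha>"
proof -
  let ?f = "\<lambda>q r. indicator {0<..} q * w (t + q) * (indicator {q..} r * r powr (- 1 - \<alpha>))"
  have m: "case_prod ?f \<in> borel_measurable (borel \<Otimes>\<^sub>M borel)"
  proof -
    have "(\<lambda>p. indicator {0<..} (fst p) * w (t + fst p) *
       (indicator {p. fst p \<le> snd p} p * snd p powr (- 1 - \<alpha>))) \<in> borel_measurable (borel \<Otimes>\<^sub>M borel)"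
      by measurable
    then show ?thesis by (rule measurable_cong[THEN iffD1, rotated]) (auto simp: indicator_def)
  qed
  have inner: "(\<integral>\<^sup>+r. ennreal (indicator {q..} r * r powr (- 1 - \<alpha>)) \<partial>lborel) = ennreal (q powr (- \<alpha>) / \<alpha>)"
    if "q > 0" for q
    using nn_integral_powr_to_inf[of "- 1 - \<alpha>" q] \<alpha> that by (simp add: minus_divide_left[symmetric])
  have nn: "(\<integral>\<^sup>+q. (\<integral>\<^sup>+r. ennreal \<bar>?f q r\<bar> \<partial>lborel) \<partial>lborel) < \<infinity>"
  proof -
    have "(\<integral>\<^sup>+q. (\<integral>\<^sup>+r. ennreal \<bar>?f q r\<bar> \<partial>lborel) \<partial>lborel)
        = (\<integral>\<^sup>+q. ennreal (\<bar>indicator {0<..} q * (w (t + q) * q powr (- \<alpha>))\<bar> / \<alpha>) \<partial>lborel)"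
    proof (rule nn_integral_cong)
      fix q :: real
      have "(\<integral>\<^sup>+r. ennreal \<bar>?f q r\<bar> \<partial>lborel)
          = (\<integral>\<^sup>+r. ennreal \<bar>indicator {0<..} q * w (t + q)\<bar> * ennreal (indicator {q..} r * r powr (- 1 - \<alpha>)) \<partial>lborel)"
        by (intro nn_integral_cong) (simp add: abs_mult ennreal_mult'[symmetric])
      also have "\<dots> = ennreal \<bar>indicator {0<..} q * w (t + q)\<bar> * (\<integral>\<^sup>+r. ennreal (indicator {q..} r * r powr (- 1 - \<alpha>)) \<partial>lborel)"
        by (rule nn_integral_cmult) measurable
      also have "\<dots> = ennreal (\<bar>indicator {0<..} q * (w (t + q) * q powr (- \<alpha>))\<bar> / \<alpha>)"
        using \<alpha> by (cases "0 < q") (auto simp: inner abs_mult ennreal_mult'[symmetric])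
      finally show "(\<integral>\<^sup>+r. ennreal \<bar>?f q r\<bar> \<partial>lborel) = \<dots>" .
    qed
    also have "\<dots> < \<infinity>"
    proof -
      have "integrable lborel (\<lambda>q. \<bar>indicator {0<..} q * (w (t + q) * q powr (- \<alpha>))\<bar> / \<alpha>)"
        by (intro integrable_divide integrable_abs frac_int_integrable[where W = W]) (use assms in auto)
      then show ?thesis using \<alpha> by (simp add: integrable_iff_bounded)
    qed
    finally show ?thesis .
  qed
  have "marchaud \<alpha> \<phi> t = - (LBINT r. (LBINT q. ?f q r))"
  proof -
    have "indicator {0<..} r * ((\<phi> t - \<phi> (t + r)) * r powr (- 1 - \<alpha>)) = - (LBINT q. ?f q r)" for r
    proof (cases "0 < r")
      case True
      have "(LBINT q. ?f q r) = (LBINT q. (indicator {0<..r} q * w (t + q)) * r powr (- 1 - \<alpha>))"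
        by (intro Bochner_Integration.integral_cong) (auto simp: indicator_def)
      also have "\<dots> = (\<phi> (t + r) - \<phi> t) * r powr (- 1 - \<alpha>)"
        using prim[OF True] by simp
      finally show ?thesis using True by (simp add: algebra_simps)
    next
      case False
      then have "(LBINT q. ?f q r) = (LBINT q::real. 0)"
        by (intro Bochner_Integration.integral_cong) (auto simp: indicator_def)
      then show ?thesis using False by simp
    qed
    then show ?thesis unfolding marchaud_def by simp
  qed
  also have "(LBINT r. (LBINT q. ?f q r)) = (LBINT q. (LBINT r. ?f q r))"
    by (rule lborel_Fubini(1)[OF m nn, symmetric])
  also have "\<dots> = (LBINT q. indicator {0<..} q * (w (t + q) * q powr (- \<alpha>)) / \<alpha>)"
  proof (intro Bochner_Integration.integral_cong refl)
    fix q :: real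
    show "(LBINT r. ?f q r) = indicator {0<..} q * (w (t + q) * q powr (- \<alpha>)) / \<alpha>"
    proof (cases "0 < q")
      case True
      then have "(LBINT r. indicator {q..} r * r powr (- 1 - \<alpha>)) = q powr (- \<alpha>) / \<alpha>"
        using integral_powr_to_inf[of "- 1 - \<alpha>" q] \<alpha> by (simp add: minus_divide_left[symmetric])
      then show ?thesis using True by simp
    qed simp
  qed
  finally show ?thesis unfolding frac_int_def by simp
qed

end

section \<open>Composition of fractional integrals and the adjoint relation\<close>

context frac_order
begin

text \<open>Fractional integration commutes with differentiation, in integrated form: if
  \<open>w'\<close> is the density of \<open>w\<close>, then its fractional integral is the density
  of that of \<open>w\<close>. Fubini over the lag \<open>p\<close> and the increment variable
  \<open>q\<close>.\<close>

lemma frac_int_diff: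
  assumes [measurable]: "w \<in> borel_measurable borel" "w' \<in> borel_measurable borel"
    and W: "\<And>t. 0 \<le> t \<Longrightarrow> \<bar>w t\<bar> \<le> W" and z: "\<And>t. T \<le> t \<Longrightarrow> w t = 0"
    and W': "\<And>t. 0 \<le> t \<Longrightarrow> \<bar>w' t\<bar> \<le> W'" and z': "\<And>t. T \<le> t \<Longrightarrow> w' t = 0"
    and prim: "\<And>t r. 0 \<le> t \<Longrightarrow> 0 < r \<Longrightarrow> w (t + r) - w t = (LBINT q. indicator {0<..r} q * w' (t + q))"
    and t: "0 \<le> t" and r: "0 < r"
  shows "frac_int \<alpha> w (t + r) - frac_int \<alpha> w t = (LBINT q. indicator {0<..r} q * frac_int \<alpha> w' (t + q))"
proof -
  let ?f = "\<lambda>p q. indicator {0<..} p * p powr (- \<alpha>) * (indicator {0<..r} q * w' (t + p + q))"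
  have m: "case_prod ?f \<in> borel_measurable (borel \<Otimes>\<^sub>M borel)" by measurable
  have i: "integrable lborel (\<lambda>p. W' * r * (indicator {0..T} p * p powr (- \<alpha>)))"
    using integrable_powr_from_0[of "- \<alpha>" T] \<alpha> by simp
  have nn: "(\<integral>\<^sup>+p. (\<integral>\<^sup>+q. ennreal \<bar>?f p q\<bar> \<partial>lborel) \<partial>lborel) < \<infinity>"
  proof -
    have "(\<integral>\<^sup>+p. (\<integral>\<^sup>+q. ennreal \<bar>?f p q\<bar> \<partial>lborel) \<partial>lborel)
        \<le> (\<integral>\<^sup>+p. ennreal (W' * r * (indicator {0..T} p * p powr (- \<alpha>))) \<partial>lborel)"
    proof (rule nn_integral_mono)
      fix p :: real
      have "\<bar>?f p q\<bar> \<le> W' * (indicator {0..T} p * p powr (- \<alpha>)) * indicator {0<..r} q" for q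
        using W'[of "t + p + q"] z'[of "t + p + q"] t W'[of 0]
        by (cases "p \<le> T") (auto simp: indicator_def abs_mult mult_right_mono mult.commute)
      then have "(\<integral>\<^sup>+q. ennreal \<bar>?f p q\<bar> \<partial>lborel)
          \<le> (\<integral>\<^sup>+q. ennreal (W' * (indicator {0..T} p * p powr (- \<alpha>)) * indicator {0<..r} q) \<partial>lborel)"
        by (intro nn_integral_mono ennreal_leI)
      also have "\<dots> = (\<integral>\<^sup>+q. ennreal (W' * (indicator {0..T} p * p powr (- \<alpha>))) * indicator {0<..r} q \<partial>lborel)"
        by (intro nn_integral_cong) (auto simp: indicator_def)
      also have "\<dots> = ennreal (W' * (indicator {0..T} p * p powr (- \<alpha>))) * ennreal r"
        using r by (subst nn_integral_cmult_indicator) auto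
      also have "\<dots> = ennreal (W' * r * (indicator {0..T} p * p powr (- \<alpha>)))"
        using r W'[of 0] by (simp add: ennreal_mult'[symmetric] mult_ac)
      finally show "(\<integral>\<^sup>+q. ennreal \<bar>?f p q\<bar> \<partial>lborel) \<le> \<dots>" .
    qed
    also have "\<dots> < \<infinity>" using integrableD(2)[OF i] r W'[of 0] by (simp add: abs_mult less_top)
    finally show ?thesis .
  qed
  have "frac_int \<alpha> w (t + r) - frac_int \<alpha> w t
      = (LBINT p. indicator {0<..} p * (w (t + r + p) * p powr (- \<alpha>)) - indicator {0<..} p * (w (t + p) * p powr (- \<alpha>)))"
    unfolding frac_int_def
    by (intro Bochner_Integration.integral_diff[symmetric] frac_int_integrable[where W = W]) (use W z t r in auto)
  also have "\<dots> = (LBINT p. (LBINT q. ?f p q))"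
  proof (intro Bochner_Integration.integral_cong refl)
    fix p :: real
    show "indicator {0<..} p * (w (t + r + p) * p powr (- \<alpha>)) - indicator {0<..} p * (w (t + p) * p powr (- \<alpha>))
        = (LBINT q. ?f p q)"
    proof (cases "0 < p")
      case True
      then show ?thesis using prim[of "t + p" r] t r
        by (simp add: algebra_simps)
    qed simp
  qed
  also have "\<dots> = (LBINT q. (LBINT p. ?f p q))" by (rule lborel_Fubini(1)[OF m nn])
  also have "\<dots> = (LBINT q. indicator {0<..r} q * frac_int \<alpha> w' (t + q))"
  proof (intro Bochner_Integration.integral_cong refl)
    fix q :: real
    have "(LBINT p. ?f p q) = (LBINT p. indicator {0<..r} q * (indicator {0<..} p * (w' (t + q + p) * p powr (- \<alpha>))))"
      by (intro Bochner_Integration.integral_cong refl) (simp add: add_ac)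
    then show "(LBINT p. ?f p q) = indicator {0<..r} q * frac_int \<alpha> w' (t + q)"
      unfolding frac_int_def by simp
  qed
  finally show ?thesis .
qed

text \<open>Substituting q = v x leads to Euler's Beta integral with parameters 1 - \<alpha> and
  \<alpha>. The powers of \<open>v\<close> have exponents 1, - \<alpha> and \<alpha> - 1 and cancel,
  so the value does not depend on \<open>v\<close>.\<close>

lemma beta_kernel:
  assumes "0 < v"
  shows "(\<integral>\<^sup>+q. ennreal (indicator {0<..<v} q * (q powr (- \<alpha>) * (v - q) powr (\<alpha> - 1))) \<partial>lborel)
      = ennreal (Gamma \<alpha> * Gamma (1 - \<alpha>))"
proof -
  have B: "(\<integral>\<^sup>+x. ennreal (indicator {0..1} x * (x powr (- \<alpha>) * (1 - x) powr (\<alpha> - 1))) \<partial>lborel)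
      = ennreal (Gamma \<alpha> * Gamma (1 - \<alpha>))"
    using nn_integral_has_integral_lebesgue[OF _ has_integral_Beta_real[of "1 - \<alpha>" \<alpha>]] \<alpha>
    by (simp add: Beta_def mult.commute)
  have "(\<integral>\<^sup>+q. ennreal (indicator {0<..<v} q * (q powr (- \<alpha>) * (v - q) powr (\<alpha> - 1))) \<partial>lborel)
      = ennreal \<bar>v\<bar> * (\<integral>\<^sup>+x. ennreal (indicator {0<..<v} (0 + v * x) * ((0 + v * x) powr (- \<alpha>) * (v - (0 + v * x)) powr (\<alpha> - 1))) \<partial>lborel)"
    by (rule nn_integral_real_affine) (use assms in auto)
  also have "\<dots> = (\<integral>\<^sup>+x. ennreal v * ennreal (indicator {0<..<v} (0 + v * x) * ((0 + v * x) powr (- \<alpha>) * (v - (0 + v * x)) powr (\<alpha> - 1))) \<partial>lborel)"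
    using assms by (subst nn_integral_cmult) auto
  also have "\<dots> = (\<integral>\<^sup>+x. ennreal (indicator {0..1} x * (x powr (- \<alpha>) * (1 - x) powr (\<alpha> - 1))) \<partial>lborel)"
  proof (rule nn_integral_cong)
    fix x :: real
    have "v * (indicator {0<..<v} (v * x) * ((v * x) powr (- \<alpha>) * (v - v * x) powr (\<alpha> - 1)))
        = indicator {0..1} x * (x powr (- \<alpha>) * (1 - x) powr (\<alpha> - 1))"
    proof (cases "0 < x \<and> x < 1")
      case True
      have "v - v * x = v * (1 - x)" by (simp add: algebra_simps)
      then have "v * ((v * x) powr (- \<alpha>) * (v - v * x) powr (\<alpha> - 1))
          = (v powr 1 * v powr (- \<alpha>) * v powr (\<alpha> - 1)) * (x powr (- \<alpha>) * (1 - x) powr (\<alpha> - 1))"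
        using True assms by (simp add: powr_mult)
      also have "v powr 1 * v powr (- \<alpha>) * v powr (\<alpha> - 1) = 1"
        using assms by (simp only: powr_add[symmetric]) simp
      finally show ?thesis using True assms by (simp add: indicator_def)
    next
      case False
      then have "indicator {0<..<v} (v * x) = (0::real)" using assms by (auto simp: indicator_def zero_less_mult_iff)
      moreover have "indicator {0..1} x * (x powr (- \<alpha>) * (1 - x) powr (\<alpha> - 1)) = 0"
        using False by (auto simp: indicator_def not_less)
      ultimately show ?thesis by simp
    qed
    then show "ennreal v * ennreal (indicator {0<..<v} (0 + v * x) * ((0 + v * x) powr (- \<alpha>) * (v - (0 + v * x)) powr (\<alpha> - 1)))
        = ennreal (indicator {0..1} x * (x powr (- \<alpha>) * (1 - x) powr (\<alpha> - 1)))"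
      using assms by (simp add: ennreal_mult'[symmetric])
  qed
  finally show ?thesis using B by simp
qed

text \<open>The semigroup property of fractional integrals: the two orders add up to 1, so the
  composition is an ordinary integral. After Fubini the inner integral is the Beta kernel; the Gamma
  factors remain because the operators are not normalised.\<close>

lemma frac_int_compose:
  assumes [measurable]: "w \<in> borel_measurable borel"
    and W: "\<And>t. 0 \<le> t \<Longrightarrow> \<bar>w t\<bar> \<le> W" and z: "\<And>t. T \<le> t \<Longrightarrow> w t = 0" and t: "0 \<le> t"
  shows "frac_int \<alpha> (frac_int (1 - \<alpha>) w) t
    = Gamma \<alpha> * Gamma (1 - \<alpha>) * (LBINT v. indicator {0<..} v * w (t + v))"
proof -
  let ?G = "Gamma \<alpha> * Gamma (1 - \<alpha>)"
  have G: "0 < ?G" using \<alpha> by (simp add: Gamma_real_pos)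
  let ?k = "\<lambda>v q. indicator {0<..<v} q * (q powr (- \<alpha>) * (v - q) powr (\<alpha> - 1))"
  let ?f = "\<lambda>v q. w (t + v) * ?k v q"
  have km: "(\<lambda>p. indicator {p. 0 < snd p \<and> snd p < fst p} p * (snd p powr (- \<alpha>) * (fst p - snd p) powr (\<alpha> - 1)))
      \<in> borel_measurable (borel \<Otimes>\<^sub>M borel)" by measurable
  have m: "case_prod ?f \<in> borel_measurable (borel \<Otimes>\<^sub>M borel)"
  proof -
    have "(\<lambda>p. w (t + fst p) * (indicator {p. 0 < snd p \<and> snd p < fst p} p * (snd p powr (- \<alpha>) * (fst p - snd p) powr (\<alpha> - 1))))
      \<in> borel_measurable (borel \<Otimes>\<^sub>M borel)" using km by (intro borel_measurable_times) auto
    then show ?thesis by (rule measurable_cong[THEN iffD1, rotated]) (auto simp: indicator_def)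
  qed
  have k0: "?k v q = 0" if "\<not> 0 < v" for v q using that by (auto simp: indicator_def)
  have nn: "(\<integral>\<^sup>+v. (\<integral>\<^sup>+q. ennreal \<bar>?f v q\<bar> \<partial>lborel) \<partial>lborel) < \<infinity>"
  proof -
    have "(\<integral>\<^sup>+v. (\<integral>\<^sup>+q. ennreal \<bar>?f v q\<bar> \<partial>lborel) \<partial>lborel) \<le> (\<integral>\<^sup>+v. ennreal (W * ?G) * indicator {0..T} v \<partial>lborel)"
    proof (rule nn_integral_mono)
      fix v :: real
      have "(\<integral>\<^sup>+q. ennreal \<bar>?f v q\<bar> \<partial>lborel) = (\<integral>\<^sup>+q. ennreal \<bar>w (t + v)\<bar> * ennreal (?k v q) \<partial>lborel)"
        by (intro nn_integral_cong) (simp add: abs_mult ennreal_mult'[symmetric])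
      also have "\<dots> = ennreal \<bar>w (t + v)\<bar> * (\<integral>\<^sup>+q. ennreal (?k v q) \<partial>lborel)"
        by (rule nn_integral_cmult) measurable
      also have "\<dots> \<le> ennreal (W * ?G) * indicator {0..T} v"
      proof (cases "0 < v \<and> v \<le> T")
        case True
        then show ?thesis using beta_kernel[of v] W[of "t + v"] t G
          by (auto simp: ennreal_mult'[symmetric] intro!: ennreal_leI mult_right_mono)
      next
        case False
        then show ?thesis using z[of "t + v"] t by (cases "0 < v") (auto simp: k0)
      qed
      finally show "(\<integral>\<^sup>+q. ennreal \<bar>?f v q\<bar> \<partial>lborel) \<le> \<dots>" .
    qed
    also have "\<dots> < \<infinity>"
      using T by (subst nn_integral_cmult_indicator) (auto simp: ennreal_mult'[symmetric] ennreal_mult_less_top)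
    finally show ?thesis .
  qed
  have "frac_int \<alpha> (frac_int (1 - \<alpha>) w) t = (LBINT q. (LBINT v. ?f v q))"
    unfolding frac_int_def[of \<alpha>]
  proof (intro Bochner_Integration.integral_cong refl)
    fix q :: real
    have "frac_int (1 - \<alpha>) w (t + q)
        = (LBINT v. indicator {0<..} (- q + 1 * v) * (w (t + q + (- q + 1 * v)) * (- q + 1 * v) powr (- (1 - \<alpha>))))"
      unfolding frac_int_def by (subst lborel_integral_real_affine[where c = 1 and t = "- q"]) simp_all
    also have "\<dots> = (LBINT v. indicator {q<..} v * (w (t + v) * (v - q) powr (\<alpha> - 1)))"
      by (intro Bochner_Integration.integral_cong refl) (auto simp: indicator_def)
    finally have e: "frac_int (1 - \<alpha>) w (t + q) = (LBINT v. indicator {q<..} v * (w (t + v) * (v - q) powr (\<alpha> - 1)))" .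
    show "indicator {0<..} q * (frac_int (1 - \<alpha>) w (t + q) * q powr (- \<alpha>)) = (LBINT v. ?f v q)"
    proof (cases "0 < q")
      case True
      have "(LBINT v. ?f v q) = (LBINT v. indicator {q<..} v * (w (t + v) * (v - q) powr (\<alpha> - 1)) * q powr (- \<alpha>))"
        using True by (intro Bochner_Integration.integral_cong refl) (auto simp: indicator_def)
      then show ?thesis using True e by simp
    next
      case False
      then have "(LBINT v. ?f v q) = (LBINT v::real. 0)"
        by (intro Bochner_Integration.integral_cong refl) (auto simp: indicator_def)
      then show ?thesis using False by simp
    qed
  qed
  also have "\<dots> = (LBINT v. (LBINT q. ?f v q))" by (rule lborel_Fubini(1)[OF m nn, symmetric])
  also have "\<dots> = (LBINT v. ?G * (indicator {0<..} v * w (t + v)))"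
  proof (intro Bochner_Integration.integral_cong refl)
    fix v :: real
    show "(LBINT q. ?f v q) = ?G * (indicator {0<..} v * w (t + v))"
    proof (cases "0 < v")
      case True
      have "(LBINT q. ?k v q) = ?G"
        by (rule integral_eq_nn_integral[THEN trans]) (use beta_kernel[OF True] G in auto)
      then show ?thesis using True by simp
    qed (simp add: k0)
  qed
  finally show ?thesis by simp
qed

text \<open>
  For each fixed \<open>r\<close> the translation \<open>t \<mapsto> t + r\<close> moves the increment from \<open>h\<close> to \<open>\<Phi>\<close>; Fubini exchanges
  the order of integration before and after.
\<close>

lemma marchaud_adjoint:
  assumes [measurable]: "h \<in> borel_measurable borel" "\<Phi> \<in> borel_measurable borel"
    and M: "\<And>t. \<bar>h t\<bar> \<le> M" and hz: "\<And>t. t \<notin> {0<..<T} \<Longrightarrow> h t = 0"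
    and fin: "(\<integral>\<^sup>+t. (\<integral>\<^sup>+r. ennreal \<bar>indicator {0<..<T} t * (indicator {0<..} r * ((h t - h (t - r)) * r powr (- 1 - \<alpha>)))\<bar> \<partial>lborel) \<partial>lborel) < \<infinity>"
    and B: "\<And>t. 0 \<le> t \<Longrightarrow> \<bar>\<Phi> t\<bar> \<le> B" and L: "\<And>t r. 0 \<le> t \<Longrightarrow> 0 < r \<Longrightarrow> \<bar>\<Phi> t - \<Phi> (t + r)\<bar> \<le> L * r"
    and \<Phi>z: "\<And>t. T \<le> t \<Longrightarrow> \<Phi> t = 0"
  shows "(LBINT t. indicator {0<..<T} t * marchaud_left \<alpha> h t * \<Phi> t) = (LBINT t. h t * marchaud \<alpha> \<Phi> t)"
proof -
  let ?f = "\<lambda>t r. indicator {0<..<T} t * (indicator {0<..} r * ((h t - h (t - r)) * r powr (- 1 - \<alpha>))) * \<Phi> t"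
  let ?g = "\<lambda>t r. h t * (indicator {0<..} r * ((\<Phi> t - \<Phi> (t + r)) * r powr (- 1 - \<alpha>)))"
  have fm: "case_prod ?f \<in> borel_measurable (borel \<Otimes>\<^sub>M borel)" by measurable
  have gm: "case_prod ?g \<in> borel_measurable (borel \<Otimes>\<^sub>M borel)" by measurable
  have B0: "0 \<le> B" using B[of 0] by simp
  have M0: "0 \<le> M" using M[of 0] by simp
  have L0: "0 \<le> L" using L[of 0 1] by simp
  have f_fin: "(\<integral>\<^sup>+t. (\<integral>\<^sup>+r. ennreal \<bar>?f t r\<bar> \<partial>lborel) \<partial>lborel) < \<infinity>"
  proof -
    have "(\<integral>\<^sup>+t. (\<integral>\<^sup>+r. ennreal \<bar>?f t r\<bar> \<partial>lborel) \<partial>lborel)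
       \<le> (\<integral>\<^sup>+t. ennreal B * (\<integral>\<^sup>+r. ennreal \<bar>indicator {0<..<T} t * (indicator {0<..} r * ((h t - h (t - r)) * r powr (- 1 - \<alpha>)))\<bar> \<partial>lborel) \<partial>lborel)"
    proof (rule nn_integral_mono)
      fix t :: real
      have "(\<integral>\<^sup>+r. ennreal \<bar>?f t r\<bar> \<partial>lborel)
        \<le> (\<integral>\<^sup>+r. ennreal B * ennreal \<bar>indicator {0<..<T} t * (indicator {0<..} r * ((h t - h (t - r)) * r powr (- 1 - \<alpha>)))\<bar> \<partial>lborel)"
      proof (rule nn_integral_mono)
        fix r :: real
        let ?u = "indicator {0<..<T} t * (indicator {0<..} r * ((h t - h (t - r)) * r powr (- 1 - \<alpha>)))"
        have "\<bar>?u * \<Phi> t\<bar> \<le> B * \<bar>?u\<bar>"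
        proof (cases "0 < t")
          case True
          then show ?thesis unfolding abs_mult[of _ "\<Phi> t"] using B[of t] by (subst mult.commute) (intro mult_right_mono; simp)
        qed simp
        then show "ennreal \<bar>?u * \<Phi> t\<bar> \<le> ennreal B * ennreal \<bar>?u\<bar>"
          using B0 by (simp add: ennreal_mult'[symmetric] ennreal_leI del: abs_mult)
      qed
      then show "(\<integral>\<^sup>+r. ennreal \<bar>?f t r\<bar> \<partial>lborel)
        \<le> ennreal B * (\<integral>\<^sup>+r. ennreal \<bar>indicator {0<..<T} t * (indicator {0<..} r * ((h t - h (t - r)) * r powr (- 1 - \<alpha>)))\<bar> \<partial>lborel)"
        by (subst (asm) nn_integral_cmult) auto
    qed
    also have "\<dots> < \<infinity>" using fin by (subst nn_integral_cmult) (auto simp: ennreal_mult_less_top)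
    finally show ?thesis .
  qed
  have g_fin: "(\<integral>\<^sup>+t. (\<integral>\<^sup>+r. ennreal \<bar>?g t r\<bar> \<partial>lborel) \<partial>lborel) < \<infinity>"
  proof -
    \<comment> \<open>For r up to 1 the Lipschitz bound lowers the singularity to the integrable
      power - \<alpha>; beyond 1 the supremum bound is enough.\<close>
    let ?b = "\<lambda>r. L * (indicator {0..1} r * r powr (- \<alpha>)) + 2 * B * (indicator {1..} r * r powr (- 1 - \<alpha>))"
    have bi: "integrable lborel ?b"
      using \<alpha> by (intro Bochner_Integration.integrable_add integrable_mult_right integrable_powr_from_0 integrable_powr_to_inf) auto
    have "(\<integral>\<^sup>+t. (\<integral>\<^sup>+r. ennreal \<bar>?g t r\<bar> \<partial>lborel) \<partial>lborel)
      \<le> (\<integral>\<^sup>+t. ennreal M * (\<integral>\<^sup>+r. ennreal (?b r) \<partial>lborel) * indicator {0<..<T} t \<partial>lborel)"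
    proof (rule nn_integral_mono)
      fix t :: real
      show "(\<integral>\<^sup>+r. ennreal \<bar>?g t r\<bar> \<partial>lborel) \<le> ennreal M * (\<integral>\<^sup>+r. ennreal (?b r) \<partial>lborel) * indicator {0<..<T} t"
      proof (cases "t \<in> {0<..<T}")
        case True
        have "\<bar>?g t r\<bar> \<le> M * ?b r" for r
        proof -
          have "indicator {0<..} r * (\<bar>\<Phi> t - \<Phi> (t + r)\<bar> * r powr (- 1 - \<alpha>)) \<le> ?b r"
          proof (cases "0 < r")
            case r: True
            show ?thesis
            proof (cases "r \<le> 1")
              case True
              have "\<bar>\<Phi> t - \<Phi> (t + r)\<bar> * r powr (- 1 - \<alpha>) \<le> L * r * r powr (- 1 - \<alpha>)"
                using L[of t r] \<open>t \<in> _\<close> r by (intro mult_right_mono) auto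
              also have "\<dots> = L * (r powr 1 * r powr (- 1 - \<alpha>))" using r by simp
              also have "r powr 1 * r powr (- 1 - \<alpha>) = r powr (- \<alpha>)" by (simp only: powr_add[symmetric]) simp
              finally show ?thesis using r True B0 by (auto simp: indicator_def)
            next
              case False
              have "\<bar>\<Phi> t - \<Phi> (t + r)\<bar> \<le> 2 * B" using B[of t] B[of "t + r"] \<open>t \<in> _\<close> r by auto
              then have "\<bar>\<Phi> t - \<Phi> (t + r)\<bar> * r powr (- 1 - \<alpha>) \<le> 2 * B * r powr (- 1 - \<alpha>)"
                by (intro mult_right_mono) auto
              then show ?thesis using r False by (auto simp: indicator_def)
            qed
          qed (use L0 B0 in auto)
          then have "\<bar>h t\<bar> * (indicator {0<..} r * (\<bar>\<Phi> t - \<Phi> (t + r)\<bar> * r powr (- 1 - \<alpha>))) \<le> M * ?b r"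
            using M[of t] M0 by (intro mult_mono) auto
          then show ?thesis by (simp add: abs_mult)
        qed
        then have "(\<integral>\<^sup>+r. ennreal \<bar>?g t r\<bar> \<partial>lborel) \<le> (\<integral>\<^sup>+r. ennreal M * ennreal (?b r) \<partial>lborel)"
          using M0 by (intro nn_integral_mono) (simp add: ennreal_mult'[symmetric] ennreal_leI)
        also have "\<dots> = ennreal M * (\<integral>\<^sup>+r. ennreal (?b r) \<partial>lborel)" by (rule nn_integral_cmult) measurable
        finally show ?thesis using True by simp
      qed (simp add: hz)
    qed
    also have "\<dots> = ennreal M * (\<integral>\<^sup>+r. ennreal (?b r) \<partial>lborel) * ennreal T"
      using T by (subst nn_integral_cmult_indicator) auto
    also have "\<dots> < \<infinity>"
    proof -
      have "?b r \<ge> 0" for r using L0 B0 by simp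
      then have "(\<integral>\<^sup>+r. ennreal (?b r) \<partial>lborel) < \<infinity>" using bi by (simp add: integrable_iff_bounded)
      then show ?thesis by (simp add: ennreal_mult_less_top)
    qed
    finally show ?thesis .
  qed
  have "(LBINT t. indicator {0<..<T} t * marchaud_left \<alpha> h t * \<Phi> t) = (LBINT t. (LBINT r. ?f t r))"
    unfolding marchaud_left_def by simp
  also have "\<dots> = (LBINT r. (LBINT t. ?f t r))" by (rule lborel_Fubini(1)[OF fm f_fin])
  also have "\<dots> = (LBINT r. (LBINT t. ?g t r))"
  proof (rule Bochner_Integration.integral_cong[OF refl])
    fix r :: real
    show "(LBINT t. ?f t r) = (LBINT t. ?g t r)"
    proof (cases "0 < r")
      case True
      have int: "integrable lborel (\<lambda>t. u t * v t)"
        if "u \<in> borel_measurable borel" "v \<in> borel_measurable borel" "\<And>t. \<bar>u t * v t\<bar> \<le> K * indicator {0..T} t"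
        for u v :: "real \<Rightarrow> real" and K
      proof (rule Bochner_Integration.integrable_bound)
        show "integrable lborel (\<lambda>t. K * indicator {0..T} t)"
          by (intro integrable_mult_right integrable_real_indicator) (auto simp: emeasure_lborel_Icc_eq)
        show "AE t in lborel. norm (u t * v t) \<le> norm (K * indicator {0..T} t)"
          using that(3) by (auto intro: order_trans[OF _ abs_ge_self])
      qed (use that in measurable)
      have MB: "\<bar>h s * \<Phi> u\<bar> \<le> M * B" if "0 \<le> u" for s u
        using M[of s] B[OF that] M0 unfolding abs_mult by (intro mult_mono) auto
      have i1: "integrable lborel (\<lambda>t. h t * \<Phi> t)"
        using MB by (intro int[where K = "M * B"]) (auto simp: indicator_def hz)
      have i2: "integrable lborel (\<lambda>t. h t * \<Phi> (t + r))"
        using MB True by (intro int[where K = "M * B"]) (auto simp: indicator_def hz)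
      have i3: "integrable lborel (\<lambda>t. h (t - r) * (indicator {0<..<T} t * \<Phi> t))"
        using MB M0 B0 by (intro int[where K = "M * B"]) (auto simp: indicator_def)
      have "(LBINT t. h (t - r) * (indicator {0<..<T} t * \<Phi> t))
          = (LBINT t. h (r + 1 * t - r) * (indicator {0<..<T} (r + 1 * t) * \<Phi> (r + 1 * t)))"
        by (subst lborel_integral_real_affine[where c = 1 and t = r]) simp_all
      also have "\<dots> = (LBINT t. h t * \<Phi> (t + r))"
      proof (intro Bochner_Integration.integral_cong refl)
        fix t
        show "h (r + 1 * t - r) * (indicator {0<..<T} (r + 1 * t) * \<Phi> (r + 1 * t)) = h t * \<Phi> (t + r)"
          using hz[of t] \<Phi>z[of "t + r"] True
          by (cases "0 < t"; cases "t + r < T") (auto simp: indicator_def add.commute)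
      qed
      finally have shift: "(LBINT t. h (t - r) * (indicator {0<..<T} t * \<Phi> t)) = (LBINT t. h t * \<Phi> (t + r))" .
      have "(LBINT t. ?f t r) = (LBINT t. (h t * \<Phi> t - h (t - r) * (indicator {0<..<T} t * \<Phi> t)) * r powr (- 1 - \<alpha>))"
        using True hz by (intro Bochner_Integration.integral_cong refl) (auto simp: indicator_def algebra_simps)
      also have "\<dots> = ((LBINT t. h t * \<Phi> t) - (LBINT t. h t * \<Phi> (t + r))) * r powr (- 1 - \<alpha>)"
        using i1 i3 shift by simp
      also have "\<dots> = (LBINT t. (h t * \<Phi> t - h t * \<Phi> (t + r)) * r powr (- 1 - \<alpha>))"
        using i1 i2 by simp
      also have "\<dots> = (LBINT t. ?g t r)"
        using True by (intro Bochner_Integration.integral_cong refl) (simp add: algebra_simps)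
      finally show ?thesis .
    next
      case False
      then show ?thesis by simp
    qed
  qed
  also have "\<dots> = (LBINT t. (LBINT r. ?g t r))" by (rule lborel_Fubini(1)[OF gm g_fin, symmetric])
  also have "\<dots> = (LBINT t. h t * marchaud \<alpha> \<Phi> t)" unfolding marchaud_def by simp
  finally show ?thesis .
qed

end

section \<open>Fractional integration by parts and its extension to Hoelder integrators\<close>

lemma FTC_Ioc:
  fixes F f :: "real \<Rightarrow> real"
  assumes "\<And>x. (F has_real_derivative f x) (at x)" "\<And>x. isCont f x" "0 \<le> r"
  shows "F (t + r) - F t = (LBINT q. indicator {0<..r} q * f (t + q))"
proof -
  have [measurable]: "f \<in> borel_measurable borel"
    using assms by (auto intro!: borel_measurable_continuous_onI continuous_at_imp_continuous_on)
  have "(LBINT q. f (t + q) * indicator {0..r} q) = F (t + r) - F (t + 0)"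
  proof (rule integral_FTC_Icc_real[OF \<open>0 \<le> r\<close>])
    show "((\<lambda>q. F (t + q)) has_real_derivative f (t + q)) (at q)" for q
      using assms(1)[of "q + t"] unfolding DERIV_shift by (simp add: add.commute)
    show "isCont (\<lambda>q. f (t + q)) q" for q
      by (rule isCont_o2[where f = "\<lambda>q. t + q"]) (auto intro: assms)
  qed
  moreover have "(LBINT q. f (t + q) * indicator {0..r} q) = (LBINT q. indicator {0<..r} q * f (t + q))"
    by (rule integral_cong_AE)
       (use AE_lborel_singleton[of "0::real"] in \<open>auto simp: indicator_def elim!: eventually_mono\<close>)
  ultimately show ?thesis by simp
qed

text \<open>The mean value theorem twice, first for the increment of \<open>L\<close> over a step
  \<open>e\<close>. Divided by the square of \<open>e\<close>, the second difference is the twofold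
  Steklov mean of \<open>k\<close>; being a value of \<open>k\<close> nearby, it inherits bounds,
  Hoelder constants and pointwise limits.\<close>

lemma second_difference_mvt:
  fixes L K k :: "real \<Rightarrow> real"
  assumes L: "\<And>x. (L has_real_derivative K x) (at x)" and K: "\<And>x. (K has_real_derivative k x) (at x)"
    and e: "0 < e"
  obtains \<xi> where "x < \<xi>" "\<xi> < x + 2 * e" "L (x + 2 * e) - 2 * L (x + e) + L x = e\<^sup>2 * k \<xi>"
proof -
  have dL: "((\<lambda>x. L (x + e) - L x) has_real_derivative K (y + e) - K y) (at y)" for y
    using L[of "y + e"] by (auto intro!: derivative_eq_intros L simp: DERIV_shift)
  obtain \<eta> where \<eta>: "x < \<eta>" "\<eta> < x + e"
    "(L (x + e + e) - L (x + e)) - (L (x + e) - L x) = (x + e - x) * (K (\<eta> + e) - K \<eta>)"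
    using MVT2[of x "x + e" "\<lambda>x. L (x + e) - L x" "\<lambda>y. K (y + e) - K y"] dL e by auto
  obtain \<xi> where \<xi>: "\<eta> < \<xi>" "\<xi> < \<eta> + e" "K (\<eta> + e) - K \<eta> = (\<eta> + e - \<eta>) * k \<xi>"
    using MVT2[of \<eta> "\<eta> + e" K k] K e by auto
  show thesis
  proof
    show "L (x + 2 * e) - 2 * L (x + e) + L x = e\<^sup>2 * k \<xi>"
      using \<eta>(3) \<xi>(3) by (simp add: algebra_simps power2_eq_square)
  qed (use \<eta> \<xi> in auto)
qed

lemma frac_int_scale: "frac_int \<alpha> (\<lambda>t. c * w t) t = c * frac_int \<alpha> w t"
proof -
  have "(\<lambda>q. indicator {0<..} q * (c * w (t + q) * q powr (- \<alpha>)))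
      = (\<lambda>q. c * (indicator {0<..} q * (w (t + q) * q powr (- \<alpha>))))" by (auto simp: fun_eq_iff)
  then show ?thesis unfolding frac_int_def by simp
qed

context frac_order
begin

lemma frac_order_compl: "frac_order (1 - \<alpha>) T"
  using \<alpha> T by unfold_locales auto

text \<open>Up to constants, the derivative of order 1 - \<alpha> of \<kappa> is a fractional
  integral \<open>\<Phi>\<close> of \<kappa>'. The adjoint relation puts the derivative of order
  \<alpha> on \<open>\<Phi>\<close>, and there the two fractional integrals compose to the ordinary
  integral of \<kappa>'', which is - \<kappa>'. Two derivatives are required since
  \<open>\<Phi>\<close> has to be Lipschitz; this is why the Steklov mean is taken twice.\<close>

lemma marchaud_by_parts:
  assumes [measurable]: "h \<in> borel_measurable borel"
    and M: "\<And>t. \<bar>h t\<bar> \<le> M" and hz: "\<And>t. t \<notin> {0<..<T} \<Longrightarrow> h t = 0"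
    and fin: "(\<integral>\<^sup>+t. (\<integral>\<^sup>+r. ennreal \<bar>indicator {0<..<T} t * (indicator {0<..} r * ((h t - h (t - r)) * r powr (- 1 - \<alpha>)))\<bar> \<partial>lborel) \<partial>lborel) < \<infinity>"
    and d1: "\<And>t. (\<kappa> has_real_derivative \<kappa>' t) (at t)" and d2: "\<And>t. (\<kappa>' has_real_derivative \<kappa>'' t) (at t)"
    and c2: "\<And>t. isCont \<kappa>'' t" and z1: "\<And>t. T \<le> t \<Longrightarrow> \<kappa>' t = 0" and z2: "\<And>t. T \<le> t \<Longrightarrow> \<kappa>'' t = 0"
  shows "(LBINT t. indicator {0<..<T} t * marchaud_left \<alpha> h t * marchaud (1 - \<alpha>) \<kappa> t)
    = - (Gamma \<alpha> * Gamma (1 - \<alpha>) / (\<alpha> * (1 - \<alpha>))) * (LBINT t. h t * \<kappa>' t)"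
proof -
  interpret c: frac_order "1 - \<alpha>" T by (rule frac_order_compl)
  have c1: "isCont \<kappa>' t" for t using d2 DERIV_isCont by blast
  have [measurable]: "\<kappa>' \<in> borel_measurable borel" "\<kappa>'' \<in> borel_measurable borel"
    using c1 c2 by (auto intro!: borel_measurable_continuous_onI continuous_at_imp_continuous_on)
  have bounded: "\<exists>W. \<forall>t\<ge>0. \<bar>w t\<bar> \<le> W" if "\<And>t. isCont w t" "\<And>t. T \<le> t \<Longrightarrow> w t = 0" for w :: "real \<Rightarrow> real"
  proof -
    have "compact (w ` {0..T})"
      by (intro compact_continuous_image continuous_at_imp_continuous_on) (use that in auto)
    then obtain W where W: "\<And>t. t \<in> {0..T} \<Longrightarrow> \<bar>w t\<bar> \<le> W"
      unfolding compact_eq_bounded_closed bounded_iff by (metis image_eqI real_norm_def)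
    have "\<bar>w t\<bar> \<le> \<bar>W\<bar>" if "0 \<le> t" for t
      using W[of t] that \<open>\<And>t. T \<le> t \<Longrightarrow> w t = 0\<close>[of t] by (cases "T \<le> t") auto
    then show ?thesis by blast
  qed
  obtain W1 where W1: "\<And>t. 0 \<le> t \<Longrightarrow> \<bar>\<kappa>' t\<bar> \<le> W1" using bounded[of \<kappa>'] c1 z1 by blast
  obtain W2 where W2: "\<And>t. 0 \<le> t \<Longrightarrow> \<bar>\<kappa>'' t\<bar> \<le> W2" using bounded[of \<kappa>''] c2 z2 by blast
  define E where "E = W2 * (T powr (1 - (1 - \<alpha>)) / (1 - (1 - \<alpha>)))"
  \<comment> \<open>\<open>w\<close> turns out to be the density of \<open>\<Phi>\<close>, and the
    bound on \<open>w\<close> its Lipschitz constant.\<close>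
  define w where "w = (\<lambda>t. - (1 / (1 - \<alpha>)) * frac_int (1 - \<alpha>) \<kappa>'' t)"
  define \<Phi> where "\<Phi> = (\<lambda>t. - (1 / (1 - \<alpha>)) * frac_int (1 - \<alpha>) \<kappa>' t)"
  have [measurable]: "frac_int (1 - \<alpha>) \<kappa>'' \<in> borel_measurable borel" "frac_int (1 - \<alpha>) \<kappa>' \<in> borel_measurable borel"
    using c.frac_int_measurable[of \<kappa>'' W2 0] c.frac_int_measurable[of \<kappa>' W1 0] W1 W2 z1 z2 by auto
  have E: "\<bar>frac_int (1 - \<alpha>) \<kappa>'' t\<bar> \<le> E" if "0 \<le> t" for t
    unfolding E_def by (rule c.frac_int_bound) (use W2 z2 that in auto)
  have E0: "0 \<le> E" using E[of 0] by simp
  have zw: "w t = 0" if "T \<le> t" for t unfolding w_def using c.frac_int_zero[of \<kappa>'' t] z2 that by simp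
  have z\<Phi>: "\<Phi> t = 0" if "T \<le> t" for t unfolding \<Phi>_def using c.frac_int_zero[of \<kappa>' t] z1 that by simp
  have mw [measurable]: "w \<in> borel_measurable borel" and m\<Phi> [measurable]: "\<Phi> \<in> borel_measurable borel"
    unfolding w_def \<Phi>_def by measurable
  have w_bound: "\<bar>w t\<bar> \<le> E / (1 - \<alpha>)" if "0 \<le> t" for t
    using E[OF that] \<alpha> by (simp add: w_def abs_mult divide_right_mono)
  have diff: "\<Phi> (t + r) - \<Phi> t = (LBINT q. indicator {0<..r} q * w (t + q))" if "0 \<le> t" "0 < r" for t r
  proof -
    have "frac_int (1 - \<alpha>) \<kappa>' (t + r) - frac_int (1 - \<alpha>) \<kappa>' t
        = (LBINT q. indicator {0<..r} q * frac_int (1 - \<alpha>) \<kappa>'' (t + q))"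
      by (rule c.frac_int_diff[where W = W1 and W' = W2])
         (use W1 W2 z1 z2 that FTC_Ioc[OF d2 c2] in auto)
    moreover have "\<Phi> (t + r) - \<Phi> t = - (1 / (1 - \<alpha>)) * (frac_int (1 - \<alpha>) \<kappa>' (t + r) - frac_int (1 - \<alpha>) \<kappa>' t)"
      unfolding \<Phi>_def by (rule right_diff_distrib[symmetric])
    moreover have "(\<lambda>q. indicator {0<..r} q * w (t + q))
        = (\<lambda>q. - (1 / (1 - \<alpha>)) * (indicator {0<..r} q * frac_int (1 - \<alpha>) \<kappa>'' (t + q)))"
      by (auto simp: w_def fun_eq_iff)
    ultimately show ?thesis by simp
  qed
  have lip: "\<bar>\<Phi> t - \<Phi> (t + r)\<bar> \<le> E / (1 - \<alpha>) * r" if "0 \<le> t" "0 < r" for t r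
  proof -
    have i: "integrable lborel (\<lambda>q. E / (1 - \<alpha>) * indicator {0<..r} q)"
      by (intro integrable_mult_right integrable_real_indicator) (use that in auto)
    have b: "\<bar>indicator {0<..r} q * w (t + q)\<bar> \<le> E / (1 - \<alpha>) * indicator {0<..r} q" for q
      using w_bound[of "t + q"] that by (auto simp: indicator_def)
    have i': "integrable lborel (\<lambda>q. indicator {0<..r} q * w (t + q))"
    proof (rule Bochner_Integration.integrable_bound[OF i])
      show "AE q in lborel. norm (indicator {0<..r} q * w (t + q)) \<le> norm (E / (1 - \<alpha>) * indicator {0<..r} q)"
        unfolding real_norm_def by (intro AE_I2 order_trans[OF b abs_ge_self])
    qed measurable
    have "\<bar>\<Phi> t - \<Phi> (t + r)\<bar> = \<bar>LBINT q. indicator {0<..r} q * w (t + q)\<bar>"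
      using diff[OF that] by (metis abs_minus_commute)
    also have "\<dots> \<le> (LBINT q. \<bar>indicator {0<..r} q * w (t + q)\<bar>)" by (rule integral_abs_bound)
    also have "\<dots> \<le> (LBINT q. E / (1 - \<alpha>) * indicator {0<..r} q)"
      by (rule integral_mono[OF integrable_abs[OF i'] i]) (use b in auto)
    also have "\<dots> = E / (1 - \<alpha>) * r" using that by simp
    finally show ?thesis .
  qed
  have \<Phi>_bound: "\<bar>\<Phi> t\<bar> \<le> W1 * (T powr (1 - (1 - \<alpha>)) / (1 - (1 - \<alpha>))) / (1 - \<alpha>)" if "0 \<le> t" for t
  proof -
    have "\<bar>\<Phi> t\<bar> = \<bar>frac_int (1 - \<alpha>) \<kappa>' t\<bar> / (1 - \<alpha>)" using \<alpha> by (simp add: \<Phi>_def abs_mult)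
    also have "\<dots> \<le> W1 * (T powr (1 - (1 - \<alpha>)) / (1 - (1 - \<alpha>))) / (1 - \<alpha>)"
      by (intro divide_right_mono c.frac_int_bound) (use W1 z1 that \<alpha> in auto)
    finally show ?thesis .
  qed
  have "(LBINT t. indicator {0<..<T} t * marchaud_left \<alpha> h t * marchaud (1 - \<alpha>) \<kappa> t)
      = (LBINT t. indicator {0<..<T} t * marchaud_left \<alpha> h t * \<Phi> t)"
  proof (rule Bochner_Integration.integral_cong[OF refl])
    fix t
    have "marchaud (1 - \<alpha>) \<kappa> t = \<Phi> t" if "0 \<le> t"
      using c.marchaud_eq_frac_int[of \<kappa>' W1 t \<kappa>] W1 z1 that FTC_Ioc[OF d1 c1] by (simp add: \<Phi>_def)
    then show "indicator {0<..<T} t * marchaud_left \<alpha> h t * marchaud (1 - \<alpha>) \<kappa> t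
        = indicator {0<..<T} t * marchaud_left \<alpha> h t * \<Phi> t" by (auto simp: indicator_def)
  qed
  also have "\<dots> = (LBINT t. h t * marchaud \<alpha> \<Phi> t)"
    by (rule marchaud_adjoint[OF assms(1) m\<Phi> M hz fin \<Phi>_bound lip z\<Phi>])
  also have "\<dots> = (LBINT t. - (Gamma \<alpha> * Gamma (1 - \<alpha>) / (\<alpha> * (1 - \<alpha>))) * (h t * \<kappa>' t))"
  proof (rule Bochner_Integration.integral_cong[OF refl])
    fix t
    show "h t * marchaud \<alpha> \<Phi> t = - (Gamma \<alpha> * Gamma (1 - \<alpha>) / (\<alpha> * (1 - \<alpha>))) * (h t * \<kappa>' t)"
    proof (cases "t \<in> {0<..<T}")
      case True
      then have t: "0 \<le> t" by simp
      have "marchaud \<alpha> \<Phi> t = - frac_int \<alpha> w t / \<alpha>"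
        by (rule marchaud_eq_frac_int[OF mw w_bound zw t]) (use diff[OF t] in auto)
      also have "frac_int \<alpha> w t = - (1 / (1 - \<alpha>)) * frac_int \<alpha> (frac_int (1 - \<alpha>) \<kappa>'') t"
        unfolding w_def by (rule frac_int_scale)
      also have "frac_int \<alpha> (frac_int (1 - \<alpha>) \<kappa>'') t
          = Gamma \<alpha> * Gamma (1 - \<alpha>) * (LBINT v. indicator {0<..} v * \<kappa>'' (t + v))"
        by (rule frac_int_compose) (use W2 z2 t in auto)
      also have "(LBINT v. indicator {0<..} v * \<kappa>'' (t + v)) = (LBINT v. indicator {0<..T} v * \<kappa>'' (t + v))"
        using t z2 by (intro Bochner_Integration.integral_cong refl) (auto simp: indicator_def)
      also have "\<dots> = \<kappa>' (t + T) - \<kappa>' t" using FTC_Ioc[OF d2 c2, of T t] T by simp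
      also have "\<kappa>' (t + T) = 0" using z1 t by simp
      finally have "marchaud \<alpha> \<Phi> t = - (Gamma \<alpha> * Gamma (1 - \<alpha>) / (\<alpha> * (1 - \<alpha>))) * \<kappa>' t"
        using \<alpha> by simp
      then show ?thesis by simp
    qed (simp add: hz)
  qed
  finally show ?thesis by simp
qed

lemma marchaud_left_integrable:
  assumes [measurable]: "h \<in> borel_measurable borel"
    and fin: "(\<integral>\<^sup>+t. (\<integral>\<^sup>+r. ennreal \<bar>indicator {0<..<T} t * (indicator {0<..} r * ((h t - h (t - r)) * r powr (- 1 - \<alpha>)))\<bar> \<partial>lborel) \<partial>lborel) < \<infinity>"
  shows "integrable lborel (\<lambda>t. indicator {0<..<T} t * marchaud_left \<alpha> h t)"
    and "AE t in lborel. t \<in> {0<..<T} \<longrightarrow> integrable lborel (\<lambda>r. indicator {0<..} r * ((h t - h (t - r)) * r powr (- 1 - \<alpha>)))"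
proof -
  let ?f = "\<lambda>t r. indicator {0<..<T} t * (indicator {0<..} r * ((h t - h (t - r)) * r powr (- 1 - \<alpha>)))"
  have m: "case_prod ?f \<in> borel_measurable (borel \<Otimes>\<^sub>M borel)" by measurable
  show "integrable lborel (\<lambda>t. indicator {0<..<T} t * marchaud_left \<alpha> h t)"
    using lborel_Fubini(3)[OF m fin] by (simp add: marchaud_left_def)
  show "AE t in lborel. t \<in> {0<..<T} \<longrightarrow> integrable lborel (\<lambda>r. indicator {0<..} r * ((h t - h (t - r)) * r powr (- 1 - \<alpha>)))"
    using lborel_Fubini(2)[OF m fin] by eventually_elim auto
qed

end

text \<open>Up to r = 1 the Hoelder bound is used, leaving the power \<gamma> - 1 - \<alpha>,
  integrable because \<alpha> < \<gamma>; beyond 1 the supremum bound. The majorant depends on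
  \<open>k\<close> through \<open>C\<close> and \<open>M\<close> only and so serves whole sequences,
  and it does not depend on \<open>t\<close>.\<close>

lemma (in frac_order)
  assumes \<gamma>: "\<alpha> < \<gamma>"
    and [measurable]: "k \<in> borel_measurable borel"
    and hol: "\<And>x y. \<bar>k x - k y\<bar> \<le> C * \<bar>x - y\<bar> powr \<gamma>" and bd: "\<And>x. \<bar>k x\<bar> \<le> M"
  shows marchaud_dominated: "\<bar>indicator {0<..} r * ((k t - k (t + r)) * r powr (- 1 - \<alpha>))\<bar>
      \<le> C * (indicator {0..1} r * r powr (\<gamma> - 1 - \<alpha>)) + 2 * M * (indicator {1..} r * r powr (- 1 - \<alpha>))"
    and marchaud_majorant_integrable:
      "integrable lborel (\<lambda>r. C * (indicator {0..1} r * r powr (\<gamma> - 1 - \<alpha>)) + 2 * M * (indicator {1..} r * r powr (- 1 - \<alpha>)))"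
    and marchaud_integrable: "integrable lborel (\<lambda>r. indicator {0<..} r * ((k t - k (t + r)) * r powr (- 1 - \<alpha>)))"
    and marchaud_bound: "\<bar>marchaud \<alpha> k t\<bar> \<le> (LBINT r. C * (indicator {0..1} r * r powr (\<gamma> - 1 - \<alpha>))
      + 2 * M * (indicator {1..} r * r powr (- 1 - \<alpha>)))"
    and marchaud_measurable: "marchaud \<alpha> k \<in> borel_measurable borel"
proof -
  have C0: "0 \<le> C" using hol[of 0 1] by simp
  have M0: "0 \<le> M" using bd[of 0] by simp
  show dom: "\<bar>indicator {0<..} r * ((k t - k (t + r)) * r powr (- 1 - \<alpha>))\<bar>
      \<le> C * (indicator {0..1} r * r powr (\<gamma> - 1 - \<alpha>)) + 2 * M * (indicator {1..} r * r powr (- 1 - \<alpha>))" for r t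
  proof (cases "0 < r")
    case r: True
    show ?thesis
    proof (cases "r \<le> 1")
      case True
      have "\<bar>k t - k (t + r)\<bar> * r powr (- 1 - \<alpha>) \<le> C * r powr \<gamma> * r powr (- 1 - \<alpha>)"
        using hol[of t "t + r"] r by (intro mult_right_mono) auto
      also have "\<dots> = C * r powr (\<gamma> - 1 - \<alpha>)" by (simp add: powr_add[symmetric] algebra_simps)
      finally show ?thesis using r True M0 by (auto simp: indicator_def abs_mult)
    next
      case False
      have "\<bar>k t - k (t + r)\<bar> \<le> 2 * M" using bd[of t] bd[of "t + r"] by linarith
      then have "\<bar>k t - k (t + r)\<bar> * r powr (- 1 - \<alpha>) \<le> 2 * M * r powr (- 1 - \<alpha>)"
        by (intro mult_right_mono) auto
      then show ?thesis using r False by (auto simp: indicator_def abs_mult)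
    qed
  qed (use C0 M0 in auto)
  show i: "integrable lborel (\<lambda>r. C * (indicator {0..1} r * r powr (\<gamma> - 1 - \<alpha>)) + 2 * M * (indicator {1..} r * r powr (- 1 - \<alpha>)))"
    using \<alpha> \<gamma> by (intro Bochner_Integration.integrable_add integrable_mult_right integrable_powr_from_0 integrable_powr_to_inf) auto
  show i2: "integrable lborel (\<lambda>r. indicator {0<..} r * ((k t - k (t + r)) * r powr (- 1 - \<alpha>)))" for t
    by (rule Bochner_Integration.integrable_bound[OF i]) (use dom in \<open>auto intro: order_trans[OF _ abs_ge_self]\<close>)
  have "\<bar>marchaud \<alpha> k t\<bar> \<le> (LBINT r. \<bar>indicator {0<..} r * ((k t - k (t + r)) * r powr (- 1 - \<alpha>))\<bar>)"
    unfolding marchaud_def by (rule integral_abs_bound)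
  also have "\<dots> \<le> (LBINT r. C * (indicator {0..1} r * r powr (\<gamma> - 1 - \<alpha>)) + 2 * M * (indicator {1..} r * r powr (- 1 - \<alpha>)))"
    by (rule integral_mono[OF integrable_abs[OF i2] i]) (use dom in auto)
  finally show "\<bar>marchaud \<alpha> k t\<bar> \<le> \<dots>" .
  show "marchaud \<alpha> k \<in> borel_measurable borel" unfolding marchaud_def by measurable
qed

lemma (in frac_order) marchaud_tendsto:
  assumes \<gamma>: "\<alpha> < \<gamma>"
    and [measurable]: "\<And>n. k n \<in> borel_measurable borel" "l \<in> borel_measurable borel"
    and hol: "\<And>n x y. \<bar>k n x - k n y\<bar> \<le> C * \<bar>x - y\<bar> powr \<gamma>" and bd: "\<And>n x. \<bar>k n x\<bar> \<le> M"
    and lim: "\<And>x. (\<lambda>n. k n x) \<longlonglongrightarrow> l x"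
  shows "(\<lambda>n. marchaud \<alpha> (k n) t) \<longlonglongrightarrow> marchaud \<alpha> l t"
  unfolding marchaud_def
proof (rule integral_dominated_convergence[OF _ _ marchaud_majorant_integrable[OF \<gamma> _ hol[of 0] bd[of 0]]])
  show "AE r in lborel. (\<lambda>n. indicator {0<..} r * ((k n t - k n (t + r)) * r powr (- 1 - \<alpha>)))
      \<longlonglongrightarrow> indicator {0<..} r * ((l t - l (t + r)) * r powr (- 1 - \<alpha>))"
    by (intro AE_I2 tendsto_intros lim)
  show "AE r in lborel. norm (indicator {0<..} r * ((k n t - k n (t + r)) * r powr (- 1 - \<alpha>)))
      \<le> C * (indicator {0..1} r * r powr (\<gamma> - 1 - \<alpha>)) + 2 * M * (indicator {1..} r * r powr (- 1 - \<alpha>))" for n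
    using marchaud_dominated[OF \<gamma> _ hol[of n] bd[of n]] by simp
qed measurable

lemma holder_imp_isCont:
  fixes k :: "real \<Rightarrow> real"
  assumes "0 < \<gamma>" and hol: "\<And>x y. \<bar>k x - k y\<bar> \<le> C * \<bar>x - y\<bar> powr \<gamma>"
  shows "isCont k x"
proof -
  have "((\<lambda>y. C * \<bar>y - x\<bar> powr \<gamma>) \<longlongrightarrow> 0) (at x)"
    using \<open>0 < \<gamma>\<close> by (auto intro!: tendsto_eq_intros)
  then have "((\<lambda>y. k y - k x) \<longlongrightarrow> 0) (at x)"
    by (rule Lim_null_comparison[rotated]) (use hol in simp)
  then show ?thesis unfolding isCont_def by (simp add: LIM_zero_iff)
qed

text \<open>\<open>k\<close> is only Hoelder continuous, so integration by parts is applied to its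
  Steklov means \<open>\<kappa> n\<close>. They obey the bounds of \<open>k\<close> uniformly in
  \<open>n\<close>; hence their Marchaud derivatives converge boundedly, whereas the other side
  stays an ordinary integral against \<open>\<kappa>' n\<close>.\<close>

lemma (in frac_order) marchaud_pairing_limit:
  assumes \<gamma>: "1 - \<alpha> < \<gamma>"
    and h [measurable]: "h \<in> borel_measurable borel"
    and M: "\<And>t. \<bar>h t\<bar> \<le> M" and hz: "\<And>t. t \<notin> {0<..<T} \<Longrightarrow> h t = 0"
    and fin: "(\<integral>\<^sup>+t. (\<integral>\<^sup>+r. ennreal \<bar>indicator {0<..<T} t * (indicator {0<..} r * ((h t - h (t - r)) * r powr (- 1 - \<alpha>)))\<bar> \<partial>lborel) \<partial>lborel) < \<infinity>"
    and hol: "\<And>x y. \<bar>k x - k y\<bar> \<le> C * \<bar>x - y\<bar> powr \<gamma>" and bd: "\<And>x. \<bar>k x\<bar> \<le> B"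
    and kz: "\<And>x. T \<le> x \<Longrightarrow> k x = 0"
    and L: "\<And>x. (L has_real_derivative K x) (at x)" and K: "\<And>x. (K has_real_derivative k x) (at x)"
    and e: "\<And>n. 0 < e n" "e \<longlonglongrightarrow> 0"
  shows "(\<lambda>n. LBINT t. h t * ((K (t + 2 * e n) - 2 * K (t + e n) + K t) / (e n)\<^sup>2)) \<longlonglongrightarrow>
    - (\<alpha> * (1 - \<alpha>) / (Gamma \<alpha> * Gamma (1 - \<alpha>))) *
      (LBINT t. indicator {0<..<T} t * marchaud_left \<alpha> h t * marchaud (1 - \<alpha>) k t)"
proof -
  interpret c: frac_order "1 - \<alpha>" T by (rule frac_order_compl)
  have \<gamma>0: "0 < \<gamma>" using \<gamma> \<alpha> by linarith
  have kc: "isCont k x" for x by (rule holder_imp_isCont[OF \<gamma>0 hol])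
  have [measurable]: "k \<in> borel_measurable borel"
    using kc by (auto intro!: borel_measurable_continuous_onI continuous_at_imp_continuous_on)
  \<comment> \<open>Forward differences only: as \<open>k\<close> vanishes from \<open>T\<close> on
    and \<open>K\<close> is constant there, \<open>\<kappa>' n\<close> and
    \<open>\<kappa>'' n\<close> vanish from \<open>T\<close> on, as the integration by parts
    demands.\<close>
  define \<kappa> where "\<kappa> = (\<lambda>n t. (L (t + 2 * e n) - 2 * L (t + e n) + L t) / (e n)\<^sup>2)"
  define \<kappa>' where "\<kappa>' = (\<lambda>n t. (K (t + 2 * e n) - 2 * K (t + e n) + K t) / (e n)\<^sup>2)"
  define \<kappa>'' where "\<kappa>'' = (\<lambda>n t. (k (t + 2 * e n) - 2 * k (t + e n) + k t) / (e n)\<^sup>2)"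
  have d1: "(\<kappa> n has_real_derivative \<kappa>' n t) (at t)" for n t
    unfolding \<kappa>_def \<kappa>'_def 
    by (intro DERIV_cdivide DERIV_add DERIV_diff DERIV_cmult L L[of "t + _", unfolded DERIV_shift])
  have d2: "(\<kappa>' n has_real_derivative \<kappa>'' n t) (at t)" for n t
    unfolding \<kappa>'_def \<kappa>''_def 
    by (intro DERIV_cdivide DERIV_add DERIV_diff DERIV_cmult K K[of "t + _", unfolded DERIV_shift])
  have kc': "isCont (\<lambda>t. k (t + a)) t" for a t
    by (rule isCont_o2[where f = "\<lambda>q. q + a"]) (auto intro: kc)
  have c2: "isCont (\<kappa>'' n) t" for n t
    unfolding \<kappa>''_def using e(1)[of n] by (intro continuous_intros kc' kc) auto
  have Kz: "K y = K x" if "T \<le> x" "x \<le> y" for x y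
  proof (cases "x = y")
    case False
    then have "x < y" using that by simp
    from MVT2[OF this K] obtain z where "x < z" "K y - K x = (y - x) * k z" by blast
    then show ?thesis using kz[of z] that by simp
  qed simp
  have z1: "\<kappa>' n t = 0" if "T \<le> t" for n t
    using Kz[OF that, of "t + 2 * e n"] Kz[OF that, of "t + e n"] e(1)[of n] by (simp add: \<kappa>'_def)
  have z2: "\<kappa>'' n t = 0" if "T \<le> t" for n t
    using kz[of t] kz[of "t + 2 * e n"] kz[of "t + e n"] that e(1)[of n] by (simp add: \<kappa>''_def)
  have mvt: "\<exists>\<xi>. x < \<xi> \<and> \<xi> < x + 2 * e n \<and> \<kappa> n x = k \<xi>" for n x
  proof -
    obtain \<xi> where "x < \<xi>" "\<xi> < x + 2 * e n" "L (x + 2 * e n) - 2 * L (x + e n) + L x = (e n)\<^sup>2 * k \<xi>"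
      by (rule second_difference_mvt[OF L K e(1)])
    then show ?thesis using e(1)[of n] by (auto simp: \<kappa>_def)
  qed
  have \<kappa>_bd: "\<bar>\<kappa> n x\<bar> \<le> B" for n x using mvt[of x n] bd by auto
  have \<kappa>_hol: "\<bar>\<kappa> n x - \<kappa> n y\<bar> \<le> C * \<bar>x - y\<bar> powr \<gamma>" for n x y
  proof -
    \<comment> \<open>Applying the mean value theorem to the difference of \<open>L\<close> and its
      translate by \<open>d\<close> yields one common point \<xi> for both means; two separate
      points would not give the Hoelder bound.\<close>
    define d where "d = y - x"
    have 1: "((\<lambda>x. L x - L (x + d)) has_real_derivative K x - K (x + d)) (at x)" for x
      using L[of "x + d"] L[of x] unfolding DERIV_shift by (auto intro!: derivative_eq_intros)
    have 2: "((\<lambda>x. K x - K (x + d)) has_real_derivative k x - k (x + d)) (at x)" for x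
      using K[of "x + d"] K[of x] unfolding DERIV_shift by (auto intro!: derivative_eq_intros)
    obtain \<xi> where \<xi>: "(L (x + 2 * e n) - L (x + 2 * e n + d)) - 2 * (L (x + e n) - L (x + e n + d)) + (L x - L (x + d))
        = (e n)\<^sup>2 * (k \<xi> - k (\<xi> + d))"
      by (rule second_difference_mvt[OF 1 2 e(1)])
    have "(e n)\<^sup>2 * (\<kappa> n x - \<kappa> n y) = (e n)\<^sup>2 * (k \<xi> - k (\<xi> + d))"
    proof -
      have "(e n)\<^sup>2 * \<kappa> n z = L (z + 2 * e n) - 2 * L (z + e n) + L z" for z
        using e(1)[of n] by (simp add: \<kappa>_def)
      moreover have "y + 2 * e n = x + 2 * e n + d" "y + e n = x + e n + d" "y = x + d" by (simp_all add: d_def)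
      ultimately show ?thesis using \<xi> by (simp add: right_diff_distrib add.assoc add.commute[of d])
    qed
    then have "\<kappa> n x - \<kappa> n y = k \<xi> - k (\<xi> + d)" using e(1)[of n] by simp
    then show ?thesis using hol[of \<xi> "\<xi> + d"] by (simp add: d_def abs_minus_commute)
  qed
  have \<kappa>_lim: "(\<lambda>n. \<kappa> n x) \<longlonglongrightarrow> k x" for x
  proof -
    have C0: "0 \<le> C" using hol[of 0 1] by simp
    have "(\<lambda>n. \<kappa> n x - k x) \<longlonglongrightarrow> 0"
    proof (rule Lim_null_comparison)
      show "\<forall>\<^sub>F n in sequentially. norm (\<kappa> n x - k x) \<le> C * (2 * e n) powr \<gamma>"
      proof (intro always_eventually allI)
        fix n
        obtain \<xi> where \<xi>: "x < \<xi>" "\<xi> < x + 2 * e n" "\<kappa> n x = k \<xi>" using mvt by blast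
        have "\<bar>k \<xi> - k x\<bar> \<le> C * \<bar>\<xi> - x\<bar> powr \<gamma>" by (rule hol)
        also have "\<dots> \<le> C * (2 * e n) powr \<gamma>"
          using \<xi> C0 \<gamma>0 by (intro mult_left_mono powr_mono2) auto
        finally show "norm (\<kappa> n x - k x) \<le> C * (2 * e n) powr \<gamma>" using \<xi> by simp
      qed
      show "(\<lambda>n. C * (2 * e n) powr \<gamma>) \<longlonglongrightarrow> 0"
        using \<gamma>0 by (auto intro!: tendsto_eq_intros e(2) always_eventually simp: e(1) less_imp_le)
    qed
    then show ?thesis by (simp add: LIM_zero_iff)
  qed
  have [measurable]: "\<kappa> n \<in> borel_measurable borel" for n
    using d1 by (auto intro!: borel_measurable_continuous_onI continuous_at_imp_continuous_on DERIV_isCont)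
  have [measurable]: "marchaud (1 - \<alpha>) (\<kappa> n) \<in> borel_measurable borel" for n
    by (rule c.marchaud_measurable[OF \<gamma> _ \<kappa>_hol \<kappa>_bd]) measurable
  have [measurable]: "marchaud (1 - \<alpha>) k \<in> borel_measurable borel"
    by (rule c.marchaud_measurable[OF \<gamma> _ hol bd]) measurable
  have [measurable]: "marchaud_left \<alpha> h \<in> borel_measurable borel"
    unfolding marchaud_left_def by measurable
  define D where "D = (LBINT r. C * (indicator {0..1} r * r powr (\<gamma> - 1 - (1 - \<alpha>)))
      + 2 * B * (indicator {1..} r * r powr (- 1 - (1 - \<alpha>))))"
  have D: "\<bar>marchaud (1 - \<alpha>) (\<kappa> n) t\<bar> \<le> D" for n t
    unfolding D_def by (rule c.marchaud_bound[OF \<gamma> _ \<kappa>_hol \<kappa>_bd]) measurable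
  have "(\<lambda>n. LBINT t. indicator {0<..<T} t * marchaud_left \<alpha> h t * marchaud (1 - \<alpha>) (\<kappa> n) t) \<longlonglongrightarrow>
      (LBINT t. indicator {0<..<T} t * marchaud_left \<alpha> h t * marchaud (1 - \<alpha>) k t)"
  proof (rule integral_dominated_convergence)
    show "integrable lborel (\<lambda>t. \<bar>indicator {0<..<T} t * marchaud_left \<alpha> h t\<bar> * D)"
      by (intro integrable_mult_left integrable_abs marchaud_left_integrable(1)[OF h fin])
    show "AE t in lborel. (\<lambda>n. indicator {0<..<T} t * marchaud_left \<alpha> h t * marchaud (1 - \<alpha>) (\<kappa> n) t)
        \<longlonglongrightarrow> indicator {0<..<T} t * marchaud_left \<alpha> h t * marchaud (1 - \<alpha>) k t"
      by (intro AE_I2 tendsto_mult tendsto_const c.marchaud_tendsto[OF \<gamma> _ _ \<kappa>_hol \<kappa>_bd \<kappa>_lim]) measurable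
    show "AE t in lborel. norm (indicator {0<..<T} t * marchaud_left \<alpha> h t * marchaud (1 - \<alpha>) (\<kappa> n) t)
        \<le> \<bar>indicator {0<..<T} t * marchaud_left \<alpha> h t\<bar> * D" for n
      unfolding real_norm_def abs_mult[of "_ * _"] by (intro AE_I2 mult_left_mono D) simp
  qed measurable
  then have "(\<lambda>n. - (\<alpha> * (1 - \<alpha>) / (Gamma \<alpha> * Gamma (1 - \<alpha>))) *
      (LBINT t. indicator {0<..<T} t * marchaud_left \<alpha> h t * marchaud (1 - \<alpha>) (\<kappa> n) t)) \<longlonglongrightarrow>
    - (\<alpha> * (1 - \<alpha>) / (Gamma \<alpha> * Gamma (1 - \<alpha>))) *
      (LBINT t. indicator {0<..<T} t * marchaud_left \<alpha> h t * marchaud (1 - \<alpha>) k t)"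
    by (intro tendsto_mult tendsto_const)
  moreover have "- (\<alpha> * (1 - \<alpha>) / (Gamma \<alpha> * Gamma (1 - \<alpha>))) *
      (LBINT t. indicator {0<..<T} t * marchaud_left \<alpha> h t * marchaud (1 - \<alpha>) (\<kappa> n) t)
    = (LBINT t. h t * \<kappa>' n t)" for n
  proof -
    have "Gamma \<alpha> \<noteq> 0" "Gamma (1 - \<alpha>) \<noteq> 0"
      using \<alpha> by (metis Gamma_real_pos diff_gt_0_iff_gt less_irrefl)+
    moreover have "(LBINT t. indicator {0<..<T} t * marchaud_left \<alpha> h t * marchaud (1 - \<alpha>) (\<kappa> n) t)
        = - (Gamma \<alpha> * Gamma (1 - \<alpha>) / (\<alpha> * (1 - \<alpha>))) * (LBINT t. h t * \<kappa>' n t)"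
      by (rule marchaud_by_parts[OF h M hz fin d1 d2 c2 z1 z2])
    ultimately show ?thesis using \<alpha> by simp
  qed
  ultimately show ?thesis unfolding \<kappa>'_def by simp
qed

section \<open>The fractional Stieltjes integral\<close>

lemma frac_deriv_left_lborel:
  assumes [measurable]: "h \<in> borel_measurable borel"
  shows "frac_deriv_left \<alpha> h t = 1 / Gamma (1 - \<alpha>) *
     (h t / t powr \<alpha> + \<alpha> * (LBINT r. indicator {0<..<t} r * ((h t - h r) / (t - r) powr (\<alpha> + 1))))"
  unfolding frac_deriv_left_def set_lebesgue_integral_def
  by (subst integral_completion) auto

lemma frac_deriv_right_lborel:
  assumes [measurable]: "k \<in> borel_measurable borel"
  shows "frac_deriv_right T \<alpha> k t = 1 / Gamma (1 - \<alpha>) *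
     (k t / (T - t) powr \<alpha> + \<alpha> * (LBINT r. indicator {t<..<T} r * ((k t - k r) / (r - t) powr (\<alpha> + 1))))"
  unfolding frac_deriv_right_def set_lebesgue_integral_def
  by (subst integral_completion) auto

lemma W_0_iff_lborel:
  assumes [measurable]: "h \<in> borel_measurable borel"
  shows "h \<in> W_0 T \<theta> \<longleftrightarrow>
    (\<integral>\<^sup>+t\<in>{0<..<T}. ennreal (\<bar>h t\<bar> / t powr \<theta>) \<partial>lborel) +
     (\<integral>\<^sup>+t\<in>{0<..<T}. (\<integral>\<^sup>+u\<in>{0<..<T}.
        ennreal (\<bar>h t - h u\<bar> / \<bar>t - u\<bar> powr (1 + \<theta>)) \<partial>lborel) \<partial>lborel) < \<infinity>"
proof -
  have "h \<in> borel_measurable (lebesgue_on {0<..<T})"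
    by (intro measurable_restrict_space1 measurable_completion) simp
  then show ?thesis unfolding W_0_def by (simp add: nn_integral_completion)
qed

section \<open>Weyl-Marchaud derivatives on (0, T) as Marchaud derivatives on the line\<close>

context frac_order
begin

lemma frac_deriv_left_eq_marchaud:
  assumes [measurable]: "h \<in> borel_measurable borel" and hz: "\<And>t. t \<notin> {0<..<T} \<Longrightarrow> h t = 0"
    and t: "0 < t" and int: "integrable lborel (\<lambda>r. indicator {0<..} r * ((h t - h (t - r)) * r powr (- 1 - \<alpha>)))"
  shows "frac_deriv_left \<alpha> h t = \<alpha> / Gamma (1 - \<alpha>) * marchaud_left \<alpha> h t"
proof -
  let ?f = "\<lambda>r. indicator {0<..} r * ((h t - h (t - r)) * r powr (- 1 - \<alpha>))"
  have i1: "integrable lborel (\<lambda>r. indicator {..<t} r * ?f r)" and i2: "integrable lborel (\<lambda>r. indicator {t..} r * ?f r)"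
    using integrable_mult_indicator[OF _ int, of "{..<t}"] integrable_mult_indicator[OF _ int, of "{t..}"] by simp_all
  have "marchaud_left \<alpha> h t = (LBINT r. indicator {..<t} r * ?f r + indicator {t..} r * ?f r)"
    unfolding marchaud_left_def by (intro Bochner_Integration.integral_cong refl) (auto simp: indicator_def)
  also have "\<dots> = (LBINT r. indicator {..<t} r * ?f r) + (LBINT r. indicator {t..} r * ?f r)"
    by (rule Bochner_Integration.integral_add[OF i1 i2])
  also have "(LBINT r. indicator {t..} r * ?f r) = (LBINT r. h t * (indicator {t..} r * r powr (- 1 - \<alpha>)))"
    using t hz by (intro Bochner_Integration.integral_cong refl) (auto simp: indicator_def)
  also have "\<dots> = h t * (t powr (- \<alpha>) / \<alpha>)"
    using integral_powr_to_inf[of "- 1 - \<alpha>" t] \<alpha> t by (simp add: minus_divide_left[symmetric])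
  also have "(LBINT r. indicator {..<t} r * ?f r)
      = (LBINT r. indicator {..<t} (t + (- 1) * r) * ?f (t + (- 1) * r))"
    by (subst lborel_integral_real_affine[where c = "-1" and t = t]) simp_all
  also have "\<dots> = (LBINT r. indicator {0<..<t} r * ((h t - h r) / (t - r) powr (\<alpha> + 1)))"
  proof (intro Bochner_Integration.integral_cong refl)
    fix r :: real
    have "(t - r) powr (- 1 - \<alpha>) = 1 / (t - r) powr (\<alpha> + 1)"
      by (simp add: powr_minus_divide[symmetric] add.commute)
    then show "indicator {..<t} (t + (- 1) * r) * ?f (t + (- 1) * r)
        = indicator {0<..<t} r * ((h t - h r) / (t - r) powr (\<alpha> + 1))" by (auto simp: indicator_def)
  qed
  finally have *: "marchaud_left \<alpha> h t = (LBINT r. indicator {0<..<t} r * ((h t - h r) / (t - r) powr (\<alpha> + 1)))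
      + h t * (t powr (- \<alpha>) / \<alpha>)" .
  show ?thesis unfolding frac_deriv_left_lborel[OF assms(1)] * using \<alpha>
    by (simp add: field_simps powr_minus_divide)
qed

lemma frac_deriv_right_eq_marchaud:
  assumes [measurable]: "k \<in> borel_measurable borel" and kz: "\<And>t. T \<le> t \<Longrightarrow> k t = 0"
    and t: "t < T" and int: "integrable lborel (\<lambda>r. indicator {0<..} r * ((k t - k (t + r)) * r powr (- 1 - \<alpha>)))"
  shows "frac_deriv_right T \<alpha> k t = \<alpha> / Gamma (1 - \<alpha>) * marchaud \<alpha> k t"
proof -
  let ?f = "\<lambda>r. indicator {0<..} r * ((k t - k (t + r)) * r powr (- 1 - \<alpha>))"
  have i1: "integrable lborel (\<lambda>r. indicator {..<T - t} r * ?f r)" and i2: "integrable lborel (\<lambda>r. indicator {T - t..} r * ?f r)"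
    using integrable_mult_indicator[OF _ int, of "{..<T - t}"] integrable_mult_indicator[OF _ int, of "{T - t..}"] by simp_all
  have "marchaud \<alpha> k t = (LBINT r. indicator {..<T - t} r * ?f r + indicator {T - t..} r * ?f r)"
    unfolding marchaud_def by (intro Bochner_Integration.integral_cong refl) (auto simp: indicator_def)
  also have "\<dots> = (LBINT r. indicator {..<T - t} r * ?f r) + (LBINT r. indicator {T - t..} r * ?f r)"
    by (rule Bochner_Integration.integral_add[OF i1 i2])
  also have "(LBINT r. indicator {T - t..} r * ?f r) = (LBINT r. k t * (indicator {T - t..} r * r powr (- 1 - \<alpha>)))"
    using t kz by (intro Bochner_Integration.integral_cong refl) (auto simp: indicator_def)
  also have "\<dots> = k t * ((T - t) powr (- \<alpha>) / \<alpha>)"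
    using integral_powr_to_inf[of "- 1 - \<alpha>" "T - t"] \<alpha> t by (simp add: minus_divide_left[symmetric])
  also have "(LBINT r. indicator {..<T - t} r * ?f r)
      = (LBINT r. indicator {..<T - t} (- t + 1 * r) * ?f (- t + 1 * r))"
    by (subst lborel_integral_real_affine[where c = "1" and t = "- t"]) simp_all
  also have "\<dots> = (LBINT r. indicator {t<..<T} r * ((k t - k r) / (r - t) powr (\<alpha> + 1)))"
  proof (intro Bochner_Integration.integral_cong refl)
    fix r :: real
    have "(r - t) powr (- 1 - \<alpha>) = 1 / (r - t) powr (\<alpha> + 1)"
      by (simp add: powr_minus_divide[symmetric] add.commute)
    then show "indicator {..<T - t} (- t + 1 * r) * ?f (- t + 1 * r)
        = indicator {t<..<T} r * ((k t - k r) / (r - t) powr (\<alpha> + 1))" by (auto simp: indicator_def)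
  qed
  finally have *: "marchaud \<alpha> k t = (LBINT r. indicator {t<..<T} r * ((k t - k r) / (r - t) powr (\<alpha> + 1)))
      + k t * ((T - t) powr (- \<alpha>) / \<alpha>)" .
  show ?thesis unfolding frac_deriv_right_lborel[OF assms(1)] * using \<alpha>
    by (simp add: field_simps powr_minus_divide)
qed

text \<open>Lags r < t are covered by the double integral in \<open>W_0\<close>. For r beyond
  \<open>t\<close> the value at t - r is 0, and integrating the kernel gives the weighted integral
  with the factor 1 / \<alpha>.\<close>

lemma W_0_imp_marchaud_left_finite:
  assumes [measurable]: "h \<in> borel_measurable borel" and hz: "\<And>t. t \<notin> {0<..<T} \<Longrightarrow> h t = 0"
    and W: "h \<in> W_0 T \<alpha>"
  shows "(\<integral>\<^sup>+t. (\<integral>\<^sup>+r. ennreal \<bar>indicator {0<..<T} t * (indicator {0<..} r * ((h t - h (t - r)) * r powr (- 1 - \<alpha>)))\<bar> \<partial>lborel) \<partial>lborel) < \<infinity>"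
proof -
  let ?J = "\<lambda>t. (\<integral>\<^sup>+u\<in>{0<..<T}. ennreal (\<bar>h t - h u\<bar> / \<bar>t - u\<bar> powr (1 + \<alpha>)) \<partial>lborel)"
  have "(\<integral>\<^sup>+t. (\<integral>\<^sup>+r. ennreal \<bar>indicator {0<..<T} t * (indicator {0<..} r * ((h t - h (t - r)) * r powr (- 1 - \<alpha>)))\<bar> \<partial>lborel) \<partial>lborel)
    \<le> (\<integral>\<^sup>+t. ?J t * indicator {0<..<T} t + ennreal (1 / \<alpha>) * (ennreal (\<bar>h t\<bar> / t powr \<alpha>) * indicator {0<..<T} t) \<partial>lborel)"
  proof (rule nn_integral_mono)
    fix t :: real
    show "(\<integral>\<^sup>+r. ennreal \<bar>indicator {0<..<T} t * (indicator {0<..} r * ((h t - h (t - r)) * r powr (- 1 - \<alpha>)))\<bar> \<partial>lborel)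
      \<le> ?J t * indicator {0<..<T} t + ennreal (1 / \<alpha>) * (ennreal (\<bar>h t\<bar> / t powr \<alpha>) * indicator {0<..<T} t)"
    proof (cases "t \<in> {0<..<T}")
      case True
      let ?a = "\<lambda>r. indicator {0<..<t} r * (\<bar>h t - h (t - r)\<bar> * r powr (- 1 - \<alpha>))"
      have "(\<integral>\<^sup>+r. ennreal \<bar>indicator {0<..<T} t * (indicator {0<..} r * ((h t - h (t - r)) * r powr (- 1 - \<alpha>)))\<bar> \<partial>lborel)
        = (\<integral>\<^sup>+r. ennreal (?a r) + ennreal \<bar>h t\<bar> * ennreal (indicator {t..} r * r powr (- 1 - \<alpha>)) \<partial>lborel)"
        using True hz by (intro nn_integral_cong) (auto simp: indicator_def abs_mult ennreal_mult'[symmetric])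
      also have "\<dots> = (\<integral>\<^sup>+r. ennreal (?a r) \<partial>lborel) + ennreal \<bar>h t\<bar> * (\<integral>\<^sup>+r. ennreal (indicator {t..} r * r powr (- 1 - \<alpha>)) \<partial>lborel)"
        by (subst nn_integral_add) (auto simp: nn_integral_cmult)
      also have "(\<integral>\<^sup>+r. ennreal (indicator {t..} r * r powr (- 1 - \<alpha>)) \<partial>lborel) = ennreal (t powr (- \<alpha>) / \<alpha>)"
        using nn_integral_powr_to_inf[of "- 1 - \<alpha>" t] \<alpha> True by (simp add: minus_divide_left[symmetric])
      also have "ennreal \<bar>h t\<bar> * ennreal (t powr (- \<alpha>) / \<alpha>) = ennreal (1 / \<alpha>) * ennreal (\<bar>h t\<bar> / t powr \<alpha>)"
        using \<alpha> by (simp add: ennreal_mult'[symmetric] powr_minus_divide)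
      finally have eq: "(\<integral>\<^sup>+r. ennreal \<bar>indicator {0<..<T} t * (indicator {0<..} r * ((h t - h (t - r)) * r powr (- 1 - \<alpha>)))\<bar> \<partial>lborel)
        = (\<integral>\<^sup>+r. ennreal (?a r) \<partial>lborel) + ennreal (1 / \<alpha>) * ennreal (\<bar>h t\<bar> / t powr \<alpha>)" .
      have "(\<integral>\<^sup>+r. ennreal (?a r) \<partial>lborel) = (\<integral>\<^sup>+r. ennreal (?a (t + (- 1) * r)) \<partial>lborel)"
        by (subst nn_integral_real_affine[where c = "-1" and t = t]) simp_all
      also have "\<dots> \<le> ?J t"
      proof (rule nn_integral_mono)
        fix r :: real
        have "(t - r) powr (- 1 - \<alpha>) = 1 / (t - r) powr (1 + \<alpha>)"
          by (simp add: powr_minus_divide[symmetric])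
        then show "ennreal (?a (t + (- 1) * r)) \<le> ennreal (\<bar>h t - h r\<bar> / \<bar>t - r\<bar> powr (1 + \<alpha>)) * indicator {0<..<T} r"
          using True by (auto simp: indicator_def)
      qed
      finally have "(\<integral>\<^sup>+r. ennreal (?a r) \<partial>lborel) \<le> ?J t" .
      then show ?thesis unfolding eq using True by (intro add_mono) simp_all
    qed simp
  qed
  also have "\<dots> = (\<integral>\<^sup>+t. ?J t * indicator {0<..<T} t \<partial>lborel) + ennreal (1 / \<alpha>) * (\<integral>\<^sup>+t\<in>{0<..<T}. ennreal (\<bar>h t\<bar> / t powr \<alpha>) \<partial>lborel)"
    by (subst nn_integral_add) (auto simp: nn_integral_cmult)
  also have "\<dots> < \<infinity>" using W unfolding W_0_iff_lborel[OF assms(1)] by (auto simp: ennreal_mult_less_top)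
  finally show ?thesis .
qed

end

text \<open>Extension by constants to the whole line. It preserves the Hoelder constant, because
  clamping is a contraction, and after subtracting the value at \<open>T\<close> it vanishes from
  \<open>T\<close> on, as the operators on the line require.\<close>

definition clamped :: "real \<Rightarrow> (real \<Rightarrow> real) \<Rightarrow> real \<Rightarrow> real" where
  "clamped T Y u = Y (max 0 (min T u))"

lemma clamped_eq [simp]: "0 \<le> u \<Longrightarrow> u \<le> T \<Longrightarrow> clamped T Y u = Y u"
  by (simp add: clamped_def)

lemma clamped_ge: "0 < T \<Longrightarrow> T \<le> u \<Longrightarrow> clamped T Y u = Y T"
  by (simp add: clamped_def)

lemma holder_on_clamped:
  assumes "0 < T" "0 < \<gamma>" "holder_on \<gamma> {0..T} Y"
  obtains C where "0 \<le> C" "\<And>x y. \<bar>clamped T Y x - clamped T Y y\<bar> \<le> C * \<bar>x - y\<bar> powr \<gamma>"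
proof -
  obtain C where C: "\<And>t u. t \<in> {0..T} \<Longrightarrow> u \<in> {0..T} \<Longrightarrow> \<bar>Y t - Y u\<bar> \<le> C * \<bar>t - u\<bar> powr \<gamma>"
    using assms unfolding holder_on_def by blast
  have C0: "0 \<le> C"
  proof -
    have "0 \<le> C * \<bar>0 - T\<bar> powr \<gamma>" using C[of 0 T] assms by (auto intro: order_trans[OF abs_ge_zero])
    then show ?thesis using assms by (simp add: zero_le_mult_iff)
  qed
  show thesis
  proof
    fix x y
    have "\<bar>clamped T Y x - clamped T Y y\<bar> \<le> C * \<bar>max 0 (min T x) - max 0 (min T y)\<bar> powr \<gamma>"
      unfolding clamped_def using assms by (intro C) auto
    also have "\<dots> \<le> C * \<bar>x - y\<bar> powr \<gamma>"
      using assms C0 by (intro mult_left_mono powr_mono2) auto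
    finally show "\<bar>clamped T Y x - clamped T Y y\<bar> \<le> C * \<bar>x - y\<bar> powr \<gamma>" .
  qed (rule C0)
qed

lemma left_limit_clamped:
  assumes "0 < T" "isCont (clamped T Y) T"
  shows "(Y \<longlongrightarrow> Y T) (at_left T)" "left_limit Y T = Y T"
proof -
  have "(clamped T Y \<longlongrightarrow> clamped T Y T) (at_left T)"
    using assms(2) unfolding isCont_def by (rule tendsto_mono[rotated]) (simp add: at_le)
  moreover have "\<forall>\<^sub>F u in at_left T. clamped T Y u = Y u"
    using eventually_at_left_real[OF \<open>0 < T\<close>] by eventually_elim (simp add: clamped_def)
  ultimately show *: "(Y \<longlongrightarrow> Y T) (at_left T)"
    using assms(1) by (simp add: tendsto_cong)
  then show "left_limit Y T = Y T" by (rule tendsto_Lim[OF trivial_limit_at_left_real])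
qed

section \<open>Membership of integrator and integrand in the fractional spaces\<close>

lemma holder_in_W_T:
  assumes "0 < T" "0 < \<beta>" "\<beta> < \<gamma>" "holder_on \<gamma> {0..T} Y"
  shows "Y \<in> W_T T \<beta>"
proof -
  have \<gamma>: "0 < \<gamma>" using assms by simp
  obtain C where C: "0 \<le> C" "\<And>x y. \<bar>clamped T Y x - clamped T Y y\<bar> \<le> C * \<bar>x - y\<bar> powr \<gamma>"
    using holder_on_clamped[OF \<open>0 < T\<close> \<gamma> assms(4)] by blast
  have cont: "isCont (clamped T Y) x" for x by (rule holder_imp_isCont[OF \<gamma> C(2)])
  note ll = left_limit_clamped[OF \<open>0 < T\<close> cont]
  have [measurable]: "clamped T Y \<in> borel_measurable borel"
    using cont by (auto intro!: borel_measurable_continuous_onI continuous_at_imp_continuous_on)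
  have C': "\<bar>Y x - Y y\<bar> \<le> C * \<bar>x - y\<bar> powr \<gamma>" if "x \<in> {0..T}" "y \<in> {0..T}" for x y
    using C(2)[of x y] that by simp
  have "clamped T Y \<in> borel_measurable (lebesgue_on {0<..<T})"
    by (intro measurable_restrict_space1 measurable_completion) simp
  then have m: "Y \<in> borel_measurable (lebesgue_on {0<..<T})"
    by (rule measurable_cong[THEN iffD1, rotated]) (auto simp: space_restrict_space)
  have b1: "(SUP t\<in>{0<..<T}. ennreal (\<bar>left_limit Y T - Y t\<bar> / (T - t) powr \<beta>)) \<le> ennreal (C * T powr (\<gamma> - \<beta>))"
  proof (rule SUP_least, rule ennreal_leI)
    fix t assume t: "t \<in> {0<..<T}"
    have "\<bar>left_limit Y T - Y t\<bar> / (T - t) powr \<beta> \<le> C * (T - t) powr \<gamma> / (T - t) powr \<beta>"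
      unfolding ll(2) using C'[of T t] t by (intro divide_right_mono) auto
    also have "\<dots> = C * (T - t) powr (\<gamma> - \<beta>)" by (simp add: powr_diff)
    also have "\<dots> \<le> C * T powr (\<gamma> - \<beta>)" using t C assms by (intro mult_left_mono powr_mono2) auto
    finally show "\<bar>left_limit Y T - Y t\<bar> / (T - t) powr \<beta> \<le> C * T powr (\<gamma> - \<beta>)" .
  qed
  have b2: "(SUP t\<in>{0<..<T}. (\<integral>\<^sup>+u\<in>{t<..<T}. ennreal (\<bar>Y t - Y u\<bar> / \<bar>t - u\<bar> powr (1 + \<beta>)) \<partial>lebesgue))
      \<le> ennreal C * ennreal (T powr (\<gamma> - 1 - \<beta> + 1) / (\<gamma> - 1 - \<beta> + 1))"
  proof (rule SUP_least)
    fix t assume t: "t \<in> {0<..<T}"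
    have "(\<integral>\<^sup>+u\<in>{t<..<T}. ennreal (\<bar>Y t - Y u\<bar> / \<bar>t - u\<bar> powr (1 + \<beta>)) \<partial>lebesgue)
       = (\<integral>\<^sup>+u\<in>{t<..<T}. ennreal (\<bar>Y t - Y u\<bar> / \<bar>t - u\<bar> powr (1 + \<beta>)) \<partial>lborel)"
      by (rule nn_integral_completion)
    also have "\<dots> \<le> (\<integral>\<^sup>+u. ennreal C * ennreal (indicator {0..T} (- t + 1 * u) * (- t + 1 * u) powr (\<gamma> - 1 - \<beta>)) \<partial>lborel)"
    proof (rule nn_integral_mono)
      fix u :: real
      have "\<bar>Y t - Y u\<bar> / \<bar>t - u\<bar> powr (1 + \<beta>) \<le> C * (u - t) powr (\<gamma> - 1 - \<beta>)" if u: "t < u" "u < T"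
      proof -
        have "\<bar>Y t - Y u\<bar> / \<bar>t - u\<bar> powr (1 + \<beta>) \<le> C * (u - t) powr \<gamma> / (u - t) powr (1 + \<beta>)"
          using C'[of t u] t u by (auto intro!: divide_right_mono simp: abs_if)
        also have "\<dots> = C * (u - t) powr (\<gamma> - (1 + \<beta>))" by (simp only: powr_diff times_divide_eq_right)
        finally show ?thesis by (simp add: algebra_simps)
      qed
      then show "ennreal (\<bar>Y t - Y u\<bar> / \<bar>t - u\<bar> powr (1 + \<beta>)) * indicator {t<..<T} u
          \<le> ennreal C * ennreal (indicator {0..T} (- t + 1 * u) * (- t + 1 * u) powr (\<gamma> - 1 - \<beta>))"
        using C t by (auto simp: indicator_def ennreal_mult'[symmetric] intro!: ennreal_leI)
    qed
    also have "\<dots> = ennreal C * (\<integral>\<^sup>+u. ennreal (indicator {0..T} (- t + 1 * u) * (- t + 1 * u) powr (\<gamma> - 1 - \<beta>)) \<partial>lborel)"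
      by (rule nn_integral_cmult) measurable
    also have "(\<integral>\<^sup>+u. ennreal (indicator {0..T} (- t + 1 * u) * (- t + 1 * u) powr (\<gamma> - 1 - \<beta>)) \<partial>lborel)
        = (\<integral>\<^sup>+u. ennreal (indicator {0..T} u * u powr (\<gamma> - 1 - \<beta>)) \<partial>lborel)"
      by (subst nn_integral_real_affine[where c = 1 and t = "- t"]) simp_all
    also have "\<dots> = ennreal (T powr (\<gamma> - 1 - \<beta> + 1) / (\<gamma> - 1 - \<beta> + 1))"
      by (rule nn_integral_powr_from_0) (use assms in auto)
    finally show "(\<integral>\<^sup>+u\<in>{t<..<T}. ennreal (\<bar>Y t - Y u\<bar> / \<bar>t - u\<bar> powr (1 + \<beta>)) \<partial>lebesgue)
      \<le> ennreal C * ennreal (T powr (\<gamma> - 1 - \<beta> + 1) / (\<gamma> - 1 - \<beta> + 1))" .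
  qed
  have "(SUP t\<in>{0<..<T}. ennreal (\<bar>left_limit Y T - Y t\<bar> / (T - t) powr \<beta>)) < \<infinity>"
    using b1 by (rule order.strict_trans1) simp
  moreover have "(SUP t\<in>{0<..<T}. (\<integral>\<^sup>+u\<in>{t<..<T}. ennreal (\<bar>Y t - Y u\<bar> / \<bar>t - u\<bar> powr (1 + \<beta>)) \<partial>lebesgue)) < \<infinity>"
    using b2 by (rule order.strict_trans1) (simp add: ennreal_mult_less_top)
  ultimately show ?thesis using m ll(1) unfolding W_T_def by auto
qed

lemma nn_integral_abs_powr_le:
  fixes u :: real
  assumes "-1 < p" "0 < T" "u \<in> {0..T}"
  shows "(\<integral>\<^sup>+v. ennreal (indicator {0<..<T} v * \<bar>u - v\<bar> powr p) \<partial>lborel) \<le> 2 * ennreal (T powr (p + 1) / (p + 1))"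
proof -
  let ?k = "\<lambda>q. ennreal (indicator {0..T} q * q powr p)"
  have "(\<integral>\<^sup>+v. ennreal (indicator {0<..<T} v * \<bar>u - v\<bar> powr p) \<partial>lborel)
    \<le> (\<integral>\<^sup>+v. ?k (- u + 1 * v) + ?k (u + (-1) * v) \<partial>lborel)"
    by (intro nn_integral_mono) (use assms in \<open>auto simp: indicator_def abs_if\<close>)
  also have "\<dots> = (\<integral>\<^sup>+v. ?k (- u + 1 * v) \<partial>lborel) + (\<integral>\<^sup>+v. ?k (u + (-1) * v) \<partial>lborel)"
    by (rule nn_integral_add) measurable
  also have "(\<integral>\<^sup>+v. ?k (- u + 1 * v) \<partial>lborel) = (\<integral>\<^sup>+v. ?k v \<partial>lborel)"
    by (subst (2) nn_integral_real_affine[where c = 1 and t = "- u"]) simp_all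
  also have "(\<integral>\<^sup>+v. ?k (u + (-1) * v) \<partial>lborel) = (\<integral>\<^sup>+v. ?k v \<partial>lborel)"
    by (subst (2) nn_integral_real_affine[where c = "-1" and t = u]) simp_all
  also have "(\<integral>\<^sup>+v. ?k v \<partial>lborel) = ennreal (T powr (p + 1) / (p + 1))"
    by (rule nn_integral_powr_from_0) (use assms in auto)
  finally show ?thesis by (simp add: mult_2)
qed

lemma nn_integral_abs_powr_tail_le:
  fixes u :: real
  assumes "p < -1" "0 < a"
  shows "(\<integral>\<^sup>+v. ennreal (indicator {a..} \<bar>u - v\<bar> * \<bar>u - v\<bar> powr p) \<partial>lborel) \<le> 2 * ennreal (- (a powr (p + 1)) / (p + 1))"
proof -
  let ?k = "\<lambda>q. ennreal (indicator {a..} q * q powr p)"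
  have "(\<integral>\<^sup>+v. ennreal (indicator {a..} \<bar>u - v\<bar> * \<bar>u - v\<bar> powr p) \<partial>lborel)
    \<le> (\<integral>\<^sup>+v. ?k (- u + 1 * v) + ?k (u + (-1) * v) \<partial>lborel)"
    by (intro nn_integral_mono) (use assms in \<open>auto simp: indicator_def abs_if\<close>)
  also have "\<dots> = (\<integral>\<^sup>+v. ?k (- u + 1 * v) \<partial>lborel) + (\<integral>\<^sup>+v. ?k (u + (-1) * v) \<partial>lborel)"
    by (rule nn_integral_add) measurable
  also have "(\<integral>\<^sup>+v. ?k (- u + 1 * v) \<partial>lborel) = (\<integral>\<^sup>+v. ?k v \<partial>lborel)"
    by (subst (2) nn_integral_real_affine[where c = 1 and t = "- u"]) simp_all
  also have "(\<integral>\<^sup>+v. ?k (u + (-1) * v) \<partial>lborel) = (\<integral>\<^sup>+v. ?k v \<partial>lborel)"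
    by (subst (2) nn_integral_real_affine[where c = "-1" and t = u]) simp_all
  also have "(\<integral>\<^sup>+v. ?k v \<partial>lborel) = ennreal (- (a powr (p + 1)) / (p + 1))"
    by (rule nn_integral_powr_to_inf) (use assms in auto)
  finally show ?thesis by (simp add: mult_2)
qed

text \<open>Two times on the same side of \<tau> are handled by \<open>est\<close>, with the power
  \<eta> - 1 - \<theta> integrable since \<theta> < \<eta>. On different sides the increment is only
  bounded, but the times are at least the distance from \<open>t\<close> to \<tau> apart; the tail
  integral is then of order - \<theta> in this distance, integrable since \<theta> < 1.\<close>

lemma indicator_times_in_W_0:
  fixes \<phi> V :: "real \<Rightarrow> real"
  assumes T: "0 < T" and \<theta>: "0 < \<theta>" "\<theta> < 1" "\<theta> < \<eta>" and \<tau>: "\<tau> \<in> {0..T}"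
    and [measurable]: "\<phi> \<in> borel_measurable borel" "V \<in> borel_measurable borel"
    and M: "\<And>u. \<bar>\<phi> u\<bar> \<le> M" and V0: "\<And>u. 0 \<le> V u"
    and V: "(\<integral>\<^sup>+u\<in>{0<..<T}. ennreal (V u) \<partial>lborel) < \<infinity>"
    and est: "AE u in lborel. u \<in> {0<..<T} \<longrightarrow> (\<forall>v. \<bar>\<phi> u - \<phi> v\<bar> \<le> \<bar>u - v\<bar> powr \<eta> * V u)"
  shows "(\<lambda>u. indicator {0<..<T} u * (indicator {0..\<tau>} u * \<phi> u)) \<in> W_0 T \<theta>"
proof -
  define h where "h = (\<lambda>u. indicator {0<..<T} u * (indicator {0..\<tau>} u * \<phi> u))"
  have [measurable]: "h \<in> borel_measurable borel" unfolding h_def by measurable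
  have M0: "0 \<le> M" using M[of 0] by simp
  have hM: "\<bar>h u\<bar> \<le> M" for u using M[of u] M0 by (auto simp: h_def indicator_def)
  have "(\<integral>\<^sup>+t\<in>{0<..<T}. ennreal (\<bar>h t\<bar> / t powr \<theta>) \<partial>lborel)
     \<le> (\<integral>\<^sup>+t. ennreal M * ennreal (indicator {0..T} t * t powr (- \<theta>)) \<partial>lborel)"
  proof (rule nn_integral_mono)
    fix t :: real
    show "ennreal (\<bar>h t\<bar> / t powr \<theta>) * indicator {0<..<T} t \<le> ennreal M * ennreal (indicator {0..T} t * t powr (- \<theta>))"
      using hM[of t] M0 by (auto simp: indicator_def ennreal_mult'[symmetric] powr_minus_divide
          intro!: ennreal_leI divide_right_mono)
  qed
  also have "\<dots> = ennreal M * ennreal (T powr (- \<theta> + 1) / (- \<theta> + 1))"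
    using nn_integral_powr_from_0[of "- \<theta>" T] \<theta> T by (subst nn_integral_cmult) auto
  also have "\<dots> < \<infinity>" by (simp add: ennreal_mult_less_top)
  finally have fin1: "(\<integral>\<^sup>+t\<in>{0<..<T}. ennreal (\<bar>h t\<bar> / t powr \<theta>) \<partial>lborel) < \<infinity>" .
  define c1 where "c1 = 2 * ennreal (T powr (\<eta> - 1 - \<theta> + 1) / (\<eta> - 1 - \<theta> + 1))"
  define c2 where "c2 = ennreal (2 * M / \<theta>)"
  have "(\<integral>\<^sup>+t\<in>{0<..<T}. (\<integral>\<^sup>+u\<in>{0<..<T}. ennreal (\<bar>h t - h u\<bar> / \<bar>t - u\<bar> powr (1 + \<theta>)) \<partial>lborel) \<partial>lborel)
    \<le> (\<integral>\<^sup>+t. c1 * (ennreal (V t) * indicator {0<..<T} t) + c2 * ennreal (indicator {0<..<T} t * \<bar>\<tau> - t\<bar> powr (- \<theta>)) \<partial>lborel)"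
  proof (rule nn_integral_mono_AE)
    show "AE t in lborel. (\<integral>\<^sup>+u\<in>{0<..<T}. ennreal (\<bar>h t - h u\<bar> / \<bar>t - u\<bar> powr (1 + \<theta>)) \<partial>lborel) * indicator {0<..<T} t
      \<le> c1 * (ennreal (V t) * indicator {0<..<T} t) + c2 * ennreal (indicator {0<..<T} t * \<bar>\<tau> - t\<bar> powr (- \<theta>))"
      \<comment> \<open>\<open>t = \<tau>\<close> is excluded because the tail estimate needs a
        positive cut-off.\<close>
      using est AE_lborel_singleton[of \<tau>]
    proof eventually_elim
      case (elim t)
      show ?case
      proof (cases "t \<in> {0<..<T}")
        case t: True
        let ?a = "\<lambda>u. ennreal (indicator {0<..<T} u * \<bar>t - u\<bar> powr (\<eta> - 1 - \<theta>))"
        let ?b = "\<lambda>u. ennreal (indicator {\<bar>\<tau> - t\<bar>..} \<bar>t - u\<bar> * \<bar>t - u\<bar> powr (- 1 - \<theta>))"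
        have "(\<integral>\<^sup>+u\<in>{0<..<T}. ennreal (\<bar>h t - h u\<bar> / \<bar>t - u\<bar> powr (1 + \<theta>)) \<partial>lborel)
          \<le> (\<integral>\<^sup>+u. ennreal (V t) * ?a u + ennreal M * ?b u \<partial>lborel)"
        proof (rule nn_integral_mono)
          fix u :: real
          have eq: "x / \<bar>t - u\<bar> powr (1 + \<theta>) = x * \<bar>t - u\<bar> powr (- 1 - \<theta>)" for x
          proof -
            have "- 1 - \<theta> = - (1 + \<theta>)" by simp
            then show ?thesis by (simp only: powr_minus_divide) simp
          qed
          show "ennreal (\<bar>h t - h u\<bar> / \<bar>t - u\<bar> powr (1 + \<theta>)) * indicator {0<..<T} u \<le> ennreal (V t) * ?a u + ennreal M * ?b u"
          proof (cases "u \<in> {0<..<T}")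
            case u: True
            consider "t \<le> \<tau> \<and> u \<le> \<tau>" | "\<tau> < t \<and> \<tau> < u" | "t \<le> \<tau> \<and> \<tau> < u \<or> \<tau> < t \<and> u \<le> \<tau>" by linarith
            then show ?thesis
            proof cases
              case 1
              then have "\<bar>h t - h u\<bar> = \<bar>\<phi> t - \<phi> u\<bar>" using t u by (simp add: h_def)
              also have "\<dots> \<le> \<bar>t - u\<bar> powr \<eta> * V t" using elim t by blast
              finally have "\<bar>h t - h u\<bar> * \<bar>t - u\<bar> powr (- 1 - \<theta>) \<le> \<bar>t - u\<bar> powr \<eta> * V t * \<bar>t - u\<bar> powr (- 1 - \<theta>)"
                by (intro mult_right_mono) auto
              also have "\<dots> = V t * (\<bar>t - u\<bar> powr \<eta> * \<bar>t - u\<bar> powr (- 1 - \<theta>))" by simp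
              also have "\<bar>t - u\<bar> powr \<eta> * \<bar>t - u\<bar> powr (- 1 - \<theta>) = \<bar>t - u\<bar> powr (\<eta> - 1 - \<theta>)"
                by (simp add: powr_add[symmetric] algebra_simps)
              finally have "ennreal (\<bar>h t - h u\<bar> / \<bar>t - u\<bar> powr (1 + \<theta>)) * indicator {0<..<T} u \<le> ennreal (V t) * ?a u"
                unfolding eq using u V0 by (simp add: ennreal_mult'[symmetric] ennreal_leI)
              then show ?thesis by (rule order_trans) simp
            next
              case 2
              then show ?thesis by (simp add: h_def)
            next
              case 3
              then have "\<bar>h t - h u\<bar> \<le> M" using t u M M0 by (auto simp: h_def)
              then have "\<bar>h t - h u\<bar> * \<bar>t - u\<bar> powr (- 1 - \<theta>) \<le> M * \<bar>t - u\<bar> powr (- 1 - \<theta>)"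
                by (intro mult_right_mono) auto
              moreover have "\<bar>\<tau> - t\<bar> \<le> \<bar>t - u\<bar>" using 3 by auto
              ultimately have "ennreal (\<bar>h t - h u\<bar> / \<bar>t - u\<bar> powr (1 + \<theta>)) * indicator {0<..<T} u \<le> ennreal M * ?b u"
                unfolding eq using u M0 by (simp add: ennreal_mult'[symmetric] ennreal_leI)
              then show ?thesis by (rule order_trans) simp
            qed
          qed simp
        qed
        also have "\<dots> = ennreal (V t) * (\<integral>\<^sup>+u. ?a u \<partial>lborel) + ennreal M * (\<integral>\<^sup>+u. ?b u \<partial>lborel)"
          by (subst nn_integral_add) (auto simp: nn_integral_cmult)
        also have "\<dots> \<le> ennreal (V t) * c1 + ennreal M * (2 * ennreal (- (\<bar>\<tau> - t\<bar> powr (- 1 - \<theta> + 1)) / (- 1 - \<theta> + 1)))"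
          unfolding c1_def
          by (intro add_mono mult_left_mono nn_integral_abs_powr_le nn_integral_abs_powr_tail_le) (use t \<theta> T elim in auto)
        also have "ennreal M * (2 * ennreal (- (\<bar>\<tau> - t\<bar> powr (- 1 - \<theta> + 1)) / (- 1 - \<theta> + 1))) = c2 * ennreal (\<bar>\<tau> - t\<bar> powr (- \<theta>))"
        proof -
          have "ennreal M * (2 * ennreal y) = ennreal (M * (2 * y))" if "0 \<le> y" for y
            using that M0 by (simp add: ennreal_mult)
          then show ?thesis unfolding c2_def using M0 \<theta>
            by (simp add: ennreal_mult'[symmetric] minus_divide_left[symmetric])
        qed
        finally show ?thesis using t by (simp add: mult.commute)
      qed simp
    qed
  qed
  also have "\<dots> = c1 * (\<integral>\<^sup>+t\<in>{0<..<T}. ennreal (V t) \<partial>lborel) + c2 * (\<integral>\<^sup>+t. ennreal (indicator {0<..<T} t * \<bar>\<tau> - t\<bar> powr (- \<theta>)) \<partial>lborel)"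
    by (subst nn_integral_add) (auto simp: nn_integral_cmult)
  also have "\<dots> < \<infinity>"
  proof -
    have "(\<integral>\<^sup>+t. ennreal (indicator {0<..<T} t * \<bar>\<tau> - t\<bar> powr (- \<theta>)) \<partial>lborel) \<le> 2 * ennreal (T powr (- \<theta> + 1) / (- \<theta> + 1))"
      by (rule nn_integral_abs_powr_le) (use \<theta> T \<tau> in auto)
    also have "\<dots> < \<infinity>" by (simp add: ennreal_mult_less_top)
    finally show ?thesis using V by (simp add: c1_def c2_def ennreal_mult_less_top)
  qed
  finally have fin2: "(\<integral>\<^sup>+t\<in>{0<..<T}. (\<integral>\<^sup>+u\<in>{0<..<T}. ennreal (\<bar>h t - h u\<bar> / \<bar>t - u\<bar> powr (1 + \<theta>)) \<partial>lborel) \<partial>lborel) < \<infinity>" .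
  have "h \<in> W_0 T \<theta>" using fin1 fin2 by (subst W_0_iff_lborel) auto
  then show ?thesis unfolding h_def .
qed

section \<open>Invariance of the integral under changes of the integrand on null sets\<close>

lemma frac_deriv_left_measurable:
  assumes [measurable]: "h \<in> borel_measurable borel"
  shows "frac_deriv_left \<alpha> h \<in> borel_measurable borel"
proof -
  have "(\<lambda>t. 1 / Gamma (1 - \<alpha>) * (h t / t powr \<alpha> + \<alpha> *
      (LBINT r. (if 0 < r \<and> r < t then (h t - h r) / (t - r) powr (\<alpha> + 1) else 0)))) \<in> borel_measurable borel"
    by measurable
  moreover have "(LBINT r. (if 0 < r \<and> r < t then (h t - h r) / (t - r) powr (\<alpha> + 1) else 0))
      = (LBINT r. indicator {0<..<t} r * ((h t - h r) / (t - r) powr (\<alpha> + 1)))" for t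
    by (intro Bochner_Integration.integral_cong refl) (simp add: indicator_def)
  ultimately show ?thesis unfolding frac_deriv_left_lborel[OF assms, abs_def] by simp
qed

lemma frac_deriv_right_measurable:
  assumes [measurable]: "k \<in> borel_measurable borel"
  shows "frac_deriv_right T \<alpha> k \<in> borel_measurable borel"
proof -
  have "(\<lambda>t. 1 / Gamma (1 - \<alpha>) * (k t / (T - t) powr \<alpha> + \<alpha> *
      (LBINT r. (if t < r \<and> r < T then (k t - k r) / (r - t) powr (\<alpha> + 1) else 0)))) \<in> borel_measurable borel"
    by measurable
  moreover have "(LBINT r. (if t < r \<and> r < T then (k t - k r) / (r - t) powr (\<alpha> + 1) else 0))
      = (LBINT r. indicator {t<..<T} r * ((k t - k r) / (r - t) powr (\<alpha> + 1)))" for t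
    by (intro Bochner_Integration.integral_cong refl) (simp add: indicator_def)
  ultimately show ?thesis unfolding frac_deriv_right_lborel[OF assms, abs_def] by simp
qed

text \<open>Three integrands occur: \<open>h''\<close> is the given one and may be arbitrary off (0,
  T), \<open>h'\<close> is a Borel function equal to it on (0, T), and \<open>h\<close> agrees with
  \<open>h'\<close> almost everywhere there and is the one that gets estimated. Similarly
  \<open>Y'\<close> is a Borel extension of the integrator.\<close>

lemma has_frac_integral_cong:
  assumes [measurable]: "h \<in> borel_measurable borel" "h' \<in> borel_measurable borel"
    and T: "0 < T" and pw: "\<And>t. t \<in> {0<..<T} \<Longrightarrow> h'' t = h' t"
    and ae: "AE t in lborel. t \<in> {0<..<T} \<longrightarrow> h' t = h t"
    and I: "has_frac_integral T h Y I"
    and Y [measurable]: "(\<lambda>u. Y' u - left_limit Y T) \<in> borel_measurable borel" "\<And>t. t \<in> {0<..<T} \<Longrightarrow> Y t = Y' t"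
  shows "has_frac_integral T h'' Y I"
proof -
  let ?l = "left_limit Y T" and ?S = "{0<..<T}"
  obtain \<theta> where \<theta>: "0 < \<theta>" "\<theta> < 1" "h \<in> W_0 T \<theta>" "Y \<in> W_T T (1 - \<theta>)"
    and Ieq: "I = - (LINT t:?S|lebesgue. frac_deriv_left \<theta> h t * frac_deriv_right T (1 - \<theta>) (\<lambda>u. Y u - ?l) t)"
    using I unfolding has_frac_integral_def by blast
  have m: "h'' \<in> borel_measurable (lebesgue_on ?S)"
  proof -
    have "h' \<in> borel_measurable (lebesgue_on ?S)" by (intro measurable_restrict_space1 measurable_completion) simp
    then show ?thesis by (rule measurable_cong[THEN iffD1, rotated]) (auto simp: space_restrict_space pw)
  qed
  have "(\<integral>\<^sup>+t\<in>?S. ennreal (\<bar>h'' t\<bar> / t powr \<theta>) \<partial>lebesgue) = (\<integral>\<^sup>+t\<in>?S. ennreal (\<bar>h t\<bar> / t powr \<theta>) \<partial>lebesgue)"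
    by (rule nn_integral_cong_AE) (use AE_completion[OF ae] in \<open>eventually_elim, auto simp: pw indicator_def\<close>)
  moreover have "(\<integral>\<^sup>+t\<in>?S. (\<integral>\<^sup>+u\<in>?S. ennreal (\<bar>h'' t - h'' u\<bar> / \<bar>t - u\<bar> powr (1 + \<theta>)) \<partial>lebesgue) \<partial>lebesgue)
      = (\<integral>\<^sup>+t\<in>?S. (\<integral>\<^sup>+u\<in>?S. ennreal (\<bar>h t - h u\<bar> / \<bar>t - u\<bar> powr (1 + \<theta>)) \<partial>lebesgue) \<partial>lebesgue)"
  proof (rule nn_integral_cong_AE)
    show "AE t in lebesgue. (\<integral>\<^sup>+u\<in>?S. ennreal (\<bar>h'' t - h'' u\<bar> / \<bar>t - u\<bar> powr (1 + \<theta>)) \<partial>lebesgue) * indicator ?S t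
      = (\<integral>\<^sup>+u\<in>?S. ennreal (\<bar>h t - h u\<bar> / \<bar>t - u\<bar> powr (1 + \<theta>)) \<partial>lebesgue) * indicator ?S t"
      using AE_completion[OF ae]
    proof eventually_elim
      case (elim t)
      have "(\<integral>\<^sup>+u\<in>?S. ennreal (\<bar>h'' t - h'' u\<bar> / \<bar>t - u\<bar> powr (1 + \<theta>)) \<partial>lebesgue)
          = (\<integral>\<^sup>+u\<in>?S. ennreal (\<bar>h t - h u\<bar> / \<bar>t - u\<bar> powr (1 + \<theta>)) \<partial>lebesgue)" if t: "t \<in> ?S"
      proof (rule nn_integral_cong_AE)
        show "AE u in lebesgue. ennreal (\<bar>h'' t - h'' u\<bar> / \<bar>t - u\<bar> powr (1 + \<theta>)) * indicator ?S u
            = ennreal (\<bar>h t - h u\<bar> / \<bar>t - u\<bar> powr (1 + \<theta>)) * indicator ?S u"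
          using AE_completion[OF ae] by eventually_elim (use elim t in \<open>auto simp: pw indicator_def\<close>)
      qed
      then show ?case by (cases "t \<in> ?S") simp_all
    qed
  qed
  ultimately have W: "h'' \<in> W_0 T \<theta>" using \<theta>(3) m unfolding W_0_def by simp
  let ?k = "\<lambda>u. Y' u - ?l"
  have km: "?k \<in> borel_measurable borel" by fact
  have FR: "frac_deriv_right T (1 - \<theta>) (\<lambda>u. Y u - ?l) t = frac_deriv_right T (1 - \<theta>) ?k t" if "t \<in> ?S" for t
  proof -
    have "(LINT r:{t<..<T}|lebesgue. (Y t - ?l - (Y r - ?l)) / (r - t) powr (1 - \<theta> + 1))
        = (LINT r:{t<..<T}|lebesgue. (?k t - ?k r) / (r - t) powr (1 - \<theta> + 1))"
      using that by (intro set_lebesgue_integral_cong) (auto simp: Y(2))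
    then show ?thesis unfolding frac_deriv_right_def by (simp add: Y(2)[OF that])
  qed
  have FL: "frac_deriv_left \<theta> h'' t = frac_deriv_left \<theta> h' t" if "t \<in> ?S" for t
  proof -
    have "(LINT r:{0<..<t}|lebesgue. (h'' t - h'' r) / (t - r) powr (\<theta> + 1))
        = (LINT r:{0<..<t}|lebesgue. (h' t - h' r) / (t - r) powr (\<theta> + 1))"
      using that by (intro set_lebesgue_integral_cong) (auto simp: pw)
    then show ?thesis unfolding frac_deriv_left_def by (simp add: pw[OF that])
  qed
  have FLae: "AE t in lborel. t \<in> ?S \<longrightarrow> frac_deriv_left \<theta> h' t = frac_deriv_left \<theta> h t"
    using ae
  proof eventually_elim
    case (elim t)
    show ?case
    proof
      assume t: "t \<in> ?S"
      have "(LBINT r. indicator {0<..<t} r * ((h' t - h' r) / (t - r) powr (\<theta> + 1)))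
          = (LBINT r. indicator {0<..<t} r * ((h t - h r) / (t - r) powr (\<theta> + 1)))"
      proof (rule integral_cong_AE)
        show "AE r in lborel. indicator {0<..<t} r * ((h' t - h' r) / (t - r) powr (\<theta> + 1))
            = indicator {0<..<t} r * ((h t - h r) / (t - r) powr (\<theta> + 1))"
          using ae by eventually_elim (use elim t in \<open>auto simp: indicator_def\<close>)
      qed measurable
      then show "frac_deriv_left \<theta> h' t = frac_deriv_left \<theta> h t"
        using elim t by (simp add: frac_deriv_left_lborel)
    qed
  qed
  have [measurable]: "frac_deriv_left \<theta> h \<in> borel_measurable borel" "frac_deriv_left \<theta> h' \<in> borel_measurable borel"
    by (rule frac_deriv_left_measurable, fact)+
  have [measurable]: "frac_deriv_right T (1 - \<theta>) ?k \<in> borel_measurable borel"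
    by (rule frac_deriv_right_measurable[OF km])
  have "(LINT t:?S|lebesgue. frac_deriv_left \<theta> h'' t * frac_deriv_right T (1 - \<theta>) (\<lambda>u. Y u - ?l) t)
      = (LINT t:?S|lebesgue. frac_deriv_left \<theta> h' t * frac_deriv_right T (1 - \<theta>) ?k t)"
    by (intro set_lebesgue_integral_cong) (auto simp: FL FR)
  also have "\<dots> = (LINT t:?S|lebesgue. frac_deriv_left \<theta> h t * frac_deriv_right T (1 - \<theta>) ?k t)"
    unfolding set_lebesgue_integral_def
  proof (rule integral_cong_AE)
    show "AE t in lebesgue. indicator ?S t *\<^sub>R (frac_deriv_left \<theta> h' t * frac_deriv_right T (1 - \<theta>) ?k t)
        = indicator ?S t *\<^sub>R (frac_deriv_left \<theta> h t * frac_deriv_right T (1 - \<theta>) ?k t)"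
      using AE_completion[OF FLae] by eventually_elim (auto simp: indicator_def)
  qed (intro measurable_completion; simp)+
  also have "\<dots> = (LINT t:?S|lebesgue. frac_deriv_left \<theta> h t * frac_deriv_right T (1 - \<theta>) (\<lambda>u. Y u - ?l) t)"
    by (intro set_lebesgue_integral_cong) (auto simp: FR)
  finally have "I = - (LINT t:?S|lebesgue. frac_deriv_left \<theta> h'' t * frac_deriv_right T (1 - \<theta>) (\<lambda>u. Y u - ?l) t)"
    using Ieq by simp
  then show ?thesis unfolding has_frac_integral_def using \<theta> W by blast
qed

text \<open>
  With antiderivatives \<open>N\<close> of \<open>X\<close> and \<open>K\<close> of \<open>k\<close>, the derivative of \<open>N - \<phi> u K\<close> is constant near \<open>u\<close> up to an error
  of order \<open>\<eta> > 1\<close>, so its second difference is \<open>o(\<epsilon>\<^sup>2)\<close>; that of \<open>N\<close> integrates to \<open>X \<tau> - X 0\<close> in the limit.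
\<close>

lemma limit_of_second_differences:
  fixes X k \<phi> V :: "real \<Rightarrow> real"
  assumes T: "0 < T" and \<eta>: "1 < \<eta>" and \<tau>: "\<tau> \<in> {0..T}"
    and [measurable]: "\<phi> \<in> borel_measurable borel" "V \<in> borel_measurable borel"
    and V0: "\<And>u. 0 \<le> V u" and V: "integrable lborel (\<lambda>u. indicator {0<..<T} u * V u)"
    and M: "\<And>u. \<bar>\<phi> u\<bar> \<le> M"
    and X: "\<And>x. isCont X x"
    and K: "\<And>x. (K has_real_derivative k x) (at x)"
    and est: "AE u in lborel. u \<in> {0<..<T} \<longrightarrow> (\<forall>v. \<bar>X v - X u - \<phi> u * (k v - k u)\<bar> \<le> \<bar>u - v\<bar> powr \<eta> * V u)"
    and e: "\<And>n. 0 < e n" "e \<longlonglongrightarrow> 0"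
  shows "(\<lambda>n. LBINT t. indicator {0<..<T} t * (indicator {0..\<tau>} t * \<phi> t) *
      ((K (t + 2 * e n) - 2 * K (t + e n) + K t) / (e n)\<^sup>2)) \<longlonglongrightarrow> X \<tau> - X 0"
proof -
  obtain N where N: "\<And>x. (N has_real_derivative X x) (at x)"
    using continuous_antiderivative[of X] X by blast
  have Nc: "isCont N x" for x using N DERIV_isCont by blast
  obtain Q where Q: "\<And>x. (Q has_real_derivative N x) (at x)"
    using continuous_antiderivative[of N] Nc by blast
  have Kc: "isCont K x" for x using K DERIV_isCont by blast
  have [measurable]: "K \<in> borel_measurable borel" "N \<in> borel_measurable borel"
    using Kc Nc by (auto intro!: borel_measurable_continuous_onI continuous_at_imp_continuous_on)
  define A where "A = (\<lambda>t. indicator {0<..<T} t * indicator {0..\<tau>} t :: real)"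
  define D where "D = (\<lambda>G n t. (G (t + 2 * e n) - 2 * G (t + e n) + G t) / (e n)\<^sup>2 :: real)"
  have [measurable]: "A \<in> borel_measurable borel" unfolding A_def by measurable
  have Dm [measurable]: "D K n \<in> borel_measurable borel" "D N n \<in> borel_measurable borel" for n
    unfolding D_def by measurable
  \<comment> \<open>The main term is computed exactly: second differences of \<open>N\<close> are
    derivatives of those of \<open>Q\<close>, so their integral up to \<tau> is a difference of
    boundary values. Each boundary value is a value of \<open>X\<close> within distance 2 e n, by
    the mean value theorem.\<close>
  have DN: "(LBINT t. A t * D N n t) = D Q n \<tau> - D Q n 0" for n
  proof -
    have dO: "(D Q n has_real_derivative D N n x) (at x)" for x
      unfolding D_def
      by (intro DERIV_cdivide DERIV_add DERIV_diff DERIV_cmult Q Q[of "x + _", unfolded DERIV_shift])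
    have cN: "isCont (D N n) x" for x
    proof -
      have "isCont (\<lambda>t. N (t + a)) x" for a by (rule isCont_o2[where f = "\<lambda>q. q + a"]) (auto intro: Nc)
      then show ?thesis unfolding D_def using e(1)[of n] by (intro continuous_intros Nc) auto
    qed
    have "D Q n (0 + \<tau>) - D Q n 0 = (LBINT q. indicator {0<..\<tau>} q * D N n (0 + q))"
      by (rule FTC_Ioc[OF dO cN]) (use \<tau> in auto)
    also have "\<dots> = (LBINT t. A t * D N n t)"
    proof (rule integral_cong_AE)
      show "AE q in lborel. indicator {0<..\<tau>} q * D N n (0 + q) = A q * D N n q"
        using AE_lborel_singleton[of T] by eventually_elim (use \<tau> in \<open>auto simp: A_def indicator_def\<close>)
    qed (auto simp: measurable_compose)
    finally show ?thesis by simp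
  qed
  have "(\<lambda>n. D Q n x) \<longlonglongrightarrow> X x" for x
  proof (rule LIMSEQ_I)
    fix r :: real assume "0 < r"
    then obtain d where d: "0 < d" "\<And>y. \<bar>y - x\<bar> < d \<Longrightarrow> \<bar>X y - X x\<bar> < r"
      using X[of x] unfolding continuous_at_eps_delta by (auto simp: dist_real_def)
    have "\<forall>\<^sub>F n in sequentially. e n < d / 2" using e(2) d by (intro order_tendstoD(2)[where y = 0]) auto
    then obtain n0 where n0: "\<And>n. n \<ge> n0 \<Longrightarrow> e n < d / 2" by (auto simp: eventually_sequentially)
    show "\<exists>n0. \<forall>n\<ge>n0. norm (D Q n x - X x) < r"
    proof (intro exI[of _ n0] allI impI)
      fix n assume "n0 \<le> n"
      obtain \<xi> where \<xi>: "x < \<xi>" "\<xi> < x + 2 * e n" "Q (x + 2 * e n) - 2 * Q (x + e n) + Q x = (e n)\<^sup>2 * X \<xi>"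
        by (rule second_difference_mvt[OF Q N e(1)])
      then have "D Q n x = X \<xi>" using e(1)[of n] by (simp add: D_def)
      then show "norm (D Q n x - X x) < r" using d(2)[of \<xi>] \<xi> n0[OF \<open>n0 \<le> n\<close>] by simp
    qed
  qed
  then have lim1: "(\<lambda>n. LBINT t. A t * D N n t) \<longlonglongrightarrow> X \<tau> - X 0"
    unfolding DN by (intro tendsto_diff)
  \<comment> \<open>The second difference is evaluated at two mean value points within 2 e n of
    \<open>u\<close>. Each contributes an error (2 e n)^\<eta> V u, and one factor e n of the
    denominator is left; the resulting power \<eta> - 1 is positive, so the bound tends to
    0.\<close>
  have ptw: "AE u in lborel. \<bar>A u * \<phi> u * D K n u - A u * D N n u\<bar> \<le> (2 powr (\<eta> + 1) * e n powr (\<eta> - 1)) * (indicator {0<..<T} u * V u)" for n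
    using est
  proof eventually_elim
    case (elim u)
    show ?case
    proof (cases "u \<in> {0<..<T}")
      case True
      define E where "E = (\<lambda>x. N x - \<phi> u * K x)"
      have E: "(E has_real_derivative X x - \<phi> u * k x) (at x)" for x
        unfolding E_def by (intro DERIV_diff DERIV_cmult N K)
      define c where "c = X u - \<phi> u * k u"
      define b where "b = (2 * e n) powr \<eta> * V u"
      have bb: "\<bar>X v - \<phi> u * k v - c\<bar> \<le> b" if "u < v" "v < u + 2 * e n" for v
      proof -
        have "\<bar>X v - X u - \<phi> u * (k v - k u)\<bar> \<le> \<bar>u - v\<bar> powr \<eta> * V u" using elim True by blast
        also have "\<dots> \<le> b" unfolding b_def using that V0 \<eta> by (intro mult_right_mono powr_mono2) auto
        finally show ?thesis by (simp add: c_def algebra_simps)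
      qed
      obtain x1 where x1: "u < x1" "x1 < u + e n" "E (u + e n) - E u = e n * (X x1 - \<phi> u * k x1)"
        using MVT2[of u "u + e n" E "\<lambda>x. X x - \<phi> u * k x"] E e(1)[of n] by auto
      obtain x2 where x2: "u + e n < x2" "x2 < u + 2 * e n" "E (u + 2 * e n) - E (u + e n) = e n * (X x2 - \<phi> u * k x2)"
        using MVT2[of "u + e n" "u + 2 * e n" E "\<lambda>x. X x - \<phi> u * k x"] E e(1)[of n] by auto
      have "\<phi> u * D K n u - D N n u = - ((E (u + 2 * e n) - E (u + e n)) - (E (u + e n) - E u)) / (e n)\<^sup>2"
        by (simp add: D_def E_def algebra_simps diff_divide_distrib add_divide_distrib)
      also have "\<dots> = - ((X x2 - \<phi> u * k x2) - (X x1 - \<phi> u * k x1)) / e n"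
        unfolding x1(3) x2(3) using e(1)[of n] by (simp add: power2_eq_square field_simps)
      finally have "\<bar>\<phi> u * D K n u - D N n u\<bar> = \<bar>(X x2 - \<phi> u * k x2 - c) - (X x1 - \<phi> u * k x1 - c)\<bar> / e n"
        using e(1)[of n] by (simp add: abs_divide)
      also have "\<dots> \<le> (b + b) / e n"
      proof (rule divide_right_mono)
        have "\<bar>X x1 - \<phi> u * k x1 - c\<bar> \<le> b" "\<bar>X x2 - \<phi> u * k x2 - c\<bar> \<le> b"
          by (rule bb; use x1 x2 e(1)[of n] in linarith)+
        then show "\<bar>(X x2 - \<phi> u * k x2 - c) - (X x1 - \<phi> u * k x1 - c)\<bar> \<le> b + b" by linarith
      qed (use e(1)[of n] in simp)
      also have "\<dots> = (2 powr (\<eta> + 1) * e n powr (\<eta> - 1)) * V u"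
      proof -
        have "(2 * e n) powr \<eta> / e n = 2 powr \<eta> * e n powr (\<eta> - 1)"
          using e(1)[of n] by (simp add: powr_mult powr_diff)
        moreover have "(b + b) / e n = 2 * ((2 * e n) powr \<eta> / e n) * V u" by (simp add: b_def)
        ultimately show ?thesis by (simp add: powr_add)
      qed
      finally have *: "\<bar>\<phi> u * D K n u - D N n u\<bar> \<le> (2 powr (\<eta> + 1) * e n powr (\<eta> - 1)) * V u" .
      show ?thesis
      proof (cases "u \<le> \<tau>")
        case True
        then have "A u = 1" using \<open>u \<in> {0<..<T}\<close> by (simp add: A_def)
        then show ?thesis using * \<open>u \<in> {0<..<T}\<close> by simp
      next
        case False
        then show ?thesis using V0[of u] by (simp add: A_def)
      qed
    qed (simp add: A_def)
  qed
  have int: "integrable lborel (\<lambda>t. A t * G t)" if "\<And>x. x \<in> {0..T} \<Longrightarrow> \<bar>G x\<bar> \<le> B" and [measurable]: "G \<in> borel_measurable borel" for G B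
  proof (rule Bochner_Integration.integrable_bound)
    show "integrable lborel (\<lambda>t. B * indicator {0..T} t)"
      by (intro integrable_mult_right integrable_real_indicator) (auto simp: emeasure_lborel_Icc_eq)
    have "\<bar>A t * G t\<bar> \<le> \<bar>B * indicator {0..T} t\<bar>" for t
      using that(1)[of t] by (auto simp: A_def indicator_def)
    then show "AE t in lborel. norm (A t * G t) \<le> norm (B * indicator {0..T} t)" by simp
  qed measurable
  have bnd: "\<exists>B. \<forall>x\<in>{0..T}. \<bar>D G n x\<bar> \<le> B" if "\<And>x. isCont G x" for G n
  proof -
    have "isCont (\<lambda>t. G (t + a)) x" for a x by (rule isCont_o2[where f = "\<lambda>q. q + a"]) (auto intro: that)
    then have "isCont (D G n) x" for x unfolding D_def using e(1)[of n] by (intro continuous_intros that) auto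
    then have "compact (D G n ` {0..T})"
      by (intro compact_continuous_image continuous_at_imp_continuous_on) auto
    then show ?thesis unfolding compact_eq_bounded_closed bounded_iff by (metis image_eqI real_norm_def)
  qed
  have iN: "integrable lborel (\<lambda>t. A t * D N n t)" for n using bnd[OF Nc, of n] int[OF _ Dm(2)] by blast
  have iK: "integrable lborel (\<lambda>t. A t * \<phi> t * D K n t)" for n
  proof -
    obtain B where B: "\<And>x. x \<in> {0..T} \<Longrightarrow> \<bar>D K n x\<bar> \<le> B" using bnd[OF Kc, of n] by blast
    have "\<bar>\<phi> x * D K n x\<bar> \<le> M * B" if "x \<in> {0..T}" for x
      using M[of x] B[OF that] unfolding abs_mult by (intro mult_mono) auto
    then have "integrable lborel (\<lambda>t. A t * (\<phi> t * D K n t))" by (intro int[where B = "M * B"]) auto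
    then show ?thesis by (simp add: mult.assoc)
  qed
  define W where "W = (LBINT u. indicator {0<..<T} u * V u)"
  have diffb: "\<bar>(LBINT t. A t * \<phi> t * D K n t) - (LBINT t. A t * D N n t)\<bar> \<le> (2 powr (\<eta> + 1) * e n powr (\<eta> - 1)) * W" for n
  proof -
    have "\<bar>(LBINT t. A t * \<phi> t * D K n t) - (LBINT t. A t * D N n t)\<bar> = \<bar>LBINT t. A t * \<phi> t * D K n t - A t * D N n t\<bar>"
      by (simp only: Bochner_Integration.integral_diff[OF iK iN])
    also have "\<dots> \<le> (LBINT t. \<bar>A t * \<phi> t * D K n t - A t * D N n t\<bar>)" by (rule integral_abs_bound)
    also have "\<dots> \<le> (LBINT u. (2 powr (\<eta> + 1) * e n powr (\<eta> - 1)) * (indicator {0<..<T} u * V u))"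
    proof (rule integral_mono_AE)
      show "integrable lborel (\<lambda>t. \<bar>A t * \<phi> t * D K n t - A t * D N n t\<bar>)"
        by (rule integrable_abs[OF Bochner_Integration.integrable_diff[OF iK iN]])
      show "integrable lborel (\<lambda>u. (2 powr (\<eta> + 1) * e n powr (\<eta> - 1)) * (indicator {0<..<T} u * V u))"
        by (rule integrable_mult_right[OF V])
    qed (rule ptw)
    also have "\<dots> = (2 powr (\<eta> + 1) * e n powr (\<eta> - 1)) * W" by (simp add: W_def)
    finally show ?thesis .
  qed
  have limc: "(\<lambda>n. (2 powr (\<eta> + 1) * e n powr (\<eta> - 1)) * W) \<longlonglongrightarrow> 0"
  proof -
    have "(\<lambda>n. e n powr (\<eta> - 1)) \<longlonglongrightarrow> 0 powr (\<eta> - 1)"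
      by (rule tendsto_powr2[OF e(2) tendsto_const]) (use \<eta> e(1) in \<open>simp_all add: less_imp_le\<close>)
    then have "(\<lambda>n. e n powr (\<eta> - 1)) \<longlonglongrightarrow> 0" by simp
    from tendsto_mult_left_zero[OF tendsto_mult_right_zero[OF this]] show ?thesis .
  qed
  have "(\<lambda>n. (LBINT t. A t * \<phi> t * D K n t) - (LBINT t. A t * D N n t)) \<longlonglongrightarrow> 0"
    by (rule Lim_null_comparison[OF _ limc], intro always_eventually allI, unfold real_norm_def) (rule diffb)
  from tendsto_add[OF this lim1] show ?thesis by (simp add: A_def D_def mult.assoc)
qed

text \<open>One sequence, the integrals against the derivatives of the Steklov means, is evaluated
  twice: \<open>est'\<close> makes it converge to the increment of \<open>X\<close>, and fractional
  integration by parts makes it converge to the defining integral. Limits are unique.\<close>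

theorem has_frac_integral_of_increments:
  fixes X \<phi> V h h' Y :: "real \<Rightarrow> real"
  assumes T: "0 < T" and \<gamma>: "0 < \<gamma>" "\<gamma> < 1" "0 < s" "s < 1" "1 < \<gamma> * (1 + s)"
    and Y: "holder_on \<gamma> {0..T} Y" and \<tau>: "\<tau> \<in> {0..T}"
    and [measurable]: "\<phi> \<in> borel_measurable borel" "V \<in> borel_measurable borel"
    and M: "\<And>u. \<bar>\<phi> u\<bar> \<le> M" and V0: "\<And>u. 0 \<le> V u"
    and V: "(\<integral>\<^sup>+u\<in>{0<..<T}. ennreal (V u) \<partial>lborel) < \<infinity>"
    and X: "\<And>x. isCont X x"
    and est: "AE u in lborel. u \<in> {0<..<T} \<longrightarrow> (\<forall>v. \<bar>\<phi> u - \<phi> v\<bar> \<le> \<bar>u - v\<bar> powr (\<gamma> * s) * V u)"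
    and est': "AE u in lborel. u \<in> {0<..<T} \<longrightarrow>
      (\<forall>v. \<bar>X v - X u - \<phi> u * (clamped T Y v - clamped T Y u)\<bar> \<le> \<bar>u - v\<bar> powr (\<gamma> * (1 + s)) * V u)"
    and h': "h' \<in> borel_measurable borel" "\<And>t. t \<in> {0<..<T} \<Longrightarrow> h t = h' t"
      "AE t in lborel. t \<in> {0<..<T} \<longrightarrow> h' t = indicator {0..\<tau>} t * \<phi> t"
  shows "has_frac_integral T h Y (X \<tau> - X 0)"
proof -
  have "1 - \<gamma> < \<gamma> * s" using \<gamma>(5) by (simp add: algebra_simps)
  \<comment> \<open>The lower bound puts the integrator into \<open>W_T\<close> of order 1 -
    \<theta> < \<gamma>; the upper bound puts the integrand into \<open>W_0\<close> of order
    \<theta>.\<close>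
  then obtain \<theta> where \<theta>': "1 - \<gamma> < \<theta>" "\<theta> < \<gamma> * s" using dense by blast
  have "\<gamma> * s < 1" using mult_strict_right_mono[of \<gamma> 1 s] \<gamma> by linarith
  then have \<theta>: "0 < \<theta>" "\<theta> < 1" using \<theta>' \<gamma> by linarith+
  interpret frac_order \<theta> T using \<theta> T by unfold_locales
  interpret c: frac_order "1 - \<theta>" T by (rule frac_order_compl)
  define g where "g = (\<lambda>u. indicator {0<..<T} u * (indicator {0..\<tau>} u * \<phi> u))"
  have gm [measurable]: "g \<in> borel_measurable borel" unfolding g_def by measurable
  have gz: "g t = 0" if "t \<notin> {0<..<T}" for t using that by (simp add: g_def)
  have M0: "0 \<le> M" using M[of 0] by simp
  have gM: "\<bar>g t\<bar> \<le> M" for t using M[of t] M0 by (auto simp: g_def indicator_def)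
  have W0: "g \<in> W_0 T \<theta>" unfolding g_def
    by (rule indicator_times_in_W_0[OF T \<theta> \<theta>'(2) \<tau> _ _ M V0 V est]) measurable
  have fin: "(\<integral>\<^sup>+t. (\<integral>\<^sup>+r. ennreal \<bar>indicator {0<..<T} t * (indicator {0<..} r * ((g t - g (t - r)) * r powr (- 1 - \<theta>)))\<bar> \<partial>lborel) \<partial>lborel) < \<infinity>"
    by (rule W_0_imp_marchaud_left_finite[OF gm gz W0])
  have WT: "Y \<in> W_T T (1 - \<theta>)" using holder_in_W_T[OF T _ _ Y, of "1 - \<theta>"] \<theta> \<theta>' by simp
  obtain C where C: "0 \<le> C" "\<And>x y. \<bar>clamped T Y x - clamped T Y y\<bar> \<le> C * \<bar>x - y\<bar> powr \<gamma>"
    using holder_on_clamped[OF T \<gamma>(1) Y] by blast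
  have Yc: "isCont (clamped T Y) x" for x by (rule holder_imp_isCont[OF \<gamma>(1) C(2)])
  have [measurable]: "clamped T Y \<in> borel_measurable borel"
    using Yc by (auto intro!: borel_measurable_continuous_onI continuous_at_imp_continuous_on)
  have ll: "left_limit Y T = Y T" by (rule left_limit_clamped(2)[OF T Yc])
  define k where "k = (\<lambda>u. clamped T Y u - left_limit Y T)"
  have km [measurable]: "k \<in> borel_measurable borel" unfolding k_def by measurable
  have kc: "isCont k x" for x unfolding k_def by (intro continuous_intros Yc)
  have kh: "\<bar>k x - k y\<bar> \<le> C * \<bar>x - y\<bar> powr \<gamma>" for x y using C(2)[of x y] by (simp add: k_def)
  have kz: "k x = 0" if "T \<le> x" for x using clamped_ge[OF T that] by (simp add: k_def ll)
  have kB: "\<bar>k x\<bar> \<le> C * T powr \<gamma>" for x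
  proof -
    have "k x = clamped T Y (max 0 (min T x)) - clamped T Y T" using T by (simp add: k_def ll clamped_def)
    also have "\<bar>\<dots>\<bar> \<le> C * \<bar>max 0 (min T x) - T\<bar> powr \<gamma>" by (rule C)
    also have "\<dots> \<le> C * T powr \<gamma>" using C T \<gamma> by (intro mult_left_mono powr_mono2) auto
    finally show ?thesis .
  qed
  obtain K where K: "\<And>x. (K has_real_derivative k x) (at x)" using continuous_antiderivative[of k] kc by blast
  have Kc: "isCont K x" for x using K DERIV_isCont by blast
  obtain L where L: "\<And>x. (L has_real_derivative K x) (at x)" using continuous_antiderivative[of K] Kc by blast
  define e where "e = (\<lambda>n. 1 / real (Suc n))"
  have e: "0 < e n" "e \<longlonglongrightarrow> 0" for n unfolding e_def by (simp, rule LIMSEQ_Suc[OF lim_1_over_n])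
  let ?s = "\<lambda>n. LBINT t. g t * ((K (t + 2 * e n) - 2 * K (t + e n) + K t) / (e n)\<^sup>2)"
  have l1: "?s \<longlonglongrightarrow> X \<tau> - X 0"
    unfolding g_def
  proof (rule limit_of_second_differences[OF T \<gamma>(5) \<tau> _ _ V0 _ M X K _ e])
    show "integrable lborel (\<lambda>u. indicator {0<..<T} u * V u)"
    proof (rule integrableI_nonneg)
      have "(\<integral>\<^sup>+u. ennreal (indicator {0<..<T} u * V u) \<partial>lborel) = (\<integral>\<^sup>+u\<in>{0<..<T}. ennreal (V u) \<partial>lborel)"
        by (intro nn_integral_cong) (auto simp: indicator_def)
      then show "(\<integral>\<^sup>+u. ennreal (indicator {0<..<T} u * V u) \<partial>lborel) < \<infinity>" using V by simp
    qed (auto simp: V0)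
    show "AE u in lborel. u \<in> {0<..<T} \<longrightarrow> (\<forall>v. \<bar>X v - X u - \<phi> u * (k v - k u)\<bar> \<le> \<bar>u - v\<bar> powr (\<gamma> * (1 + s)) * V u)"
      using est' by (simp add: k_def)
  qed measurable
  have "1 - \<theta> < \<gamma>" using \<theta>' by simp
  then have l2: "?s \<longlonglongrightarrow> - (\<theta> * (1 - \<theta>) / (Gamma \<theta> * Gamma (1 - \<theta>))) *
      (LBINT t. indicator {0<..<T} t * marchaud_left \<theta> g t * marchaud (1 - \<theta>) k t)"
    by (rule marchaud_pairing_limit[OF _ gm gM gz fin kh kB kz L K e])
  \<comment> \<open>The factors \<theta> / Gamma (1 - \<theta>) and (1 - \<theta>) / Gamma \<theta>
    that separate Weyl-Marchaud from unnormalised Marchaud derivatives multiply to the constant of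
    \<open>l2\<close>, so nothing remains but the sign.\<close>
  have "(LINT t:{0<..<T}|lebesgue. frac_deriv_left \<theta> g t * frac_deriv_right T (1 - \<theta>) (\<lambda>u. Y u - left_limit Y T) t)
      = (\<theta> * (1 - \<theta>) / (Gamma \<theta> * Gamma (1 - \<theta>))) *
      (LBINT t. indicator {0<..<T} t * marchaud_left \<theta> g t * marchaud (1 - \<theta>) k t)"
  proof -
    have FR: "frac_deriv_right T (1 - \<theta>) (\<lambda>u. Y u - left_limit Y T) t = (1 - \<theta>) / Gamma \<theta> * marchaud (1 - \<theta>) k t"
      if t: "t \<in> {0<..<T}" for t
    proof -
      have "(LINT r:{t<..<T}|lebesgue. (Y t - left_limit Y T - (Y r - left_limit Y T)) / (r - t) powr (1 - \<theta> + 1))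
          = (LINT r:{t<..<T}|lebesgue. (k t - k r) / (r - t) powr (1 - \<theta> + 1))"
        using t by (intro set_lebesgue_integral_cong) (auto simp: k_def)
      moreover have "Y t - left_limit Y T = k t" using t by (simp add: k_def)
      ultimately have "frac_deriv_right T (1 - \<theta>) (\<lambda>u. Y u - left_limit Y T) t = frac_deriv_right T (1 - \<theta>) k t"
        unfolding frac_deriv_right_def by simp
      also have "\<dots> = (1 - \<theta>) / Gamma (1 - (1 - \<theta>)) * marchaud (1 - \<theta>) k t"
        by (rule c.frac_deriv_right_eq_marchaud[OF km kz]) (use t c.marchaud_integrable[OF \<open>1 - \<theta> < \<gamma>\<close> km kh kB] in auto)
      finally show ?thesis by simp
    qed
    have mm [measurable]: "marchaud (1 - \<theta>) k \<in> borel_measurable borel" "marchaud_left \<theta> g \<in> borel_measurable borel"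
      "frac_deriv_left \<theta> g \<in> borel_measurable borel"
      unfolding marchaud_def marchaud_left_def by (measurable, rule frac_deriv_left_measurable[OF gm])
    have "(LINT t:{0<..<T}|lebesgue. frac_deriv_left \<theta> g t * frac_deriv_right T (1 - \<theta>) (\<lambda>u. Y u - left_limit Y T) t)
      = (LINT t:{0<..<T}|lebesgue. frac_deriv_left \<theta> g t * ((1 - \<theta>) / Gamma \<theta> * marchaud (1 - \<theta>) k t))"
      by (intro set_lebesgue_integral_cong) (auto simp: FR)
    also have "\<dots> = (LBINT t. indicator {0<..<T} t *\<^sub>R (frac_deriv_left \<theta> g t * ((1 - \<theta>) / Gamma \<theta> * marchaud (1 - \<theta>) k t)))"
      unfolding set_lebesgue_integral_def by (rule integral_completion) measurable
    also have "\<dots> = (LBINT t. (\<theta> * (1 - \<theta>) / (Gamma \<theta> * Gamma (1 - \<theta>))) *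
        (indicator {0<..<T} t * marchaud_left \<theta> g t * marchaud (1 - \<theta>) k t))"
    proof (rule integral_cong_AE)
      show "AE t in lborel. indicator {0<..<T} t *\<^sub>R (frac_deriv_left \<theta> g t * ((1 - \<theta>) / Gamma \<theta> * marchaud (1 - \<theta>) k t))
        = (\<theta> * (1 - \<theta>) / (Gamma \<theta> * Gamma (1 - \<theta>))) * (indicator {0<..<T} t * marchaud_left \<theta> g t * marchaud (1 - \<theta>) k t)"
        using marchaud_left_integrable(2)[OF gm fin]
      proof eventually_elim
        case (elim t)
        show ?case
        proof (cases "t \<in> {0<..<T}")
          case True
          then have "frac_deriv_left \<theta> g t = \<theta> / Gamma (1 - \<theta>) * marchaud_left \<theta> g t"
            using elim by (intro frac_deriv_left_eq_marchaud[OF gm gz]) auto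
          then show ?thesis using True by (simp add: ac_simps)
        qed simp
      qed
    qed measurable
    finally show ?thesis by simp
  qed
  then have "X \<tau> - X 0 = - (LINT t:{0<..<T}|lebesgue. frac_deriv_left \<theta> g t * frac_deriv_right T (1 - \<theta>) (\<lambda>u. Y u - left_limit Y T) t)"
    using LIMSEQ_unique[OF l1 l2] by simp
  then have hf: "has_frac_integral T g Y (X \<tau> - X 0)"
    unfolding has_frac_integral_def using \<theta> W0 WT by blast
  show ?thesis
  proof (rule has_frac_integral_cong[OF gm h'(1) T _ _ hf])
    show "(\<lambda>u. clamped T Y u - left_limit Y T) \<in> borel_measurable borel" by measurable
    show "AE t in lborel. t \<in> {0<..<T} \<longrightarrow> h' t = g t"
      using h'(3) by eventually_elim (simp add: g_def)
    show "h t = h' t" if "t \<in> {0<..<T}" for t using h'(2)[OF that] .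
    show "Y t = clamped T Y t" if "t \<in> {0<..<T}" for t using that by simp
  qed
qed

section \<open>Potentials of Radon measures\<close>

lemma riesz_0 [simp]: "riesz s 0 = \<infinity>"
  by (simp add: riesz_def)

lemma riesz_eq: "x \<noteq> 0 \<Longrightarrow> riesz s x = ennreal (\<bar>x\<bar> powr (- s))"
  by (simp add: riesz_def inverse_ennreal powr_minus)

lemma riesz_measurable [measurable]: "riesz s \<in> borel_measurable borel"
  unfolding riesz_def by measurable

text \<open>Transfers kernels through Lipschitz maps. For \<open>y = 0\<close> the right-hand side
  is infinite, so the comparison extends across the singularity.\<close>

lemma riesz_scale:
  assumes "0 < s" "0 < L" "\<bar>y\<bar> \<le> L * \<bar>x\<bar>"
  shows "riesz s x \<le> ennreal (L powr s) * riesz s y"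
proof (cases "y = 0")
  case True
  then show ?thesis using assms by (simp add: ennreal_mult_top)
next
  case False
  then have x: "x \<noteq> 0" using assms by auto
  have "\<bar>x\<bar> powr (- s) = (L powr s) * (L * \<bar>x\<bar>) powr (- s)"
    using assms by (simp add: powr_mult powr_minus)
  also have "\<dots> \<le> L powr s * \<bar>y\<bar> powr (- s)"
    using assms False by (intro mult_left_mono powr_mono2') auto
  finally show ?thesis using x False by (simp add: riesz_eq ennreal_mult'[symmetric] ennreal_leI)
qed

lemma riesz_antimono:
  assumes "0 < s" "\<bar>y\<bar> \<le> \<bar>x\<bar>" shows "riesz s x \<le> riesz s y"
  using riesz_scale[OF assms(1), of 1 y x] assms by simp

lemma one_le_riesz:
  assumes "0 < s" "\<bar>x\<bar> \<le> \<rho>" "0 < \<rho>"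
  shows "1 \<le> ennreal (\<rho> powr s) * riesz s x"
  using riesz_scale[of s \<rho> x 1] assms by (simp add: riesz_eq)

text \<open>The layer-cake form of the kernel; it turns the potential of a measure into an integral
  of the masses of intervals about the point.\<close>

lemma riesz_eq_nn_integral:
  assumes "0 < s" "y \<noteq> 0"
  shows "riesz s y = (\<integral>\<^sup>+r. ennreal (s * (indicator {\<bar>y\<bar>..} r * r powr (- s - 1))) \<partial>lborel)"
proof -
  have "(\<integral>\<^sup>+r. ennreal (s * (indicator {\<bar>y\<bar>..} r * r powr (- s - 1))) \<partial>lborel)
      = ennreal s * (\<integral>\<^sup>+r. ennreal (indicator {\<bar>y\<bar>..} r * r powr (- s - 1)) \<partial>lborel)"
    using assms by (simp add: ennreal_mult' nn_integral_cmult)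
  also have "\<dots> = ennreal s * ennreal (\<bar>y\<bar> powr (- s) / s)"
    using nn_integral_powr_to_inf[of "- s - 1" "\<bar>y\<bar>"] assms by (simp add: minus_divide_left[symmetric])
  also have "\<dots> = riesz s y" using assms by (simp add: riesz_eq ennreal_mult'[symmetric])
  finally show ?thesis ..
qed

section \<open>Support, upper regularity and bounded potentials\<close>

context radon_measure
begin

lemma sigma_finite: "sigma_finite_measure P"
proof
  have "(\<Union>n. {- real n..real n}) = UNIV"
  proof (intro equalityI subsetI UNIV_I)
    fix x :: real
    obtain n :: nat where "\<bar>x\<bar> < real n" using reals_Archimedean2 by blast
    then show "x \<in> (\<Union>n. {- real n..real n})" by (auto simp: abs_less_iff intro!: exI[of _ n])
  qed
  then show "\<exists>A. countable A \<and> A \<subseteq> sets P \<and> \<Union> A = space P \<and> (\<forall>a\<in>A. emeasure P a \<noteq> \<infinity>)"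
    using finite_Icc by (intro exI[of _ "range (\<lambda>n. {- real n..real n})"]) (auto simp: less_top)
qed

text \<open>By Lindelof, the complement of the support is a countable union of open null
  sets.\<close>

lemma emeasure_zero_off_support:
  assumes "A \<in> sets borel" "A \<inter> measure_support P = {}"
  shows "emeasure P A = 0"
proof -
  let ?F = "{U. open U \<and> emeasure P U = 0}"
  obtain F' where F': "F' \<subseteq> ?F" "countable F'" "\<Union>F' = \<Union>?F"
    using Lindelof[of ?F] by auto
  have "(\<Union>U\<in>F'. U) \<in> null_sets P"
    by (rule null_sets_UN') (use F' in \<open>auto simp: null_sets_def\<close>)
  moreover have "A \<subseteq> (\<Union>U\<in>F'. U)"
  proof
    fix x assume "x \<in> A"
    then have "x \<notin> measure_support P" using assms by auto
    then obtain U where "open U" "x \<in> U" "emeasure P U = 0"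
      unfolding measure_support_def by (auto simp: zero_less_iff_neq_zero)
    then have "x \<in> \<Union>?F" by auto
    then show "x \<in> (\<Union>U\<in>F'. U)" using F' by simp
  qed
  ultimately show ?thesis using assms null_sets_subset[of _ P A] by (auto simp: null_sets_def)
qed

text \<open>Regularity is known only at points of \<open>A\<close> in the support. Either A within
  [l, m] contains such a point, and the interval about it of radius 2 (m - l) contains [l, m], or
  this part of \<open>A\<close> is null. The factor 2 makes the containment strict, since the
  intervals of the hypothesis are open.\<close>

lemma regular_interval:
  assumes A: "A \<in> sets borel" and c: "0 < c" and r0: "0 < r\<^sub>0" and d: "0 < d"
    and reg: "\<And>x r. x \<in> A \<Longrightarrow> x \<in> measure_support P \<Longrightarrow> 0 < r \<Longrightarrow> r < r\<^sub>0 \<Longrightarrow>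
      emeasure P {x - r<..<x + r} \<le> ennreal (c * r powr d)"
    and lm: "l \<le> m" "2 * (m - l) < r\<^sub>0"
  shows "emeasure P (A \<inter> {l..m}) \<le> ennreal (c * (2 * (m - l)) powr d)"
proof (cases "A \<inter> {l..m} \<inter> measure_support P = {}")
  case True
  then show ?thesis using emeasure_zero_off_support[of "A \<inter> {l..m}"] A by simp
next
  case False
  then obtain x where x: "x \<in> A" "l \<le> x" "x \<le> m" "x \<in> measure_support P" by auto
  show ?thesis
  proof (cases "l = m")
    case False
    have "emeasure P (A \<inter> {l..m}) \<le> emeasure P {x - 2 * (m - l)<..<x + 2 * (m - l)}"
      by (rule emeasure_mono) (use x False lm in auto)
    also have "\<dots> \<le> ennreal (c * (2 * (m - l)) powr d)" by (rule reg) (use x False lm in auto)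
    finally show ?thesis .
  next
    case True
    \<comment> \<open>For a single point the radius 2 (m - l) is 0 and not allowed; letting r tend
      to 0 shows instead that there is no atom, in accordance with
      \<open>0 powr d = 0\<close>.\<close>
    have "emeasure P (A \<inter> {l..m}) \<le> ennreal (c * r powr d)" if "0 < r" "r < r\<^sub>0" for r
    proof -
      have "emeasure P (A \<inter> {l..m}) \<le> emeasure P {x - r<..<x + r}"
        by (rule emeasure_mono) (use x True that in auto)
      also have "\<dots> \<le> ennreal (c * r powr d)" by (rule reg) (use x that in auto)
      finally show ?thesis .
    qed
    then have "\<forall>\<^sub>F r in at_right 0. emeasure P (A \<inter> {l..m}) \<le> ennreal (c * r powr d)"
      using r0 by (auto simp: eventually_at_right_field)
    moreover have "((\<lambda>r. ennreal (c * r powr d)) \<longlongrightarrow> ennreal (c * 0 powr d)) (at_right 0)"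
      using d by (intro tendsto_ennrealI tendsto_intros)
        (auto simp: eventually_at_right_less intro!: eventually_mono[OF eventually_at_right_less])
    ultimately have "emeasure P (A \<inter> {l..m}) \<le> ennreal (c * 0 powr d)"
      by (intro tendsto_lowerbound) auto
    then show ?thesis using True by simp
  qed
qed

text \<open>For short intervals the surplus power d - s is absorbed into a power of
  \<open>r\<^sub>0\<close>. For long ones the mass of [p, q] is enough, since then 2 (m - l) /
  \<open>r\<^sub>0\<close> is at least 1.\<close>

lemma regular_modulus:
  assumes A: "A \<in> sets borel" and c: "0 < c" and r0: "0 < r\<^sub>0" and s: "0 < s" "s < d"
    and reg: "\<And>x r. x \<in> A \<Longrightarrow> x \<in> measure_support P \<Longrightarrow> 0 < r \<Longrightarrow> r < r\<^sub>0 \<Longrightarrow>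
      emeasure P {x - r<..<x + r} \<le> ennreal (c * r powr d)"
  obtains c' where "0 \<le> c'" "\<And>l m. p \<le> l \<Longrightarrow> l \<le> m \<Longrightarrow> m \<le> q \<Longrightarrow>
    emeasure P (A \<inter> {l..m}) \<le> ennreal (c' * (m - l) powr s)"
proof
  let ?c1 = "c * 2 powr s * r\<^sub>0 powr (d - s)" and ?c2 = "measure P {p..q} * (2 / r\<^sub>0) powr s"
  show "0 \<le> ?c1 + ?c2" using c by simp
  fix l m assume lm: "p \<le> l" "l \<le> m" "m \<le> q"
  show "emeasure P (A \<inter> {l..m}) \<le> ennreal ((?c1 + ?c2) * (m - l) powr s)"
  proof (cases "2 * (m - l) < r\<^sub>0")
    case True
    have "emeasure P (A \<inter> {l..m}) \<le> ennreal (c * (2 * (m - l)) powr d)"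
      by (rule regular_interval[OF A c r0 _ reg]) (use s lm True in auto)
    also have "c * (2 * (m - l)) powr d = c * ((2 * (m - l)) powr s * (2 * (m - l)) powr (d - s))"
      by (simp add: powr_add[symmetric])
    also have "\<dots> \<le> c * ((2 * (m - l)) powr s * r\<^sub>0 powr (d - s))"
      using True lm s c by (intro mult_left_mono powr_mono2) auto
    also have "\<dots> = ?c1 * (m - l) powr s" using lm powr_mult[of 2 "m - l" s] by simp
    also have "\<dots> \<le> (?c1 + ?c2) * (m - l) powr s" by (intro mult_right_mono) auto
    finally show ?thesis by (simp add: ennreal_leI)
  next
    case False
    have "emeasure P (A \<inter> {l..m}) \<le> emeasure P {p..q}" by (rule emeasure_mono) (use lm in auto)
    also have "\<dots> = ennreal (measure P {p..q})"
      using finite_Icc[of p q] by (intro emeasure_eq_ennreal_measure) (simp add: less_top)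
    also have "measure P {p..q} \<le> measure P {p..q} * ((2 / r\<^sub>0) * (m - l)) powr s"
    proof -
      have "1 powr s \<le> ((2 / r\<^sub>0) * (m - l)) powr s"
        using False r0 s by (intro powr_mono2) (auto simp: field_simps)
      then show ?thesis using mult_left_mono[of 1 _ "measure P {p..q}"] by simp
    qed
    also have "\<dots> = ?c2 * (m - l) powr s" using r0 lm powr_mult[of "2 / r\<^sub>0" "m - l" s] by simp
    also have "\<dots> \<le> (?c1 + ?c2) * (m - l) powr s" using c by (intro mult_right_mono) auto
    finally show ?thesis by (simp add: ennreal_leI)
  qed
qed

text \<open>By the layer-cake formula the potential integrates s r^(-s-1) against the masses of
  intervals: d > s makes this integrable at 0, and s > 0 at infinity. The bound \<open>c'\<close>
  precedes \<open>x\<close> and \<open>A\<close> in the statement, so it is uniform in both.\<close>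

lemma growth_potential:
  assumes c: "0 < c" and \<rho>: "0 < \<rho>" and s: "0 < s" "s < d"
  obtains c' where "c' < \<infinity>" "\<And>x A. A \<in> sets borel \<Longrightarrow> A \<subseteq> {p..q} \<Longrightarrow>
      (\<And>r. 0 \<le> r \<Longrightarrow> r < \<rho> \<Longrightarrow> emeasure P (A \<inter> {x - r..x + r}) \<le> ennreal (c * r powr d)) \<Longrightarrow>
      (\<integral>\<^sup>+z\<in>A. riesz s (x - z) \<partial>P) \<le> c'"
proof -
  interpret sigma_finite_measure P by (rule sigma_finite)
  interpret pair_sigma_finite lborel P ..
  define b where "b = (\<lambda>r. ennreal (s * c) * ennreal (indicator {0..\<rho>} r * r powr (d - s - 1))
      + ennreal s * emeasure P {p..q} * ennreal (indicator {\<rho>..} r * r powr (- s - 1)))"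
  show thesis
  proof
    have "(\<integral>\<^sup>+r. b r \<partial>lborel) = ennreal (s * c) * ennreal (\<rho> powr (d - s - 1 + 1) / (d - s - 1 + 1))
      + ennreal s * emeasure P {p..q} * ennreal (- (\<rho> powr (- s - 1 + 1)) / (- s - 1 + 1))"
      unfolding b_def
      by (subst nn_integral_add, measurable, subst (1 2) nn_integral_cmult, measurable,
          subst nn_integral_powr_from_0, use s \<rho> in simp, use \<rho> in simp,
          subst nn_integral_powr_to_inf) (use s \<rho> in simp_all)
    also have "\<dots> < \<infinity>" using finite_Icc[of p q] by (simp add: ennreal_mult_less_top)
    finally show "(\<integral>\<^sup>+r. b r \<partial>lborel) < \<infinity>" .
    fix x A
    assume A: "A \<in> sets borel" "A \<subseteq> {p..q}"
      and growth: "\<And>r. 0 \<le> r \<Longrightarrow> r < \<rho> \<Longrightarrow> emeasure P (A \<inter> {x - r..x + r}) \<le> ennreal (c * r powr d)"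
    note [measurable] = A(1)
    let ?k = "\<lambda>r z. indicator A z * ennreal (s * (indicator {\<bar>x - z\<bar>..} r * r powr (- s - 1)))"
    have km: "case_prod ?k \<in> borel_measurable (lborel \<Otimes>\<^sub>M P)"
    proof -
      have "(\<lambda>w. indicator A (snd w) * ennreal (s * (indicator {w. \<bar>x - snd w\<bar> \<le> fst w} w * fst w powr (- s - 1))))
          \<in> borel_measurable (borel \<Otimes>\<^sub>M borel)" by measurable
      then have "(\<lambda>w. indicator A (snd w) * ennreal (s * (indicator {w. \<bar>x - snd w\<bar> \<le> fst w} w * fst w powr (- s - 1))))
          \<in> borel_measurable (lborel \<Otimes>\<^sub>M P)" by (simp cong: measurable_cong_sets sets_pair_measure_cong)
      then show ?thesis by (rule measurable_cong[THEN iffD1, rotated]) (auto simp: indicator_def)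
    qed
    have atom: "emeasure P (A \<inter> {x..x}) = 0"
      using growth[of 0] s \<rho> by simp
    have "(\<integral>\<^sup>+z\<in>A. riesz s (x - z) \<partial>P) = (\<integral>\<^sup>+z. (\<integral>\<^sup>+r. ?k r z \<partial>lborel) \<partial>P)"
    proof (rule nn_integral_cong_AE)
      have "A \<inter> {x..x} \<in> null_sets P" using atom by (auto simp: null_sets_def)
      then have "AE z in P. z \<notin> A \<inter> {x..x}" by (rule AE_not_in)
      then show "AE z in P. riesz s (x - z) * indicator A z = (\<integral>\<^sup>+r. ?k r z \<partial>lborel)"
      proof eventually_elim
        case (elim z)
        show ?case
        proof (cases "z \<in> A")
          case True
          then have "x - z \<noteq> 0" using elim by auto
          then show ?thesis using True riesz_eq_nn_integral[OF s(1), of "x - z"] by simp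
        qed simp
      qed
    qed
    also have "\<dots> = (\<integral>\<^sup>+r. (\<integral>\<^sup>+z. ?k r z \<partial>P) \<partial>lborel)"
      by (rule Fubini'[OF km])
    also have "\<dots> \<le> (\<integral>\<^sup>+r. b r \<partial>lborel)"
    proof (rule nn_integral_mono)
      fix r :: real
      have "(\<integral>\<^sup>+z. ?k r z \<partial>P) = (\<integral>\<^sup>+z. ennreal (s * r powr (- s - 1)) * indicator (A \<inter> {x - r..x + r}) z \<partial>P)"
        by (intro nn_integral_cong) (auto simp: indicator_def abs_le_iff)
      also have "\<dots> = ennreal (s * r powr (- s - 1)) * emeasure P (A \<inter> {x - r..x + r})"
        by (rule nn_integral_cmult_indicator) simp
      also have "\<dots> \<le> b r"
      proof -
        consider "r < 0" | "0 \<le> r" "r < \<rho>" | "\<rho> \<le> r" by linarith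
        then show ?thesis
        proof cases
          case 1
          then show ?thesis by simp
        next
          case 2
          have "emeasure P (A \<inter> {x - r..x + r}) \<le> ennreal (c * r powr d)"
            using growth 2 by simp
          then have "ennreal (s * r powr (- s - 1)) * emeasure P (A \<inter> {x - r..x + r})
              \<le> ennreal (s * r powr (- s - 1)) * ennreal (c * r powr d)"
            by (rule mult_left_mono) simp
          also have "\<dots> = ennreal (s * c * (r powr (- s - 1) * r powr d))"
            using s c by (simp add: ennreal_mult'[symmetric] ac_simps)
          also have "r powr (- s - 1) * r powr d = r powr (d - s - 1)"
            by (simp add: powr_add[symmetric] algebra_simps)
          also have "ennreal (s * c * r powr (d - s - 1))
             = ennreal (s * c) * ennreal (indicator {0..\<rho>} r * r powr (d - s - 1))"
            using 2 s c by (simp add: ennreal_mult'[symmetric])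
          also have "\<dots> \<le> b r" by (simp add: b_def)
          finally show ?thesis .
        next
          case 3
          have "emeasure P (A \<inter> {x - r..x + r}) \<le> emeasure P {p..q}"
            by (rule emeasure_mono) (use A in auto)
          then have "ennreal (s * r powr (- s - 1)) * emeasure P (A \<inter> {x - r..x + r})
              \<le> ennreal (s * r powr (- s - 1)) * emeasure P {p..q}" by (rule mult_left_mono) simp
          also have "\<dots> = ennreal s * emeasure P {p..q} * ennreal (indicator {\<rho>..} r * r powr (- s - 1))"
            using 3 s by (simp add: ennreal_mult' ac_simps)
          also have "\<dots> \<le> b r" by (simp add: b_def)
          finally show ?thesis .
        qed
      qed
      finally show "(\<integral>\<^sup>+z. ?k r z \<partial>P) \<le> b r" .
    qed
    finally show "(\<integral>\<^sup>+z\<in>A. riesz s (x - z) \<partial>P) \<le> (\<integral>\<^sup>+r. b r \<partial>lborel)" .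
  qed
qed

lemma regular_potential:
  assumes A: "A \<in> sets borel" "A \<subseteq> {p..q}" and c: "0 < c" and r0: "0 < r\<^sub>0" and s: "0 < s" "s < d"
    and reg: "\<And>x r. x \<in> A \<Longrightarrow> x \<in> measure_support P \<Longrightarrow> 0 < r \<Longrightarrow> r < r\<^sub>0 \<Longrightarrow>
      emeasure P {x - r<..<x + r} \<le> ennreal (c * r powr d)"
  obtains c' where "c' < \<infinity>" "\<And>x. (\<integral>\<^sup>+z\<in>A. riesz s (x - z) \<partial>P) \<le> c'"
proof -
  \<comment> \<open>An interval of radius r has length 2 r, so \<open>regular_interval\<close>
    bounds its mass by c (4 r)^d as long as 4 r < \<open>r\<^sub>0\<close>; hence the factor
    \<open>4 powr d\<close> and the radius \<open>r\<^sub>0 / 5\<close>. The centre \<open>x\<close>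
    may be any point, also off \<open>A\<close>.\<close>
  obtain c' where c': "c' < \<infinity>" "\<And>x A. A \<in> sets borel \<Longrightarrow> A \<subseteq> {p..q} \<Longrightarrow>
      (\<And>r. 0 \<le> r \<Longrightarrow> r < r\<^sub>0 / 5 \<Longrightarrow> emeasure P (A \<inter> {x - r..x + r}) \<le> ennreal (c * 4 powr d * r powr d)) \<Longrightarrow>
      (\<integral>\<^sup>+z\<in>A. riesz s (x - z) \<partial>P) \<le> c'"
    using growth_potential[of "c * 4 powr d" "r\<^sub>0 / 5" s d p q] c r0 s by (auto simp: mult.assoc)
  show thesis
  proof (rule that[OF c'(1)], rule c'(2)[OF A])
    fix x r :: real assume r: "0 \<le> r" "r < r\<^sub>0 / 5"
    have "emeasure P (A \<inter> {x - r..x + r}) \<le> ennreal (c * (2 * (x + r - (x - r))) powr d)"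
      by (rule regular_interval[OF A(1) c r0 _ reg]) (use s r r0 in auto)
    also have "c * (2 * (x + r - (x - r))) powr d = c * 4 powr d * r powr d"
      using r by (simp add: powr_mult)
    finally show "emeasure P (A \<inter> {x - r..x + r}) \<le> ennreal (c * 4 powr d * r powr d)" .
  qed
qed

end

section \<open>Paths of the form \<open>f \<circ> Z\<close>\<close>

locale rough_path = reciprocal_primitive F g C + radon_measure \<mu> for F g :: "real \<Rightarrow> real" and C :: real and \<mu> :: "real measure" +
  fixes T s \<gamma> x\<^sub>0 :: real and Y :: "real \<Rightarrow> real"
  assumes F_var: "\<And>x y. x \<le> y \<Longrightarrow> \<bar>F y - F x\<bar> \<le> measure \<mu> {x<..y}"
    and T_pos: "0 < T" and s_pos: "0 < s" and s_less: "s < 1"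
    and \<gamma>_gt: "1 / (1 + s) < \<gamma>" and \<gamma>_less: "\<gamma> < 1"
    and Y_holder: "holder_on \<gamma> {0..T} Y" and Y_0: "Y 0 = 0"
begin

definition Z :: "real \<Rightarrow> real" where "Z u = clamped T Y u + g x\<^sub>0"

definition X :: "real \<Rightarrow> real" where "X u = f (Z u)"

definition admissible :: "real set \<Rightarrow> bool" where
  "admissible A \<longleftrightarrow> bounded_potential T s Z (g ` A) \<or>
    (\<exists>d>s. \<exists>c>0. \<exists>r\<^sub>0>0. \<forall>x \<in> A \<inter> measure_support \<mu>. \<forall>r. 0 < r \<and> r < r\<^sub>0 \<longrightarrow>
        emeasure \<mu> {x - r<..<x + r} \<le> ennreal (c * r powr d))"

lemma \<gamma>_pos: "0 < \<gamma>"
proof -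
  have "0 < 1 / (1 + s)" using s_pos by simp
  then show ?thesis using \<gamma>_gt by linarith
qed

lemma \<gamma>_s: "1 < \<gamma> * (1 + s)"
  using \<gamma>_gt s_pos by (simp add: divide_less_eq)

lemma Z_holder: obtains H where "0 < H" "\<And>u v. \<bar>Z u - Z v\<bar> \<le> H * \<bar>u - v\<bar> powr \<gamma>"
proof -
  obtain H where H: "0 \<le> H" "\<And>x y. \<bar>clamped T Y x - clamped T Y y\<bar> \<le> H * \<bar>x - y\<bar> powr \<gamma>"
    using holder_on_clamped[OF T_pos \<gamma>_pos Y_holder] by blast
  \<comment> \<open>The constant is made strictly positive, since H times a power of |u - v| later
    serves as a radius of the kernel.\<close>
  have "\<bar>Z u - Z v\<bar> \<le> (H + 1) * \<bar>u - v\<bar> powr \<gamma>" for u v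
  proof -
    have "H * \<bar>u - v\<bar> powr \<gamma> \<le> (H + 1) * \<bar>u - v\<bar> powr \<gamma>" by (intro mult_right_mono) auto
    then show ?thesis using H(2)[of u v] unfolding Z_def by linarith
  qed
  then show thesis using H(1) by (intro that[of "H + 1"]) auto
qed

lemma isCont_Z: "isCont Z x"
  using Z_holder holder_imp_isCont[OF \<gamma>_pos] by metis

lemma isCont_X: "isCont X x"
  unfolding X_def by (rule isCont_o2[OF isCont_Z isCont_f])

lemma Z_measurable [measurable]: "Z \<in> borel_measurable borel"
  and X_measurable [measurable]: "X \<in> borel_measurable borel"
  using isCont_Z isCont_X by (auto intro!: borel_measurable_continuous_onI continuous_at_imp_continuous_on)

lemma g_X [simp]: "g (X u) = Z u"
  by (simp add: X_def)

lemma X_0: "X 0 = x\<^sub>0"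
  using T_pos by (simp add: X_def Z_def Y_0)

lemma Z_clamp: "Z u = Z (max 0 (min T u))"
  using T_pos by (simp add: Z_def clamped_def)

lemma g_mono: "g x \<le> g y \<longleftrightarrow> x \<le> y"
  using strict_mono_g by (rule strict_mono_less_eq)

lemma g_segment: "z \<in> closed_segment x y \<Longrightarrow> g z \<in> closed_segment (g x) (g y)"
  by (cases "x \<le> y") (simp_all add: closed_segment_eq_real_ivl g_mono)

lemma range_X: obtains p q where "p \<le> q" "X ` {0..T} = {p..q}" "\<And>u. X u \<in> {p..q}"
proof -
  have "\<exists>p q. X ` {0..T} = {p..q} \<and> p \<le> q"
    by (rule continuous_image_closed_interval)
       (use T_pos isCont_X in \<open>auto intro: continuous_at_imp_continuous_on\<close>)
  then obtain p q where pq: "X ` {0..T} = {p..q}" "p \<le> q" by blast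
  have "X u \<in> X ` {0..T}" for u
  proof -
    have "X u = X (max 0 (min T u))" unfolding X_def by (subst Z_clamp) simp
    then show ?thesis using T_pos by auto
  qed
  then show thesis using that pq by metis
qed

text \<open>Closed segments, instead of the half-open intervals of \<open>F_var\<close>, make the
  bound independent of the order of \<open>x\<close> and \<open>y\<close>; for \<open>x = y\<close>
  they see the atom at \<open>x\<close>.\<close>

lemma F_diff_le_segment: "z \<in> closed_segment x y \<Longrightarrow> \<bar>F z - F x\<bar> \<le> measure \<mu> (closed_segment x y)"
proof -
  assume z: "z \<in> closed_segment x y"
  have mono: "measure \<mu> {a<..b} \<le> measure \<mu> {c..d}" if "{a<..b} \<subseteq> {c..d}" for a b c d
    using finite_Icc[of c d] that by (intro measure_mono_fmeasurable) (auto simp: fmeasurable_def)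
  show ?thesis
  proof (cases "x \<le> y")
    case True
    then have "\<bar>F z - F x\<bar> \<le> measure \<mu> {x<..z}" using z by (intro F_var) (auto simp: closed_segment_eq_real_ivl)
    also have "\<dots> \<le> measure \<mu> {x..y}" using z True by (intro mono) (auto simp: closed_segment_eq_real_ivl)
    finally show ?thesis using True by (simp add: closed_segment_eq_real_ivl)
  next
    case False
    then have "\<bar>F x - F z\<bar> \<le> measure \<mu> {z<..x}" using z by (intro F_var) (auto simp: closed_segment_eq_real_ivl)
    also have "\<dots> \<le> measure \<mu> {y..x}" using z False by (intro mono) (auto simp: closed_segment_eq_real_ivl)
    finally show ?thesis using False by (simp add: closed_segment_eq_real_ivl abs_minus_commute)
  qed
qed

lemma segment_measurable [measurable]: "closed_segment (x::real) y \<in> sets borel"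
  by (simp add: closed_segment_eq_real_ivl)

lemma emeasure_segment_finite: "emeasure \<mu> (closed_segment x y) < \<infinity>"
  using finite_Icc by (simp add: closed_segment_eq_real_ivl)

text \<open>Continuity from above of \<mu> along intervals shrinking to \<open>x\<close>: their
  masses tend to 0 and dominate the oscillation of \<open>F\<close>.\<close>

lemma isCont_F_no_atom:
  assumes "emeasure \<mu> {x} = 0" shows "isCont F x"
proof -
  let ?I = "\<lambda>n. {x - 1 / real (Suc n)..x + 1 / real (Suc n)}"
  have "(\<lambda>n. emeasure \<mu> (?I n)) \<longlonglongrightarrow> emeasure \<mu> (\<Inter>n. ?I n)"
  proof (rule Lim_emeasure_decseq)
    show "decseq ?I"
    proof (rule decseq_SucI)
      fix n
      have "1 / real (Suc (Suc n)) \<le> 1 / real (Suc n)" by (intro divide_left_mono) auto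
      then show "?I (Suc n) \<subseteq> ?I n" by auto
    qed
  qed (use finite_Icc in \<open>auto simp: less_top\<close>)
  also have "(\<Inter>n. ?I n) = {x}"
  proof (intro equalityI subsetI)
    fix y assume y: "y \<in> (\<Inter>n. ?I n)"
    have l: "(\<lambda>n. 1 / real (Suc n)) \<longlonglongrightarrow> 0" by (rule LIMSEQ_Suc[OF lim_1_over_n])
    have "\<bar>y - x\<bar> \<le> 1 / real (Suc n)" for n using y by (auto simp: abs_le_iff dest!: spec[of _ n])
    then have "\<bar>y - x\<bar> \<le> 0" by (intro LIMSEQ_le_const[OF l]) auto
    then show "y \<in> {x}" by simp
  qed auto
  finally have lim: "(\<lambda>n. emeasure \<mu> (?I n)) \<longlonglongrightarrow> 0" using assms by simp
  show ?thesis unfolding continuous_at_eps_delta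
  proof (intro allI impI)
    fix e :: real assume "0 < e"
    then have "\<forall>\<^sub>F n in sequentially. emeasure \<mu> (?I n) < ennreal e"
      using lim by (intro order_tendstoD(2)) auto
    then obtain n where n: "emeasure \<mu> (?I n) < ennreal e" by (auto simp: eventually_sequentially)
    have "dist (F y) (F x) < e" if "dist y x < 1 / real (Suc n)" for y
    proof -
      have sub: "closed_segment x y \<subseteq> ?I n" using that by (auto simp: closed_segment_eq_real_ivl dist_real_def split: if_splits)
      have "ennreal \<bar>F y - F x\<bar> \<le> ennreal (measure \<mu> (closed_segment x y))"
        by (intro ennreal_leI F_diff_le_segment) simp
      also have "\<dots> = emeasure \<mu> (closed_segment x y)"
        using emeasure_segment_finite by (intro emeasure_eq_ennreal_measure[symmetric]) (simp add: less_top)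
      also have "\<dots> \<le> emeasure \<mu> (?I n)" by (rule emeasure_mono[OF sub]) simp
      also have "\<dots> < ennreal e" by (rule n)
      finally show ?thesis by (simp add: dist_real_def ennreal_less_iff)
    qed
    then show "\<exists>d>0. \<forall>y. dist y x < d \<longrightarrow> dist (F y) (F x) < e"
      by (intro exI[of _ "1 / real (Suc n)"]) auto
  qed
qed

lemma potential_measurable:
  assumes [measurable]: "A \<in> sets borel" "h \<in> borel_measurable borel" "k \<in> borel_measurable borel"
  shows "(\<lambda>u. \<integral>\<^sup>+z\<in>A. riesz s (h u - k z) \<partial>\<mu>) \<in> borel_measurable borel"
proof -
  interpret sigma_finite_measure \<mu> by (rule sigma_finite)
  show ?thesis by measurable
qed

text \<open>Fubini brings the time integral inside. Any \<open>z\<close> in [p, q] is a value of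
  \<open>X\<close>, so g z is a value of \<open>Z\<close> and the supremum in
  \<open>bounded_potential\<close> applies; the rest is the finite mass of [p, q].\<close>

lemma bounded_potential_integral:
  assumes A: "A \<in> sets borel" and b: "bounded_potential T s Z (g ` A)" and pq: "X ` {0..T} = {p..q}"
  shows "(\<integral>\<^sup>+t\<in>{0..T}. (\<integral>\<^sup>+z\<in>A \<inter> {p..q}. riesz s (Z t - g z) \<partial>\<mu>) \<partial>lborel) < \<infinity>"
proof -
  note [measurable] = A
  interpret sigma_finite_measure \<mu> by (rule sigma_finite)
  interpret pair_sigma_finite lborel \<mu> ..
  define S where "S = (SUP x \<in> Z ` {0..T} \<inter> g ` A. (\<integral>\<^sup>+t\<in>{0..T}. riesz s (Z t - x) \<partial>lebesgue))"
  have S: "S < \<infinity>" using b unfolding bounded_potential_def S_def .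
  have "(\<integral>\<^sup>+t\<in>{0..T}. (\<integral>\<^sup>+z\<in>A \<inter> {p..q}. riesz s (Z t - g z) \<partial>\<mu>) \<partial>lborel)
      = (\<integral>\<^sup>+t. (\<integral>\<^sup>+z. indicator {0..T} t * indicator (A \<inter> {p..q}) z * riesz s (Z t - g z) \<partial>\<mu>) \<partial>lborel)"
    by (intro nn_integral_cong) (auto simp: indicator_def intro!: nn_integral_cong)
  also have "\<dots> = (\<integral>\<^sup>+z. (\<integral>\<^sup>+t. indicator {0..T} t * indicator (A \<inter> {p..q}) z * riesz s (Z t - g z) \<partial>lborel) \<partial>\<mu>)"
    by (rule Fubini'[symmetric]) measurable
  also have "\<dots> \<le> (\<integral>\<^sup>+z. S * indicator {p..q} z \<partial>\<mu>)"
  proof (rule nn_integral_mono)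
    fix z
    show "(\<integral>\<^sup>+t. indicator {0..T} t * indicator (A \<inter> {p..q}) z * riesz s (Z t - g z) \<partial>lborel) \<le> S * indicator {p..q} z"
    proof (cases "z \<in> A \<inter> {p..q}")
      case True
      then obtain t' where "t' \<in> {0..T}" "z = X t'" using pq by (metis IntD2 imageE)
      then have "g z \<in> Z ` {0..T}" by simp
      moreover have "g z \<in> g ` A" using True by blast
      ultimately have "g z \<in> Z ` {0..T} \<inter> g ` A" by blast
      then have "(\<integral>\<^sup>+t\<in>{0..T}. riesz s (Z t - g z) \<partial>lebesgue) \<le> S" unfolding S_def by (rule SUP_upper)
      then show ?thesis using True by (simp add: nn_integral_completion mult.commute)
    qed auto
  qed
  also have "\<dots> = S * emeasure \<mu> {p..q}" by (rule nn_integral_cmult_indicator) simp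
  also have "\<dots> < \<infinity>" using S finite_Icc[of p q] by (simp add: ennreal_mult_less_top)
  finally show ?thesis .
qed

text \<open>If the potentials are bounded, a Chebyshev argument applies: points of the segment have
  images under \<open>g\<close> within H |u - v|^\<gamma> of Z u, so there the kernel is at least
  the power - s of this distance, and \<open>V\<close> is a multiple of the potential at Z u. If
  \<mu> is regular, the Lipschitz bound on \<open>f\<close> gives a constant
  \<open>V\<close>.\<close>

lemma admissible_modulus:
  assumes A: "A \<in> sets borel" and adm: "admissible A"
  obtains V where "V \<in> borel_measurable borel" "(\<integral>\<^sup>+t\<in>{0..T}. V t \<partial>lborel) < \<infinity>"
    "\<And>u v. V u < \<infinity> \<Longrightarrow> emeasure \<mu> (A \<inter> closed_segment (X u) (X v)) \<le> ennreal (\<bar>u - v\<bar> powr (\<gamma> * s)) * V u"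
proof -
  note [measurable] = A
  obtain p q where pq: "p \<le> q" "X ` {0..T} = {p..q}" "\<And>u. X u \<in> {p..q}" by (rule range_X) (rule that)
  obtain H where H: "0 < H" "\<And>u v. \<bar>Z u - Z v\<bar> \<le> H * \<bar>u - v\<bar> powr \<gamma>" by (rule Z_holder) (rule that)
  have seg_sub: "closed_segment (X u) (X v) \<subseteq> {p..q}" for u v
    using pq(3)[of u] pq(3)[of v] by (auto simp: closed_segment_eq_real_ivl split: if_splits)
  have Hs: "(H * \<bar>u - v\<bar> powr \<gamma>) powr s = H powr s * \<bar>u - v\<bar> powr (\<gamma> * s)" for u v
    using H by (simp add: powr_mult powr_powr)
  show thesis
  proof (cases "bounded_potential T s Z (g ` A)")
    case True
    define U where "U = (\<lambda>u. \<integral>\<^sup>+z\<in>A \<inter> {p..q}. riesz s (Z u - g z) \<partial>\<mu>)"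
    have [measurable]: "U \<in> borel_measurable borel"
      unfolding U_def by (rule potential_measurable) auto
    show thesis
    proof (rule that[of "\<lambda>u. ennreal (H powr s) * U u"])
      have "(\<integral>\<^sup>+t\<in>{0..T}. ennreal (H powr s) * U t \<partial>lborel) = ennreal (H powr s) * (\<integral>\<^sup>+t\<in>{0..T}. U t \<partial>lborel)"
        by (subst nn_integral_cmult[symmetric]) (auto simp: mult.assoc)
      then show "(\<integral>\<^sup>+t\<in>{0..T}. ennreal (H powr s) * U t \<partial>lborel) < \<infinity>"
        using bounded_potential_integral[OF A True pq(2)] by (simp add: U_def ennreal_mult_less_top)
      fix u v assume fin: "ennreal (H powr s) * U u < \<infinity>"
      then have Ufin: "U u < \<infinity>" using H by (auto simp: ennreal_mult_less_top)
      let ?S = "closed_segment (X u) (X v)"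
      show "emeasure \<mu> (A \<inter> ?S) \<le> ennreal (\<bar>u - v\<bar> powr (\<gamma> * s)) * (ennreal (H powr s) * U u)"
      proof (cases "u = v")
        case False
        have "emeasure \<mu> (A \<inter> ?S) = (\<integral>\<^sup>+z. indicator (A \<inter> ?S) z \<partial>\<mu>)" by simp
        also have "\<dots> \<le> (\<integral>\<^sup>+z. ennreal ((H * \<bar>u - v\<bar> powr \<gamma>) powr s) * (riesz s (Z u - g z) * indicator (A \<inter> {p..q}) z) \<partial>\<mu>)"
        proof (rule nn_integral_mono)
          fix z
          show "indicator (A \<inter> ?S) z \<le> ennreal ((H * \<bar>u - v\<bar> powr \<gamma>) powr s) * (riesz s (Z u - g z) * indicator (A \<inter> {p..q}) z)"
          proof (cases "z \<in> A \<inter> ?S")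
            case True
            then have "g z \<in> closed_segment (Z u) (Z v)"
              using g_segment[of z "X u" "X v"] by simp
            then have "\<bar>Z u - g z\<bar> \<le> \<bar>Z u - Z v\<bar>" by (auto simp: closed_segment_eq_real_ivl split: if_splits)
            also have "\<dots> \<le> H * \<bar>u - v\<bar> powr \<gamma>" by (rule H)
            finally have "1 \<le> ennreal ((H * \<bar>u - v\<bar> powr \<gamma>) powr s) * riesz s (Z u - g z)"
              using H False by (intro one_le_riesz s_pos) auto
            then show ?thesis using True seg_sub[of u v] by (auto simp: indicator_def)
          qed simp
        qed
        also have "\<dots> = ennreal ((H * \<bar>u - v\<bar> powr \<gamma>) powr s) * U u"
          unfolding U_def by (rule nn_integral_cmult) measurable
        also have "\<dots> = ennreal (\<bar>u - v\<bar> powr (\<gamma> * s)) * (ennreal (H powr s) * U u)"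
          unfolding Hs by (simp add: ennreal_mult' ac_simps)
        finally show ?thesis .
      next
        case True
        \<comment> \<open>For \<open>u = v\<close> the claimed bound is 0, so an atom at X u has to
          be excluded: the kernel is infinite there, which contradicts the finite potential.\<close>
        have "emeasure \<mu> (A \<inter> {X u}) = 0"
        proof (rule ccontr)
          assume pos: "emeasure \<mu> (A \<inter> {X u}) \<noteq> 0"
          have "\<infinity> * emeasure \<mu> (A \<inter> {X u}) = (\<integral>\<^sup>+z. \<infinity> * indicator (A \<inter> {X u}) z \<partial>\<mu>)"
            by (rule nn_integral_cmult_indicator[symmetric]) simp
          also have "\<dots> \<le> U u"
            unfolding U_def by (intro nn_integral_mono) (use pq(3)[of u] in \<open>auto simp: indicator_def\<close>)
          finally show False using pos Ufin by (simp add: ennreal_top_mult)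
        qed
        then show ?thesis using True by simp
      qed
    qed measurable
  next
    case False
    then obtain d c r\<^sub>0 where d: "s < d" and c: "0 < c" and r0: "0 < r\<^sub>0"
      and reg: "\<And>x r. x \<in> A \<Longrightarrow> x \<in> measure_support \<mu> \<Longrightarrow> 0 < r \<Longrightarrow> r < r\<^sub>0 \<Longrightarrow>
        emeasure \<mu> {x - r<..<x + r} \<le> ennreal (c * r powr d)"
      using adm unfolding admissible_def by blast
    obtain c' where c': "0 \<le> c'" "\<And>l m. p \<le> l \<Longrightarrow> l \<le> m \<Longrightarrow> m \<le> q \<Longrightarrow>
        emeasure \<mu> (A \<inter> {l..m}) \<le> ennreal (c' * (m - l) powr s)"
      using regular_modulus[OF A c r0 s_pos d reg] by blast
    show thesis
    proof (rule that[of "\<lambda>u. ennreal (c' * (C * H) powr s)"])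
      have "(\<integral>\<^sup>+t\<in>{0..T}. ennreal (c' * (C * H) powr s) \<partial>lborel) = ennreal (c' * (C * H) powr s) * emeasure lborel {0..T}"
        by (rule nn_integral_cmult_indicator) simp
      then show "(\<integral>\<^sup>+t\<in>{0..T}. ennreal (c' * (C * H) powr s) \<partial>lborel) < \<infinity>"
        using T_pos by (simp add: ennreal_mult_less_top)
      fix u v
      let ?l = "min (X u) (X v)" and ?m = "max (X u) (X v)"
      have "closed_segment (X u) (X v) = {?l..?m}" by (auto simp: closed_segment_eq_real_ivl)
      then have "emeasure \<mu> (A \<inter> closed_segment (X u) (X v)) \<le> ennreal (c' * (?m - ?l) powr s)"
        using c'(2)[of ?l ?m] pq(3)[of u] pq(3)[of v] by auto
      also have "?m - ?l = \<bar>X u - X v\<bar>" by auto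
      also have "c' * \<bar>X u - X v\<bar> powr s \<le> c' * (C * (H * \<bar>u - v\<bar> powr \<gamma>)) powr s"
      proof (intro mult_left_mono powr_mono2)
        have "\<bar>X u - X v\<bar> \<le> C * \<bar>Z u - Z v\<bar>"
          using lipschitz_onD[OF lipschitz_f, of "Z u" "Z v"] by (simp add: X_def dist_real_def)
        also have "\<dots> \<le> C * (H * \<bar>u - v\<bar> powr \<gamma>)" using H C_pos by (intro mult_left_mono) auto
        finally show "\<bar>X u - X v\<bar> \<le> C * (H * \<bar>u - v\<bar> powr \<gamma>)" .
      qed (use s_pos c' in auto)
      also have "c' * (C * (H * \<bar>u - v\<bar> powr \<gamma>)) powr s = \<bar>u - v\<bar> powr (\<gamma> * s) * (c' * (C * H) powr s)"
        using Hs[of u v] H C_pos by (simp add: powr_mult)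
      finally show "emeasure \<mu> (A \<inter> closed_segment (X u) (X v))
          \<le> ennreal (\<bar>u - v\<bar> powr (\<gamma> * s)) * ennreal (c' * (C * H) powr s)"
        by (simp add: ennreal_mult'[symmetric] ennreal_leI)
    qed measurable
  qed
qed

lemma total_modulus:
  assumes A: "A \<in> sets borel" and adm: "admissible A" "admissible (- A)"
  obtains V where "V \<in> borel_measurable borel" "(\<integral>\<^sup>+t\<in>{0..T}. V t \<partial>lborel) < \<infinity>"
    "\<And>u v. V u < \<infinity> \<Longrightarrow> emeasure \<mu> (closed_segment (X u) (X v)) \<le> ennreal (\<bar>u - v\<bar> powr (\<gamma> * s)) * V u"
proof -
  have nA: "- A \<in> sets borel" using A by auto
  obtain V where V [measurable]: "V \<in> borel_measurable borel" "(\<integral>\<^sup>+t\<in>{0..T}. V t \<partial>lborel) < \<infinity>"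
    "\<And>u v. V u < \<infinity> \<Longrightarrow> emeasure \<mu> (A \<inter> closed_segment (X u) (X v)) \<le> ennreal (\<bar>u - v\<bar> powr (\<gamma> * s)) * V u"
    using admissible_modulus[OF A adm(1)] by blast
  obtain W where W [measurable]: "W \<in> borel_measurable borel" "(\<integral>\<^sup>+t\<in>{0..T}. W t \<partial>lborel) < \<infinity>"
    "\<And>u v. W u < \<infinity> \<Longrightarrow> emeasure \<mu> (- A \<inter> closed_segment (X u) (X v)) \<le> ennreal (\<bar>u - v\<bar> powr (\<gamma> * s)) * W u"
    using admissible_modulus[OF nA adm(2)] by blast
  show thesis
  proof (rule that[of "\<lambda>u. V u + W u"])
    have "(\<integral>\<^sup>+t\<in>{0..T}. V t + W t \<partial>lborel) = (\<integral>\<^sup>+t\<in>{0..T}. V t \<partial>lborel) + (\<integral>\<^sup>+t\<in>{0..T}. W t \<partial>lborel)"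
      by (subst nn_integral_add[symmetric]) (auto simp: distrib_right)
    then show "(\<integral>\<^sup>+t\<in>{0..T}. V t + W t \<partial>lborel) < \<infinity>" using V(2) W(2) by simp
    fix u v assume "V u + W u < \<infinity>"
    then have fin: "V u < \<infinity>" "W u < \<infinity>" by auto
    let ?S = "closed_segment (X u) (X v)"
    have "emeasure \<mu> ?S = emeasure \<mu> ((A \<inter> ?S) \<union> (- A \<inter> ?S))" by (rule arg_cong[where f = "emeasure \<mu>"]) auto
    also have "\<dots> \<le> emeasure \<mu> (A \<inter> ?S) + emeasure \<mu> (- A \<inter> ?S)"
      by (rule emeasure_subadditive) (use A in auto)
    also have "\<dots> \<le> ennreal (\<bar>u - v\<bar> powr (\<gamma> * s)) * V u + ennreal (\<bar>u - v\<bar> powr (\<gamma> * s)) * W u"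
      by (intro add_mono V(3) W(3) fin)
    finally show "emeasure \<mu> ?S \<le> ennreal (\<bar>u - v\<bar> powr (\<gamma> * s)) * (V u + W u)" by (simp add: distrib_left)
  qed measurable
qed

text \<open>\<open>X'\<close> is the given path, prescribed on [0, T] only, and \<open>X\<close> its
  extension by constants. The integrand built from \<open>X'\<close> therefore need not be Borel on
  the line; the one built from \<open>X\<close> is.\<close>

lemma has_frac_integral_path:
  assumes A: "A \<in> sets borel" "admissible A" "admissible (- A)"
    and \<sigma>': "\<sigma>' \<in> borel_measurable borel" "\<And>x. isCont F x \<Longrightarrow> \<sigma>' x = F x"
    and \<tau>: "\<tau> \<in> {0..T}" and X': "\<And>t. t \<in> {0..T} \<Longrightarrow> X' t = X t"
  shows "has_frac_integral T (\<lambda>u. indicator {0..\<tau>} u * \<sigma>' (X' u)) Y (X' \<tau> - x\<^sub>0)"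
proof -
  note [measurable] = \<sigma>'(1)
  obtain V where [measurable]: "V \<in> borel_measurable borel" and V: "(\<integral>\<^sup>+t\<in>{0..T}. V t \<partial>lborel) < \<infinity>"
    "\<And>u v. V u < \<infinity> \<Longrightarrow> emeasure \<mu> (closed_segment (X u) (X v)) \<le> ennreal (\<bar>u - v\<bar> powr (\<gamma> * s)) * V u"
    using total_modulus[OF A] by blast
  obtain p q where pq: "p \<le> q" "X ` {0..T} = {p..q}" "\<And>u. X u \<in> {p..q}" by (rule range_X) (rule that)
  obtain H where H: "0 < H" "\<And>u v. \<bar>Z u - Z v\<bar> \<le> H * \<bar>u - v\<bar> powr \<gamma>" by (rule Z_holder) (rule that)
  \<comment> \<open>One weight for two estimates: the increments of F along \<open>X\<close> cost
    \<open>V\<close>, the deviation of the increments of \<open>X\<close> costs \<open>H\<close>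
    times \<open>V\<close>.\<close>
  define W where "W = (\<lambda>u. (1 + H) * enn2real (V u))"
  have W0: "0 \<le> W u" for u using H by (simp add: W_def)
  have [measurable]: "W \<in> borel_measurable borel" unfolding W_def by measurable
  have fin: "AE u in lborel. u \<in> {0<..<T} \<longrightarrow> V u < \<infinity>"
  proof -
    have "AE u in lborel. V u * indicator {0..T} u \<noteq> \<infinity>"
      by (rule nn_integral_PInf_AE) (use V(1) in auto)
    then show ?thesis by eventually_elim (auto simp: less_top)
  qed
  have seg: "measure \<mu> (closed_segment (X u) (X v)) \<le> \<bar>u - v\<bar> powr (\<gamma> * s) * enn2real (V u)" if "V u < \<infinity>" for u v
  proof -
    have "ennreal (measure \<mu> (closed_segment (X u) (X v))) = emeasure \<mu> (closed_segment (X u) (X v))"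
      using emeasure_segment_finite by (intro emeasure_eq_ennreal_measure[symmetric]) (simp add: less_top)
    also have "\<dots> \<le> ennreal (\<bar>u - v\<bar> powr (\<gamma> * s)) * ennreal (enn2real (V u))"
      using V(2)[OF that] that by simp
    also have "\<dots> = ennreal (\<bar>u - v\<bar> powr (\<gamma> * s) * enn2real (V u))" by (simp add: ennreal_mult')
    finally show ?thesis by (subst (asm) ennreal_le_iff) auto
  qed
  have "has_frac_integral T (\<lambda>u. indicator {0..\<tau>} u * \<sigma>' (X' u)) Y (X \<tau> - X 0)"
  proof (rule has_frac_integral_of_increments[OF T_pos \<gamma>_pos \<gamma>_less s_pos s_less \<gamma>_s Y_holder \<tau>,
        where V = W and \<phi> = "\<lambda>u. F (X u)" and h' = "\<lambda>u. indicator {0..\<tau>} u * \<sigma>' (X u)"])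
    show "\<bar>F (X u)\<bar> \<le> \<bar>F p\<bar> + measure \<mu> (closed_segment p q)" for u
    proof -
      have "X u \<in> closed_segment p q" using pq(1) pq(3)[of u] by (auto simp: closed_segment_eq_real_ivl)
      then have "\<bar>F (X u) - F p\<bar> \<le> measure \<mu> (closed_segment p q)" by (rule F_diff_le_segment)
      then show ?thesis by linarith
    qed
    show "(\<integral>\<^sup>+u\<in>{0<..<T}. ennreal (W u) \<partial>lborel) < \<infinity>"
    proof -
      have "(\<integral>\<^sup>+u\<in>{0<..<T}. ennreal (W u) \<partial>lborel) \<le> (\<integral>\<^sup>+u. ennreal (1 + H) * (V u * indicator {0..T} u) \<partial>lborel)"
      proof (rule nn_integral_mono_AE)
        show "AE u in lborel. ennreal (W u) * indicator {0<..<T} u \<le> ennreal (1 + H) * (V u * indicator {0..T} u)"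
          using fin
        proof eventually_elim
          case (elim u)
          then show ?case using H by (cases "u \<in> {0<..<T}") (auto simp: W_def ennreal_mult')
        qed
      qed
      also have "\<dots> = ennreal (1 + H) * (\<integral>\<^sup>+t\<in>{0..T}. V t \<partial>lborel)" by (rule nn_integral_cmult) measurable
      also have "\<dots> < \<infinity>" using V(1) by (simp add: ennreal_mult_less_top)
      finally show ?thesis .
    qed
    have Wge: "enn2real (V u) \<le> W u" for u
      using H mult_right_mono[of 1 "1 + H" "enn2real (V u)"] by (simp add: W_def)
    show "AE u in lborel. u \<in> {0<..<T} \<longrightarrow> (\<forall>v. \<bar>F (X u) - F (X v)\<bar> \<le> \<bar>u - v\<bar> powr (\<gamma> * s) * W u)"
      using fin
    proof eventually_elim
      case (elim u)
      have "\<bar>F (X u) - F (X v)\<bar> \<le> \<bar>u - v\<bar> powr (\<gamma> * s) * W u" if "u \<in> {0<..<T}" for v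
      proof -
        have "\<bar>F (X u) - F (X v)\<bar> \<le> measure \<mu> (closed_segment (X u) (X v))"
          using F_diff_le_segment[of "X v" "X u" "X v"] by (simp add: abs_minus_commute)
        also have "\<dots> \<le> \<bar>u - v\<bar> powr (\<gamma> * s) * enn2real (V u)" using elim that by (intro seg) auto
        also have "\<dots> \<le> \<bar>u - v\<bar> powr (\<gamma> * s) * W u" by (intro mult_left_mono Wge) auto
        finally show ?thesis .
      qed
      then show ?case by blast
    qed
    show "AE u in lborel. u \<in> {0<..<T} \<longrightarrow>
      (\<forall>v. \<bar>X v - X u - F (X u) * (clamped T Y v - clamped T Y u)\<bar> \<le> \<bar>u - v\<bar> powr (\<gamma> * (1 + s)) * W u)"
      using fin
    proof eventually_elim
      case (elim u)
      have "\<bar>X v - X u - F (X u) * (clamped T Y v - clamped T Y u)\<bar> \<le> \<bar>u - v\<bar> powr (\<gamma> * (1 + s)) * W u"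
        if u: "u \<in> {0<..<T}" for v
      proof -
        have "\<bar>X v - X u - F (X u) * (clamped T Y v - clamped T Y u)\<bar> = \<bar>X v - X u - F (X u) * (g (X v) - g (X u))\<bar>"
          by (simp add: Z_def)
        also have "\<dots> \<le> measure \<mu> (closed_segment (X u) (X v)) * \<bar>g (X v) - g (X u)\<bar>"
          by (rule deviation_bound_abs) (rule F_diff_le_segment)
        also have "\<dots> \<le> (\<bar>u - v\<bar> powr (\<gamma> * s) * enn2real (V u)) * (H * \<bar>u - v\<bar> powr \<gamma>)"
          using elim u H(2)[of u v] by (intro mult_mono seg) (auto simp: abs_minus_commute)
        also have "\<dots> = (\<bar>u - v\<bar> powr (\<gamma> * s) * \<bar>u - v\<bar> powr \<gamma>) * (H * enn2real (V u))" by simp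
        also have "\<bar>u - v\<bar> powr (\<gamma> * s) * \<bar>u - v\<bar> powr \<gamma> = \<bar>u - v\<bar> powr (\<gamma> * (1 + s))"
          by (simp add: powr_add[symmetric] algebra_simps)
        also have "\<bar>u - v\<bar> powr (\<gamma> * (1 + s)) * (H * enn2real (V u)) \<le> \<bar>u - v\<bar> powr (\<gamma> * (1 + s)) * W u"
          by (intro mult_left_mono) (auto simp: W_def distrib_right)
        finally show ?thesis .
      qed
      then show ?case by blast
    qed
    show "indicator {0..\<tau>} t * \<sigma>' (X' t) = indicator {0..\<tau>} t * \<sigma>' (X t)" if "t \<in> {0<..<T}" for t
      using X'[of t] that by simp
    show "AE t in lborel. t \<in> {0<..<T} \<longrightarrow> indicator {0..\<tau>} t * \<sigma>' (X t) = indicator {0..\<tau>} t * F (X t)"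
      using fin
    proof eventually_elim
      case (elim t)
      have "\<sigma>' (X t) = F (X t)" if "t \<in> {0<..<T}"
      proof -
        have "emeasure \<mu> {X t} = 0" using V(2)[of t t] elim that by simp
        then show ?thesis by (intro \<sigma>'(2) isCont_F_no_atom)
      qed
      then show ?case by simp
    qed
  qed (use W0 isCont_X in \<open>auto simp: measurable_compose[OF X_measurable F_measurable] measurable_compose[OF X_measurable \<sigma>'(1)]\<close>)
  then show ?thesis using X'[OF \<tau>] X_0 by simp
qed

end

section \<open>Variability of the path\<close>

context rough_path
begin

lemma lborel_Icc_finite: "c < \<infinity> \<Longrightarrow> (\<integral>\<^sup>+t\<in>{0..T}. c \<partial>lborel) < (\<infinity>::ennreal)"
  using T_pos by (subst nn_integral_cmult_indicator) (auto simp: ennreal_mult_less_top)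

lemma potential_bound:
  assumes "c < \<infinity>" "\<And>t. t \<in> {0..T} \<Longrightarrow> (\<integral>\<^sup>+z\<in>E. riesz s (X t - z) \<partial>\<mu>) \<le> c"
  shows "(\<integral>\<^sup>+t\<in>{0..T}. (\<integral>\<^sup>+z\<in>E. riesz s (X t - z) \<partial>\<mu>) \<partial>lborel) < \<infinity>"
proof -
  have "(\<integral>\<^sup>+t\<in>{0..T}. (\<integral>\<^sup>+z\<in>E. riesz s (X t - z) \<partial>\<mu>) \<partial>lborel) \<le> (\<integral>\<^sup>+t\<in>{0..T}. c \<partial>lborel)"
    by (intro nn_integral_mono) (use assms(2) in \<open>auto simp: indicator_def\<close>)
  then show ?thesis using lborel_Icc_finite[OF assms(1)] by (rule order.strict_trans1)
qed

text \<open>In the first case the Lipschitz constant \<open>G\<close> of \<open>g\<close> replaces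
  the kernel between X t and \<open>z\<close> by the one between Z t and g z, whose integral is
  known to be finite. In the second case the potential is uniformly bounded.\<close>

lemma admissible_potential:
  assumes A: "A \<in> sets borel" "admissible A" and pq: "p \<le> q" "X ` {0..T} = {p..q}"
    and G: "0 < G" "\<And>x y. x \<in> {p..q} \<Longrightarrow> y \<in> {p..q} \<Longrightarrow> \<bar>g x - g y\<bar> \<le> G * \<bar>x - y\<bar>"
  shows "(\<integral>\<^sup>+t\<in>{0..T}. (\<integral>\<^sup>+z\<in>A \<inter> {p..q}. riesz s (X t - z) \<partial>\<mu>) \<partial>lborel) < \<infinity>"
proof (cases "bounded_potential T s Z (g ` A)")
  case True
  note [measurable] = A(1)
  have [measurable]: "(\<lambda>u. \<integral>\<^sup>+z\<in>A \<inter> {p..q}. riesz s (Z u - g z) \<partial>\<mu>) \<in> borel_measurable borel"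
    by (rule potential_measurable) auto
  have "(\<integral>\<^sup>+t\<in>{0..T}. (\<integral>\<^sup>+z\<in>A \<inter> {p..q}. riesz s (X t - z) \<partial>\<mu>) \<partial>lborel)
    \<le> (\<integral>\<^sup>+t. ennreal (G powr s) * ((\<integral>\<^sup>+z\<in>A \<inter> {p..q}. riesz s (Z t - g z) \<partial>\<mu>) * indicator {0..T} t) \<partial>lborel)"
  proof (rule nn_integral_mono)
    fix t
    show "(\<integral>\<^sup>+z\<in>A \<inter> {p..q}. riesz s (X t - z) \<partial>\<mu>) * indicator {0..T} t
      \<le> ennreal (G powr s) * ((\<integral>\<^sup>+z\<in>A \<inter> {p..q}. riesz s (Z t - g z) \<partial>\<mu>) * indicator {0..T} t)"
    proof (cases "t \<in> {0..T}")
      case t: True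
      then have Xt: "X t \<in> {p..q}" using pq(2) by blast
      have "(\<integral>\<^sup>+z\<in>A \<inter> {p..q}. riesz s (X t - z) \<partial>\<mu>)
          \<le> (\<integral>\<^sup>+z. ennreal (G powr s) * (riesz s (Z t - g z) * indicator (A \<inter> {p..q}) z) \<partial>\<mu>)"
      proof (rule nn_integral_mono)
        fix z
        show "riesz s (X t - z) * indicator (A \<inter> {p..q}) z \<le> ennreal (G powr s) * (riesz s (Z t - g z) * indicator (A \<inter> {p..q}) z)"
          using riesz_scale[OF s_pos G(1), of "Z t - g z" "X t - z"] G(2)[OF Xt, of z] by (auto simp: indicator_def)
      qed
      also have "\<dots> = ennreal (G powr s) * (\<integral>\<^sup>+z\<in>A \<inter> {p..q}. riesz s (Z t - g z) \<partial>\<mu>)"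
        by (rule nn_integral_cmult) measurable
      finally show ?thesis using t by simp
    qed simp
  qed
  also have "\<dots> = ennreal (G powr s) * (\<integral>\<^sup>+t\<in>{0..T}. (\<integral>\<^sup>+z\<in>A \<inter> {p..q}. riesz s (Z t - g z) \<partial>\<mu>) \<partial>lborel)"
    by (rule nn_integral_cmult) measurable
  also have "\<dots> < \<infinity>" using bounded_potential_integral[OF A(1) True pq(2)] by (simp add: ennreal_mult_less_top)
  finally show ?thesis .
next
  case False
  then obtain d c r\<^sub>0 where d: "s < d" and c: "0 < c" and r0: "0 < r\<^sub>0"
    and reg: "\<And>x r. x \<in> A \<Longrightarrow> x \<in> measure_support \<mu> \<Longrightarrow> 0 < r \<Longrightarrow> r < r\<^sub>0 \<Longrightarrow>
      emeasure \<mu> {x - r<..<x + r} \<le> ennreal (c * r powr d)"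
    using A(2) unfolding admissible_def by blast
  have A': "A \<inter> {p..q} \<in> sets borel" "A \<inter> {p..q} \<subseteq> {p..q}" using A by auto
  obtain c' where c': "c' < \<infinity>" "\<And>x. (\<integral>\<^sup>+z\<in>A \<inter> {p..q}. riesz s (x - z) \<partial>\<mu>) \<le> c'"
    by (rule regular_potential[OF A' c r0 s_pos d]) (use reg that in auto)
  then show ?thesis by (intro potential_bound) auto
qed

text \<open>
  Beyond an end point \<open>e\<close> of the range of \<open>X\<close> the kernel is dominated by the kernel at \<open>e\<close>.
\<close>

lemma admissible_end_potential:
  assumes adm: "admissible A" and e: "e \<in> A" "e \<in> X ` {0..T}"
    and E: "E \<in> sets borel" "E \<subseteq> {e - 1..e + 1}"
    and X: "\<And>t z. t \<in> {0..T} \<Longrightarrow> z \<in> E \<Longrightarrow> \<bar>e - z\<bar> \<le> \<bar>X t - z\<bar>"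
    and Z: "\<And>t z. t \<in> {0..T} \<Longrightarrow> z \<in> E \<Longrightarrow> \<bar>Z t - g e\<bar> \<le> \<bar>Z t - g z\<bar>"
    and G: "0 < G" "\<And>t z. t \<in> {0..T} \<Longrightarrow> z \<in> E \<Longrightarrow> \<bar>Z t - g z\<bar> \<le> G * \<bar>X t - z\<bar>"
  shows "\<exists>\<delta>>0. \<delta> \<le> 1 \<and> (\<integral>\<^sup>+t\<in>{0..T}. (\<integral>\<^sup>+z\<in>E \<inter> {e - \<delta><..<e + \<delta>}. riesz s (X t - z) \<partial>\<mu>) \<partial>lborel) < \<infinity>"
proof (cases "bounded_potential T s Z (g ` A)")
  case True
  note [measurable] = E(1)
  let ?J = "E \<inter> {e - 1<..<e + 1}"
  \<comment> \<open>\<open>e\<close> is a value of the path in \<open>A\<close>, so the supremum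
    covers the potential at g e; no other point is needed, as all points of \<open>E\<close> are
    compared with \<open>e\<close>.\<close>
  have "g e \<in> Z ` {0..T} \<inter> g ` A" using e by force
  then have "(\<integral>\<^sup>+t\<in>{0..T}. riesz s (Z t - g e) \<partial>lebesgue)
      \<le> (SUP x \<in> Z ` {0..T} \<inter> g ` A. (\<integral>\<^sup>+t\<in>{0..T}. riesz s (Z t - x) \<partial>lebesgue))" by (rule SUP_upper)
  also have "\<dots> < \<infinity>" using True unfolding bounded_potential_def .
  finally have fin: "(\<integral>\<^sup>+t\<in>{0..T}. riesz s (Z t - g e) \<partial>lborel) < \<infinity>" by (simp add: nn_integral_completion)
  have J: "emeasure \<mu> ?J < \<infinity>" by (rule finite_subset_Icc[of _ "e - 1" "e + 1"]) auto
  have "(\<integral>\<^sup>+t\<in>{0..T}. (\<integral>\<^sup>+z\<in>?J. riesz s (X t - z) \<partial>\<mu>) \<partial>lborel)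
    \<le> (\<integral>\<^sup>+t. ennreal (G powr s) * emeasure \<mu> ?J * (riesz s (Z t - g e) * indicator {0..T} t) \<partial>lborel)"
  proof (rule nn_integral_mono)
    fix t
    show "(\<integral>\<^sup>+z\<in>?J. riesz s (X t - z) \<partial>\<mu>) * indicator {0..T} t
      \<le> ennreal (G powr s) * emeasure \<mu> ?J * (riesz s (Z t - g e) * indicator {0..T} t)"
    proof (cases "t \<in> {0..T}")
      case t: True
      have "(\<integral>\<^sup>+z\<in>?J. riesz s (X t - z) \<partial>\<mu>) \<le> (\<integral>\<^sup>+z. ennreal (G powr s) * riesz s (Z t - g e) * indicator ?J z \<partial>\<mu>)"
      proof (rule nn_integral_mono)
        fix z
        have "riesz s (X t - z) \<le> ennreal (G powr s) * riesz s (Z t - g e)" if z: "z \<in> E"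
        proof -
          have "riesz s (X t - z) \<le> ennreal (G powr s) * riesz s (Z t - g z)"
            by (rule riesz_scale[OF s_pos G(1)]) (rule G(2)[OF t z])
          also have "\<dots> \<le> ennreal (G powr s) * riesz s (Z t - g e)"
            by (intro mult_left_mono riesz_antimono s_pos Z t z) simp
          finally show ?thesis .
        qed
        then show "riesz s (X t - z) * indicator ?J z \<le> ennreal (G powr s) * riesz s (Z t - g e) * indicator ?J z"
          by (auto simp: indicator_def)
      qed
      also have "\<dots> = ennreal (G powr s) * riesz s (Z t - g e) * emeasure \<mu> ?J"
        by (rule nn_integral_cmult_indicator) simp
      finally show ?thesis using t by (simp add: ac_simps)
    qed simp
  qed
  also have "\<dots> = ennreal (G powr s) * emeasure \<mu> ?J * (\<integral>\<^sup>+t\<in>{0..T}. riesz s (Z t - g e) \<partial>lborel)"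
    by (rule nn_integral_cmult) measurable
  also have "\<dots> < \<infinity>" using fin J by (simp add: ennreal_mult_less_top)
  finally show ?thesis by (intro exI[of _ 1]) simp
next
  case False
  then obtain d c r\<^sub>0 where d: "s < d" and c: "0 < c" and r0: "0 < r\<^sub>0"
    and reg: "\<And>x r. x \<in> A \<Longrightarrow> x \<in> measure_support \<mu> \<Longrightarrow> 0 < r \<Longrightarrow> r < r\<^sub>0 \<Longrightarrow>
      emeasure \<mu> {x - r<..<x + r} \<le> ennreal (c * r powr d)"
    using adm unfolding admissible_def by blast
  show ?thesis
  \<comment> \<open>\<open>E\<close> may lie outside \<open>A\<close>, so regularity can be used at
    \<open>e\<close> only. If \<open>e\<close> is in the support, growth about \<open>e\<close>
    bounds the potential at \<open>e\<close>, which dominates the potential at X t; otherwise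
    \<open>e\<close> has a null neighbourhood, and this is where \<delta> may have to be
    small.\<close>
  proof (cases "e \<in> measure_support \<mu>")
    case True
    have E': "E \<inter> {e - 1<..<e + 1} \<in> sets borel" "E \<inter> {e - 1<..<e + 1} \<subseteq> {e - 1..e + 1}" using E by auto
    \<comment> \<open>The closed interval of radius r about \<open>e\<close> lies in the open one of
      radius 2 r, which accounts for \<open>2 powr d\<close> and
      \<open>r\<^sub>0 / 2\<close>.\<close>
    obtain c' where c': "c' < \<infinity>" "\<And>x A. A \<in> sets borel \<Longrightarrow> A \<subseteq> {e - 1..e + 1} \<Longrightarrow>
      (\<And>r. 0 \<le> r \<Longrightarrow> r < r\<^sub>0 / 2 \<Longrightarrow> emeasure \<mu> (A \<inter> {x - r..x + r}) \<le> ennreal (c * 2 powr d * r powr d)) \<Longrightarrow>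
      (\<integral>\<^sup>+z\<in>A. riesz s (x - z) \<partial>\<mu>) \<le> c'"
      using growth_potential[of "c * 2 powr d" "r\<^sub>0 / 2" s d "e - 1" "e + 1"] c r0 s_pos d by (auto simp: mult.assoc)
    have atom: "emeasure \<mu> {e} = 0"
    proof -
      have "emeasure \<mu> ({e} \<inter> {e..e}) \<le> ennreal (c * (2 * (e - e)) powr d)"
        by (rule regular_interval[OF _ c r0]) (use reg e r0 d s_pos in auto)
      then show ?thesis by simp
    qed
    have "(\<integral>\<^sup>+z\<in>E \<inter> {e - 1<..<e + 1}. riesz s (e - z) \<partial>\<mu>) \<le> c'"
    proof (rule c'(2)[OF E'])
      fix r :: real assume r: "0 \<le> r" "r < r\<^sub>0 / 2"
      show "emeasure \<mu> (E \<inter> {e - 1<..<e + 1} \<inter> {e - r..e + r}) \<le> ennreal (c * 2 powr d * r powr d)"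
      proof (cases "r = 0")
        case True
        have "emeasure \<mu> (E \<inter> {e - 1<..<e + 1} \<inter> {e - r..e + r}) \<le> emeasure \<mu> {e}"
          by (rule emeasure_mono) (use True in auto)
        then show ?thesis using atom by simp
      next
        case False
        have "emeasure \<mu> (E \<inter> {e - 1<..<e + 1} \<inter> {e - r..e + r}) \<le> emeasure \<mu> {e - 2 * r<..<e + 2 * r}"
          by (rule emeasure_mono) (use False r in auto)
        also have "\<dots> \<le> ennreal (c * (2 * r) powr d)" by (rule reg) (use e True r False in auto)
        also have "c * (2 * r) powr d = c * 2 powr d * r powr d" using r by (simp add: powr_mult)
        finally show ?thesis .
      qed
    qed
    then have b: "(\<integral>\<^sup>+z\<in>E \<inter> {e - 1<..<e + 1}. riesz s (X t - z) \<partial>\<mu>) \<le> c'" if t: "t \<in> {0..T}" for t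
    proof -
      have "(\<integral>\<^sup>+z\<in>E \<inter> {e - 1<..<e + 1}. riesz s (X t - z) \<partial>\<mu>) \<le> (\<integral>\<^sup>+z\<in>E \<inter> {e - 1<..<e + 1}. riesz s (e - z) \<partial>\<mu>)"
        by (intro nn_integral_mono) (auto simp: indicator_def intro!: riesz_antimono s_pos X t)
      also have "\<dots> \<le> c'" by fact
      finally show ?thesis .
    qed
    show ?thesis using potential_bound[OF c'(1) b] by (intro exI[of _ 1]) simp
  next
    case False
    then obtain U where U: "open U" "e \<in> U" "emeasure \<mu> U = 0"
      unfolding measure_support_def by (auto simp: zero_less_iff_neq_zero)
    then obtain \<delta> where \<delta>: "0 < \<delta>" "ball e \<delta> \<subseteq> U" by (meson open_contains_ball)
    define \<delta>' where "\<delta>' = min 1 \<delta>"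
    have sub: "E \<inter> {e - \<delta>'<..<e + \<delta>'} \<subseteq> U" using \<delta> by (auto simp: \<delta>'_def ball_def dist_real_def subset_iff)
    have "U \<in> null_sets \<mu>" using U by (auto simp: null_sets_def)
    then have "E \<inter> {e - \<delta>'<..<e + \<delta>'} \<in> null_sets \<mu>"
      by (rule null_sets_subset[OF _ _ sub]) (use E in auto)
    then have ae: "AE z in \<mu>. z \<notin> E \<inter> {e - \<delta>'<..<e + \<delta>'}" by (rule AE_not_in)
    have "(\<integral>\<^sup>+z\<in>E \<inter> {e - \<delta>'<..<e + \<delta>'}. riesz s (X t - z) \<partial>\<mu>) = (\<integral>\<^sup>+z. 0 \<partial>\<mu>)" for t
      by (rule nn_integral_cong_AE, rule eventually_mono[OF ae]) simp
    then show ?thesis using \<delta> by (intro exI[of _ \<delta>']) (simp add: \<delta>'_def)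
  qed
qed

lemma potential_union:
  assumes [measurable]: "A \<in> sets borel" "B \<in> sets borel"
    and "(\<integral>\<^sup>+t\<in>{0..T}. (\<integral>\<^sup>+z\<in>A. riesz s (X t - z) \<partial>\<mu>) \<partial>lborel) < \<infinity>"
    and "(\<integral>\<^sup>+t\<in>{0..T}. (\<integral>\<^sup>+z\<in>B. riesz s (X t - z) \<partial>\<mu>) \<partial>lborel) < \<infinity>"
  shows "(\<integral>\<^sup>+t\<in>{0..T}. (\<integral>\<^sup>+z\<in>A \<union> B. riesz s (X t - z) \<partial>\<mu>) \<partial>lborel) < \<infinity>"
proof -
  have [measurable]: "(\<lambda>u. \<integral>\<^sup>+z\<in>D. riesz s (X u - z) \<partial>\<mu>) \<in> borel_measurable borel" if "D \<in> sets borel" for D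
    by (rule potential_measurable) (use that in auto)
  have "(\<integral>\<^sup>+t\<in>{0..T}. (\<integral>\<^sup>+z\<in>A \<union> B. riesz s (X t - z) \<partial>\<mu>) \<partial>lborel)
    \<le> (\<integral>\<^sup>+t. (\<integral>\<^sup>+z\<in>A. riesz s (X t - z) \<partial>\<mu>) * indicator {0..T} t + (\<integral>\<^sup>+z\<in>B. riesz s (X t - z) \<partial>\<mu>) * indicator {0..T} t \<partial>lborel)"
  proof (rule nn_integral_mono)
    fix t
    have "(\<integral>\<^sup>+z\<in>A \<union> B. riesz s (X t - z) \<partial>\<mu>) \<le> (\<integral>\<^sup>+z. riesz s (X t - z) * indicator A z + riesz s (X t - z) * indicator B z \<partial>\<mu>)"
      by (intro nn_integral_mono) (auto simp: indicator_def)
    also have "\<dots> = (\<integral>\<^sup>+z\<in>A. riesz s (X t - z) \<partial>\<mu>) + (\<integral>\<^sup>+z\<in>B. riesz s (X t - z) \<partial>\<mu>)"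
      by (rule nn_integral_add) measurable
    finally show "(\<integral>\<^sup>+z\<in>A \<union> B. riesz s (X t - z) \<partial>\<mu>) * indicator {0..T} t
        \<le> (\<integral>\<^sup>+z\<in>A. riesz s (X t - z) \<partial>\<mu>) * indicator {0..T} t + (\<integral>\<^sup>+z\<in>B. riesz s (X t - z) \<partial>\<mu>) * indicator {0..T} t"
      by (auto simp: indicator_def)
  qed
  also have "\<dots> = (\<integral>\<^sup>+t\<in>{0..T}. (\<integral>\<^sup>+z\<in>A. riesz s (X t - z) \<partial>\<mu>) \<partial>lborel) + (\<integral>\<^sup>+t\<in>{0..T}. (\<integral>\<^sup>+z\<in>B. riesz s (X t - z) \<partial>\<mu>) \<partial>lborel)"
    by (rule nn_integral_add) measurable
  finally show ?thesis using assms(3,4) by (auto intro: order.strict_trans1)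
qed

text \<open>Variability asks for an open neighbourhood of the range [p, q], whereas the hypotheses
  on potentials concern values of the path only. So the range is treated by itself and two one-sided
  neighbourhoods of \<open>p\<close> and \<open>q\<close> are added.\<close>

lemma path_potential:
  assumes A: "A \<in> sets borel" "admissible A" "admissible (- A)"
    and lip: "\<And>a b. \<exists>G>0. \<forall>x\<in>{a..b}. \<forall>y\<in>{a..b}. \<bar>g x - g y\<bar> \<le> G * \<bar>x - y\<bar>"
  obtains U where "open U" "compact (closure U)" "X ` {0..T} \<subseteq> U"
    "(\<integral>\<^sup>+t\<in>{0..T}. (\<integral>\<^sup>+z\<in>U. riesz s (X t - z) \<partial>\<mu>) \<partial>lborel) < \<infinity>"
proof -
  obtain p q where pq: "p \<le> q" "X ` {0..T} = {p..q}" "\<And>u. X u \<in> {p..q}" by (rule range_X) (rule that)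
  obtain G where G: "0 < G" "\<And>x y. x \<in> {p - 1..q + 1} \<Longrightarrow> y \<in> {p - 1..q + 1} \<Longrightarrow> \<bar>g x - g y\<bar> \<le> G * \<bar>x - y\<bar>"
    using lip[of "p - 1" "q + 1"] by blast
  have nA: "- A \<in> sets borel" using A by auto
  have G': "\<bar>g x - g y\<bar> \<le> G * \<bar>x - y\<bar>" if "x \<in> {p..q}" "y \<in> {p..q}" for x y using G(2)[of x y] that by auto
  have mid: "(\<integral>\<^sup>+t\<in>{0..T}. (\<integral>\<^sup>+z\<in>(A \<inter> {p..q}) \<union> (- A \<inter> {p..q}). riesz s (X t - z) \<partial>\<mu>) \<partial>lborel) < \<infinity>"
    by (intro potential_union admissible_potential[OF A(1,2) pq(1,2) G(1) G']
        admissible_potential[OF nA A(3) pq(1,2) G(1) G']) (use A in auto)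
  have "(A \<inter> {p..q}) \<union> (- A \<inter> {p..q}) = {p..q}" by auto
  with mid have mid: "(\<integral>\<^sup>+t\<in>{0..T}. (\<integral>\<^sup>+z\<in>{p..q}. riesz s (X t - z) \<partial>\<mu>) \<partial>lborel) < \<infinity>" by simp
  have ends: "\<exists>\<delta>>0. \<delta> \<le> 1 \<and> (\<integral>\<^sup>+t\<in>{0..T}. (\<integral>\<^sup>+z\<in>E \<inter> {e - \<delta><..<e + \<delta>}. riesz s (X t - z) \<partial>\<mu>) \<partial>lborel) < \<infinity>"
    if e: "e = p \<and> E = {p - 1..<p} \<or> e = q \<and> E = {q<..q + 1}" for e E
  proof -
    have eX: "e \<in> X ` {0..T}" using e pq by auto
    have E: "E \<in> sets borel" "E \<subseteq> {e - 1..e + 1}" using e by auto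
    have x: "\<bar>e - z\<bar> \<le> \<bar>X t - z\<bar>" if "t \<in> {0..T}" "z \<in> E" for t z
      using e that(2) pq(3)[of t] by auto
    have z: "\<bar>Z t - g e\<bar> \<le> \<bar>Z t - g z\<bar>" if "t \<in> {0..T}" "z \<in> E" for t z
      using e
    proof
      assume e: "e = p \<and> E = {p - 1..<p}"
      then have "g z \<le> g e" "g e \<le> g (X t)" using that(2) pq(3)[of t] unfolding g_mono by auto
      then show ?thesis by simp
    next
      assume e: "e = q \<and> E = {q<..q + 1}"
      then have "g e \<le> g z" "g (X t) \<le> g e" using that(2) pq(3)[of t] unfolding g_mono by auto
      then show ?thesis by simp
    qed
    have gg: "\<bar>Z t - g z\<bar> \<le> G * \<bar>X t - z\<bar>" if "t \<in> {0..T}" "z \<in> E" for t z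
      using G(2)[of "X t" z] e that(2) pq(1) pq(3)[of t] by auto
    show ?thesis
    \<comment> \<open>The hypothesis used beyond an end point is that of the set containing this end
      point, even if the points beyond belong to the other set.\<close>
    proof (cases "e \<in> A")
      case True
      show ?thesis by (rule admissible_end_potential[OF A(2) True eX E x z G(1) gg])
    next
      case False
      then have "e \<in> - A" by simp
      from admissible_end_potential[OF A(3) this eX E x z G(1) gg] show ?thesis .
    qed
  qed
  obtain \<delta>1 where d1: "0 < \<delta>1" "\<delta>1 \<le> 1"
    "(\<integral>\<^sup>+t\<in>{0..T}. (\<integral>\<^sup>+z\<in>{p - 1..<p} \<inter> {p - \<delta>1<..<p + \<delta>1}. riesz s (X t - z) \<partial>\<mu>) \<partial>lborel) < \<infinity>"
    using ends[of p "{p - 1..<p}"] by auto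
  obtain \<delta>2 where d2: "0 < \<delta>2" "\<delta>2 \<le> 1"
    "(\<integral>\<^sup>+t\<in>{0..T}. (\<integral>\<^sup>+z\<in>{q<..q + 1} \<inter> {q - \<delta>2<..<q + \<delta>2}. riesz s (X t - z) \<partial>\<mu>) \<partial>lborel) < \<infinity>"
    using ends[of q "{q<..q + 1}"] by auto
  show thesis
  proof (rule that[of "{p - \<delta>1<..<q + \<delta>2}"])
    show "X ` {0..T} \<subseteq> {p - \<delta>1<..<q + \<delta>2}" using pq d1 d2 by auto
    have "({p - 1..<p} \<inter> {p - \<delta>1<..<p + \<delta>1}) \<union> ({p..q} \<union> ({q<..q + 1} \<inter> {q - \<delta>2<..<q + \<delta>2})) = {p - \<delta>1<..<q + \<delta>2}"
      using pq(1) d1(1,2) d2(1,2) by auto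
    moreover have "(\<integral>\<^sup>+t\<in>{0..T}. (\<integral>\<^sup>+z\<in>({p - 1..<p} \<inter> {p - \<delta>1<..<p + \<delta>1}) \<union> ({p..q} \<union> ({q<..q + 1} \<inter> {q - \<delta>2<..<q + \<delta>2})).
        riesz s (X t - z) \<partial>\<mu>) \<partial>lborel) < \<infinity>"
      by (intro potential_union mid d1(3) d2(3)) auto
    ultimately show "(\<integral>\<^sup>+t\<in>{0..T}. (\<integral>\<^sup>+z\<in>{p - \<delta>1<..<q + \<delta>2}. riesz s (X t - z) \<partial>\<mu>) \<partial>lborel) < \<infinity>" by simp
  qed (auto simp: compact_closure)
qed

lemma holder_on_path: "holder_on \<gamma> {0..T} X"
proof -
  obtain H where H: "0 < H" "\<And>u v. \<bar>Z u - Z v\<bar> \<le> H * \<bar>u - v\<bar> powr \<gamma>" by (rule Z_holder) (rule that)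
  have "\<bar>X u - X v\<bar> \<le> (C * H) * \<bar>u - v\<bar> powr \<gamma>" for u v
  proof -
    have "\<bar>X u - X v\<bar> \<le> C * \<bar>Z u - Z v\<bar>"
      using lipschitz_onD[OF lipschitz_f, of "Z u" "Z v"] by (simp add: X_def dist_real_def)
    also have "\<dots> \<le> C * (H * \<bar>u - v\<bar> powr \<gamma>)" using H C_pos by (intro mult_left_mono) auto
    finally show ?thesis by (simp add: mult.assoc)
  qed
  then show ?thesis unfolding holder_on_def by blast
qed

end

text \<open>\<open>F\<close> is continuous wherever the monotone function
  \<open>stieltjes \<mu>\<close> is, and that fails at countably many points only.\<close>

lemma isCont_of_variation_bound:
  assumes "radon_measure \<mu>" and F: "\<And>x y. x \<le> y \<Longrightarrow> \<bar>F y - F x\<bar> \<le> measure \<mu> {x<..y}"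
  shows "AE x in lborel. isCont F x"
proof -
  interpret radon_measure \<mu> by fact
  have "countable {x. \<not> isCont (stieltjes \<mu>) x}" by (rule mono_ctble_discont[OF mono_stieltjes])
  then have "{x. \<not> isCont (stieltjes \<mu>) x} \<in> null_sets lborel" by (rule countable_imp_null_set_lborel)
  then have "AE x in lborel. x \<notin> {x. \<not> isCont (stieltjes \<mu>) x}" by (rule AE_not_in)
  then show ?thesis
  proof eventually_elim
    case (elim x)
    then have lim: "((\<lambda>y. \<bar>stieltjes \<mu> y - stieltjes \<mu> x\<bar>) \<longlongrightarrow> 0) (at x)"
      unfolding isCont_def by (intro tendsto_rabs_zero) (simp add: LIM_zero)
    have le: "\<bar>F y - F x\<bar> \<le> \<bar>stieltjes \<mu> y - stieltjes \<mu> x\<bar>" for y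
      using F[of x y] F[of y x] stieltjes_diff[of x y] stieltjes_diff[of y x] by (cases "x \<le> y") auto
    have "((\<lambda>y. F y - F x) \<longlongrightarrow> 0) (at x)"
      by (rule Lim_null_comparison[OF _ lim]) (simp add: le)
    then show ?case unfolding isCont_def by (simp add: LIM_zero_iff)
  qed
qed

text \<open>Forces every Lebesgue representative of \<sigma> to coincide with \<open>F\<close> at
  the continuity points of \<open>F\<close>.\<close>

lemma approx_limit_of_isCont:
  assumes \<sigma>: "\<sigma> \<in> borel_measurable lebesgue" and [measurable]: "F \<in> borel_measurable borel"
    and eq: "AE x in lborel. \<sigma> x = F x" and cont: "isCont F x"
  shows "approx_limit \<sigma> x (F x)"
  unfolding approx_limit_def
proof (rule tendstoI)
  fix e :: real assume "0 < e"
  obtain \<delta> where \<delta>: "0 < \<delta>" "\<And>y. \<bar>y - x\<bar> < \<delta> \<Longrightarrow> \<bar>F y - F x\<bar> < e / 2"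
    using cont \<open>0 < e\<close> unfolding continuous_at_eps_delta by (auto simp: dist_real_def dest: spec[of _ "e / 2"])
  have "dist (1 / (2 * r) * (LINT y:{x - r..x + r}|lebesgue. \<bar>\<sigma> y - F x\<bar>)) 0 < e" if r: "0 < r" "r < \<delta>" for r
  proof -
    have "(LINT y:{x - r..x + r}|lebesgue. \<bar>\<sigma> y - F x\<bar>) = (LINT y:{x - r..x + r}|lebesgue. \<bar>F y - F x\<bar>)"
      unfolding set_lebesgue_integral_def
    proof (rule integral_cong_AE)
      show "AE y in lebesgue. indicator {x - r..x + r} y *\<^sub>R \<bar>\<sigma> y - F x\<bar> = indicator {x - r..x + r} y *\<^sub>R \<bar>F y - F x\<bar>"
        using AE_completion[OF eq] by eventually_elim simp
      have "F \<in> borel_measurable lebesgue" using measurable_completion[of F lborel borel] by simp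
      then show "(\<lambda>y. indicator {x - r..x + r} y *\<^sub>R \<bar>F y - F x\<bar>) \<in> borel_measurable lebesgue"
        by (intro borel_measurable_scaleR borel_measurable_indicator borel_measurable_abs borel_measurable_diff) auto
      show "(\<lambda>y. indicator {x - r..x + r} y *\<^sub>R \<bar>\<sigma> y - F x\<bar>) \<in> borel_measurable lebesgue"
        using \<sigma> by (intro borel_measurable_scaleR borel_measurable_indicator borel_measurable_abs borel_measurable_diff) auto
    qed
    also have "\<dots> = (LBINT y. indicator {x - r..x + r} y *\<^sub>R \<bar>F y - F x\<bar>)"
      unfolding set_lebesgue_integral_def by (rule integral_completion) measurable
    finally have i: "(LINT y:{x - r..x + r}|lebesgue. \<bar>\<sigma> y - F x\<bar>) = (LBINT y. indicator {x - r..x + r} y *\<^sub>R \<bar>F y - F x\<bar>)" .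
    have ic: "integrable lborel (\<lambda>y. e / 2 * indicator {x - r..x + r} y)"
      by (intro integrable_mult_right integrable_real_indicator) (use r in auto)
    have le: "indicator {x - r..x + r} y *\<^sub>R \<bar>F y - F x\<bar> \<le> e / 2 * indicator {x - r..x + r} y" for y
    proof (cases "y \<in> {x - r..x + r}")
      case True
      then have "\<bar>y - x\<bar> < \<delta>" using r by (auto simp: abs_less_iff)
      then show ?thesis using \<delta>(2)[of y] True by simp
    qed simp
    have "integrable lborel (\<lambda>y. indicator {x - r..x + r} y *\<^sub>R \<bar>F y - F x\<bar>)"
      by (rule Bochner_Integration.integrable_bound[OF ic])
         (use le \<open>0 < e\<close> in \<open>auto simp: abs_mult indicator_def\<close>)
    then have "(LBINT y. indicator {x - r..x + r} y *\<^sub>R \<bar>F y - F x\<bar>) \<le> (LBINT y. e / 2 * indicator {x - r..x + r} y)"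
      by (rule integral_mono[OF _ ic le])
    also have "\<dots> = e * r" using r by simp
    finally have "(LBINT y. indicator {x - r..x + r} y *\<^sub>R \<bar>F y - F x\<bar>) \<le> e * r" .
    moreover have "0 \<le> (LBINT y. indicator {x - r..x + r} y *\<^sub>R \<bar>F y - F x\<bar>)"
      by (rule integral_nonneg_AE) simp
    ultimately have "\<bar>1 / (2 * r) * (LBINT y. indicator {x - r..x + r} y *\<^sub>R \<bar>F y - F x\<bar>)\<bar> \<le> 1 / (2 * r) * (e * r)"
      using r unfolding abs_mult by (intro mult_mono) auto
    also have "\<dots> < e" using r \<open>0 < e\<close> by simp
    finally show ?thesis using i by (simp add: dist_real_def)
  qed
  then show "\<forall>\<^sub>F r in at_right 0. dist (1 / (2 * r) * (LINT y:{x - r..x + r}|lebesgue. \<bar>\<sigma> y - F x\<bar>)) 0 < e"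
    using \<delta>(1) by (auto simp: eventually_at_right_field)
qed

text \<open>\<open>F\<close> is bounded by \<open>C\<close>, so \<open>g\<close> grows at least
  linearly and its limits at both ends are infinite. An infinite \<open>a\<close> or
  \<open>b\<close> thus imposes no constraint on either side.\<close>

lemma (in reciprocal_primitive)
  shows less_ext_value: "ext_value g a < ereal (g z) \<longleftrightarrow> a < ereal z"
    and ext_value_less: "ereal (g z) < ext_value g a \<longleftrightarrow> ereal z < a"
proof -
  have lower: "g 0 + x / C \<le> g x" if "0 \<le> x" for x using g_diff_ge[OF that] by simp
  have upper: "g x \<le> g 0 + x / C" if "x \<le> 0" for x using g_diff_ge[OF that] by simp
  have "filterlim g at_top at_top"
    unfolding filterlim_at_top
  proof
    fix r :: real
    show "\<forall>\<^sub>F x in at_top. r \<le> g x"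
    proof (rule eventually_mono)
      show "\<forall>\<^sub>F x in at_top. max 0 (C * (r - g 0)) \<le> x" by (rule eventually_ge_at_top)
      fix x assume x: "max 0 (C * (r - g 0)) \<le> x"
      then have "r - g 0 \<le> x / C" using C_pos by (simp add: field_simps)
      then show "r \<le> g x" using lower[of x] x by simp
    qed
  qed
  then have "((\<lambda>x. ereal (g x)) \<longlongrightarrow> \<infinity>) at_top" by (simp add: tendsto_PInfty_eq_at_top)
  then have top: "Lim at_top (\<lambda>x. ereal (g x)) = \<infinity>" by (intro tendsto_Lim) auto
  have "((\<lambda>x. ereal (g x)) \<longlongrightarrow> - \<infinity>) at_bot"
    unfolding tendsto_MInfty
  proof
    fix r :: real
    show "\<forall>\<^sub>F x in at_bot. ereal (g x) < ereal r"
    proof (rule eventually_mono)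
      show "\<forall>\<^sub>F x in at_bot. x < min 0 (C * (r - g 0))" by (rule eventually_gt_at_bot)
      fix x assume x: "x < min 0 (C * (r - g 0))"
      then have "x / C < r - g 0" using C_pos by (simp add: field_simps)
      then show "ereal (g x) < ereal r" using upper[of x] x by simp
    qed
  qed
  then have bot: "Lim at_bot (\<lambda>x. ereal (g x)) = - \<infinity>" by (intro tendsto_Lim) auto
  show "ext_value g a < ereal (g z) \<longleftrightarrow> a < ereal z"
    using top bot strict_mono_less[OF strict_mono_g] by (cases a) (auto simp: ext_value_def)
  show "ereal (g z) < ext_value g a \<longleftrightarrow> ereal z < a"
    using top bot strict_mono_less[OF strict_mono_g] by (cases a) (auto simp: ext_value_def)
qed

lemma (in reciprocal_primitive) einterval_ext_value:
  "einterval (ext_value g a) (ext_value g b) = g ` einterval a b"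
proof (intro equalityI subsetI)
  fix y assume "y \<in> einterval (ext_value g a) (ext_value g b)"
  then have "f y \<in> einterval a b"
    using less_ext_value[of a "f y"] ext_value_less[of "f y" b] by (simp add: einterval_def)
  then have "g (f y) \<in> g ` einterval a b" by (rule imageI)
  then show "y \<in> g ` einterval a b" by simp
qed (auto simp: einterval_def less_ext_value ext_value_less)

lemma (in reciprocal_primitive) g_lipschitz_on_Icc:
  assumes "AE x in lborel. x \<in> {a..b} \<longrightarrow> 1 / F x \<le> G" "x \<in> {a..b}" "y \<in> {a..b}" "0 \<le> G"
  shows "\<bar>g x - g y\<bar> \<le> G * \<bar>x - y\<bar>"
proof -
  have *: "g v - g u \<le> G * (v - u)" if uv: "u \<le> v" "a \<le> u" "v \<le> b" for u v
  proof -
    have "g v - g u = (LBINT z:{u<..v}. 1 / F z)" by (rule g_diff[OF uv(1)])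
    also have "\<dots> \<le> (LBINT z:{u<..v}. G)"
      by (rule set_integral_mono_AE[OF set_integrable_Ioc set_integrable_const])
         (rule eventually_mono[OF assms(1)], use uv in auto)
    also have "\<dots> = G * (v - u)" using integral_const[OF uv(1), of G] by simp
    finally show ?thesis .
  qed
  have "g x \<le> g y \<longleftrightarrow> x \<le> y" using strict_mono_g by (rule strict_mono_less_eq)
  then show ?thesis using *[of x y] *[of y x] assms(2,3) by (cases "x \<le> y") (auto simp: abs_if)
qed

text \<open>\<open>g\<close> is given as a signed interval integral of 1 / \<sigma> over open
  intervals with respect to \<open>lebesgue\<close>. It is recast in terms of increments of 1 / F
  over half-open intervals with respect to \<open>lborel\<close>, which add up without gaps or
  overlaps.\<close>

lemma reciprocal_primitiveI:
  fixes \<sigma> F g :: "real \<Rightarrow> real"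
  assumes [measurable]: "F \<in> borel_measurable borel" and eq: "AE x in lborel. \<sigma> x = F x"
    and Linf: "Linfty \<sigma>" and nn: "AE x in lebesgue. 0 \<le> \<sigma> x" and rec: "recip_L1_loc \<sigma>"
    and g: "g = (\<lambda>x. LINT z=0..ereal x|lebesgue. (1 / \<sigma> z))"
  obtains C where "reciprocal_primitive F g C"
proof -
  obtain C where "AE x in lebesgue. \<bar>\<sigma> x\<bar> \<le> C" and \<sigma>: "\<sigma> \<in> borel_measurable lebesgue"
    using Linf unfolding Linfty_def by blast
  then have C: "AE x in lborel. \<bar>\<sigma> x\<bar> \<le> C" by (simp add: AE_completion_iff)
  have nn': "AE x in lborel. 0 \<le> \<sigma> x" using nn by (simp add: AE_completion_iff)
  have nz: "AE x in lborel. \<sigma> x \<noteq> 0" using rec by (simp add: recip_L1_loc_def AE_completion_iff)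
  have F\<sigma>: "AE x in lebesgue. 1 / \<sigma> x = 1 / F x" using AE_completion[OF eq] by eventually_elim simp
  have Fm: "(\<lambda>x. 1 / F x) \<in> borel_measurable lebesgue" using measurable_completion[of "\<lambda>x. 1 / F x" lborel borel] by simp
  have \<sigma>m: "(\<lambda>x. 1 / \<sigma> x) \<in> borel_measurable lebesgue" using \<sigma> by measurable
  have eqi: "(LINT z:A|lebesgue. 1 / \<sigma> z) = (LBINT z:A. 1 / F z)" if [measurable]: "A \<in> sets borel" for A
  proof -
    have "(LINT z:A|lebesgue. 1 / \<sigma> z) = (LINT z:A|lebesgue. 1 / F z)"
      unfolding set_lebesgue_integral_def
    proof (rule integral_cong_AE)
      show "AE z in lebesgue. indicator A z *\<^sub>R (1 / \<sigma> z) = indicator A z *\<^sub>R (1 / F z)"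
        using F\<sigma> by eventually_elim simp
    qed (intro borel_measurable_scaleR borel_measurable_indicator Fm \<sigma>m, simp)+
    also have "\<dots> = (LBINT z:A. 1 / F z)"
      unfolding set_lebesgue_integral_def by (rule integral_completion) measurable
    finally show ?thesis .
  qed
  have int: "set_integrable lborel {-R..R} (\<lambda>x. 1 / F x)" for R :: real
  proof -
    have "set_integrable lebesgue {-R..R} (\<lambda>x. 1 / \<sigma> x)" using rec by (auto simp: recip_L1_loc_def L1_loc_def)
    then have "integrable lebesgue (\<lambda>x. indicator {-R..R} x *\<^sub>R (1 / \<sigma> x))" by (simp add: set_integrable_def)
    then have "integrable lebesgue (\<lambda>x. indicator {-R..R} x *\<^sub>R (1 / F x))"
    proof (rule integrable_cong_AE_imp)
      show "AE x in lebesgue. indicator {-R..R} x *\<^sub>R (1 / \<sigma> x) = indicator {-R..R} x *\<^sub>R (1 / F x)"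
        using F\<sigma> by eventually_elim simp
    qed (intro borel_measurable_scaleR borel_measurable_indicator Fm, simp)
    then show ?thesis unfolding set_integrable_def by (subst (asm) integrable_completion) auto
  qed
  define J where "J = (\<lambda>a b. LBINT z:{a<..b}. 1 / F z)"
  have Ioc: "set_integrable lborel {a<..b} (\<lambda>x. 1 / F x)" for a b
    by (rule set_integrable_subset[OF int[of "max \<bar>a\<bar> \<bar>b\<bar>"]]) auto
  have J_add: "J a c = J a b + J b c" if "a \<le> b" "b \<le> c" for a b c
  proof -
    have "{a<..c} = {a<..b} \<union> {b<..c}" using that by auto
    then show ?thesis unfolding J_def using set_integral_Un[OF _ Ioc Ioc, of a b b c] by auto
  qed
  have J_Ioo: "(LBINT z:{a<..<b}. 1 / F z) = J a b" for a b
    unfolding J_def set_lebesgue_integral_def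
  proof (rule integral_cong_AE)
    show "AE z in lborel. indicator {a<..<b} z *\<^sub>R (1 / F z) = indicator {a<..b} z *\<^sub>R (1 / F z)"
      using AE_lborel_singleton[of b] by eventually_elim (auto simp: indicator_def)
  qed measurable
  have g0: "g x = (if 0 \<le> x then J 0 x else - J x 0)" for x
    unfolding g interval_lebesgue_integral_def zero_ereal_def by (simp add: eqi J_Ioo)
  have "g y - g x = J x y" if "x \<le> y" for x y
    using that J_add[of x 0 y] J_add[of 0 x y] J_add[of x y 0] by (auto simp: g0)
  then have "reciprocal_primitive F g C"
  proof (unfold_locales, goal_cases)
    case 2 show ?case using nn' nz eq by eventually_elim simp
  next
    case 3 show ?case using C eq by eventually_elim simp
  qed (use int in \<open>auto simp: J_def\<close>)
  then show thesis by (rule that)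
qed

section \<open>Existence of variability solutions\<close>

theorem theorem3p8:
  fixes T :: real and \<sigma> g f :: "real \<Rightarrow> real"
  assumes "T > 0"
    and "BV_loc \<sigma>" and "Linfty \<sigma>"
    and "AE x in lebesgue. 0 \<le> \<sigma> x"
    and "recip_L1_loc \<sigma>"
    and "g = (\<lambda>x. LINT z=0..ereal x|lebesgue. (1 / \<sigma> z))"
    and "f = inv g"
  shows "(abs_continuous g \<and> strict_mono g \<and> bij g \<and>
      (\<exists>L. L-lipschitz_on UNIV f) \<and>
      (AE y in lebesgue. (f has_real_derivative \<sigma> (f y)) (at y)) \<and>
      (\<forall>\<sigma>'. lebesgue_representative \<sigma> \<sigma>' \<longrightarrow>
        (AE y in lebesgue. (f has_real_derivative \<sigma>' (f y)) (at y)))) \<and>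
    (\<forall>(s::real) (\<gamma>::real) (Y::real \<Rightarrow> real) (x\<^sub>0::real) (a::ereal) (b::ereal) (X::real \<Rightarrow> real).
      0 < s \<longrightarrow> s < 1 \<longrightarrow> 1 / (1 + s) < \<gamma> \<longrightarrow> \<gamma> < 1 \<longrightarrow>
      holder_on \<gamma> {0..T} Y \<longrightarrow> Y 0 = 0 \<longrightarrow> a < b \<longrightarrow>
      bounded_potential T s (\<lambda>t. Y t + g x\<^sub>0) (einterval (ext_value g a) (ext_value g b)) \<or>
        (\<exists>d>s. upper_regular d \<sigma> (einterval a b)) \<longrightarrow>
      bounded_potential T s (\<lambda>t. Y t + g x\<^sub>0) (- einterval (ext_value g a) (ext_value g b)) \<or>
        (\<exists>d>s. upper_regular d \<sigma> (- einterval a b)) \<longrightarrow>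
      (\<forall>t\<in>{0..T}. X t = f (Y t + g x\<^sub>0)) \<longrightarrow>
      holder_on \<gamma> {0..T} X \<and> solves T \<sigma> Y x\<^sub>0 X \<and>
      (recip_Linfty_loc \<sigma> \<longrightarrow>
        X \<in> variable T \<sigma> s \<and> variability_solution T \<sigma> \<gamma> Y x\<^sub>0 X))"
  proof -
  obtain F where \<mu>: "radon_measure (tv_measure \<sigma>)" and F [measurable]: "F \<in> borel_measurable borel"
    and eq: "AE x in lborel. \<sigma> x = F x"
    and var: "\<And>x y. x \<le> y \<Longrightarrow> \<bar>F y - F x\<bar> \<le> measure (tv_measure \<sigma>) {x<..y}"
    by (rule tv_measure_representation[OF assms(2)]) (rule that)
  obtain C where "reciprocal_primitive F g C"
    using reciprocal_primitiveI[OF F eq assms(3-6)] by blast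
  then interpret R: reciprocal_primitive F g C .
  have f: "f = R.f" unfolding R.f_def assms(7) ..
  have \<sigma>m: "\<sigma> \<in> borel_measurable lebesgue" using assms(3) by (simp add: Linfty_def)
  have cont: "AE x in lborel. isCont F x" by (rule isCont_of_variation_bound[OF \<mu> var])
  have rep: "\<sigma>' x = F x" if "lebesgue_representative \<sigma> \<sigma>'" "isCont F x" for \<sigma>' x
    using that approx_limit_of_isCont[OF \<sigma>m F eq that(2)] by (auto simp: lebesgue_representative_def)
  have "AE x in lborel. isCont F x \<and> \<sigma> x = F x" using cont eq by eventually_elim simp
  then have ae: "AE y in lebesgue. isCont F (f y) \<and> \<sigma> (f y) = F (f y)"
    unfolding f by (intro AE_completion R.AE_compose_f)
  have part1: "abs_continuous g \<and> strict_mono g \<and> bij g \<and>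
      (\<exists>L. L-lipschitz_on UNIV f) \<and>
      (AE y in lebesgue. (f has_real_derivative \<sigma> (f y)) (at y)) \<and>
      (\<forall>\<sigma>'. lebesgue_representative \<sigma> \<sigma>' \<longrightarrow> (AE y in lebesgue. (f has_real_derivative \<sigma>' (f y)) (at y)))"
  proof (intro conjI allI impI)
    show "\<exists>L. L-lipschitz_on UNIV f" using R.lipschitz_f f by auto
    show "AE y in lebesgue. (f has_real_derivative \<sigma> (f y)) (at y)"
      using ae by eventually_elim (use R.f_has_derivative f in auto)
    show "AE y in lebesgue. (f has_real_derivative \<sigma>' (f y)) (at y)" if "lebesgue_representative \<sigma> \<sigma>'" for \<sigma>'
      using ae by eventually_elim (use R.f_has_derivative f rep[OF that] in auto)
  qed (use R.abs_continuous_g R.strict_mono_g R.bij_g in auto)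
  have part2: "holder_on \<gamma> {0..T} X \<and> solves T \<sigma> Y x\<^sub>0 X \<and>
      (recip_Linfty_loc \<sigma> \<longrightarrow> X \<in> variable T \<sigma> s \<and> variability_solution T \<sigma> \<gamma> Y x\<^sub>0 X)"
    if s: "0 < s" "s < 1" and \<gamma>: "1 / (1 + s) < \<gamma>" "\<gamma> < 1"
      and Y: "holder_on \<gamma> {0..T} Y" "Y 0 = 0"
      and inner: "bounded_potential T s (\<lambda>t. Y t + g x\<^sub>0) (einterval (ext_value g a) (ext_value g b)) \<or>
        (\<exists>d>s. upper_regular d \<sigma> (einterval a b))"
      and outer: "bounded_potential T s (\<lambda>t. Y t + g x\<^sub>0) (- einterval (ext_value g a) (ext_value g b)) \<or>
        (\<exists>d>s. upper_regular d \<sigma> (- einterval a b))"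
      and X: "\<forall>t\<in>{0..T}. X t = f (Y t + g x\<^sub>0)"
    for s \<gamma> :: real and Y :: "real \<Rightarrow> real" and x\<^sub>0 :: real and a b :: ereal and X :: "real \<Rightarrow> real"
  proof -
    interpret M: radon_measure "tv_measure \<sigma>" by (rule \<mu>)
    interpret P: rough_path F g C "tv_measure \<sigma>" T s \<gamma> x\<^sub>0 Y
      by unfold_locales (use var assms(1) s \<gamma> Y in auto)
    have XP: "X t = P.X t" if "t \<in> {0..T}" for t using X that by (simp add: f P.X_def P.Z_def)
    have pot: "bounded_potential T s P.Z B" if "bounded_potential T s (\<lambda>t. Y t + g x\<^sub>0) B" for B
    proof -
      have "P.Z ` {0..T} = (\<lambda>t. Y t + g x\<^sub>0) ` {0..T}" by (rule image_cong) (auto simp: P.Z_def)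
      moreover have "(\<integral>\<^sup>+t\<in>{0..T}. riesz s (P.Z t - x) \<partial>lebesgue) = (\<integral>\<^sup>+t\<in>{0..T}. riesz s (Y t + g x\<^sub>0 - x) \<partial>lebesgue)" for x
        by (intro nn_integral_cong) (auto simp: P.Z_def indicator_def)
      ultimately show ?thesis using that unfolding bounded_potential_def by simp
    qed
    let ?A = "einterval a b"
    have A: "?A \<in> sets borel" by simp
    have adm1: "P.admissible ?A"
      using inner pot unfolding P.admissible_def upper_regular_def R.einterval_ext_value by blast
    have adm2: "P.admissible (- ?A)"
      using outer pot unfolding P.admissible_def upper_regular_def R.einterval_ext_value
        bij_image_Compl_eq[OF R.bij_g] by blast
    have hol: "holder_on \<gamma> {0..T} X"
      using P.holder_on_path XP unfolding holder_on_def by simp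
    have sol: "solves T \<sigma> Y x\<^sub>0 X"
      unfolding solves_def
    proof (intro allI impI ballI)
      fix \<sigma>' t assume \<sigma>': "lebesgue_representative \<sigma> \<sigma>'" and t: "t \<in> {0..T}"
      show "has_frac_integral T (\<lambda>u. indicator {0..t} u * \<sigma>' (X u)) Y (X t - x\<^sub>0)"
        by (rule P.has_frac_integral_path[OF A adm1 adm2 _ rep[OF \<sigma>'] t XP])
           (use \<sigma>' in \<open>auto simp: lebesgue_representative_def\<close>)
    qed
    have "X \<in> variable T \<sigma> s \<and> variability_solution T \<sigma> \<gamma> Y x\<^sub>0 X" if rec: "recip_Linfty_loc \<sigma>"
    proof -
      have lip: "\<exists>G>0. \<forall>x\<in>{a..b}. \<forall>y\<in>{a..b}. \<bar>g x - g y\<bar> \<le> G * \<bar>x - y\<bar>" for a b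
      proof -
        obtain G where "AE x in lebesgue. x \<in> {a..b} \<longrightarrow> \<bar>1 / \<sigma> x\<bar> \<le> G"
          using rec unfolding recip_Linfty_loc_def Linfty_loc_def by blast
        then have "AE x in lborel. x \<in> {a..b} \<longrightarrow> \<bar>1 / \<sigma> x\<bar> \<le> G" by (simp only: AE_completion_iff)
        \<comment> \<open>The essential bound may be 0 or negative, for instance on a degenerate
          interval, but a positive constant is required to rescale the kernel.\<close>
        then have "AE x in lborel. x \<in> {a..b} \<longrightarrow> 1 / F x \<le> \<bar>G\<bar> + 1"
          using eq
        proof eventually_elim
          case (elim x)
          then show ?case using abs_ge_self[of "1 / F x"] by auto
        qed
        then show ?thesis by (intro exI[of _ "\<bar>G\<bar> + 1"]) (auto intro!: R.g_lipschitz_on_Icc)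
      qed
      obtain U where U: "open U" "compact (closure U)" "P.X ` {0..T} \<subseteq> U"
        "(\<integral>\<^sup>+t\<in>{0..T}. (\<integral>\<^sup>+z\<in>U. riesz s (P.X t - z) \<partial>tv_measure \<sigma>) \<partial>lborel) < \<infinity>"
        by (rule P.path_potential[OF A adm1 adm2 lip]) (rule that)
      have "(\<integral>\<^sup>+t\<in>{0..T}. (\<integral>\<^sup>+z\<in>U. riesz s (X t - z) \<partial>tv_measure \<sigma>) \<partial>lebesgue)
          = (\<integral>\<^sup>+t\<in>{0..T}. (\<integral>\<^sup>+z\<in>U. riesz s (P.X t - z) \<partial>tv_measure \<sigma>) \<partial>lborel)"
        unfolding nn_integral_completion by (intro nn_integral_cong) (auto simp: XP indicator_def)
      moreover have "continuous_on {0..T} X"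
      proof -
        have "continuous_on {0..T} P.X" using P.isCont_X by (intro continuous_at_imp_continuous_on) auto
        then show ?thesis by (subst continuous_on_cong[OF refl XP]) auto
      qed
      moreover have "X ` {0..T} \<subseteq> U" using U(3) XP by auto
      ultimately have v: "X \<in> variable T \<sigma> s" using U unfolding variable_def by auto
      \<comment> \<open>The exponents \<alpha> = \<gamma> and s' = s are taken; the condition on
        them is equivalent to \<gamma> (1 + s) > 1.\<close>
      have "(1 - \<gamma>) / \<gamma> < s" using P.\<gamma>_s P.\<gamma>_pos by (simp add: divide_less_eq algebra_simps)
      moreover have "X 0 = x\<^sub>0" using XP[of 0] P.X_0 assms(1) by simp
      ultimately have "variability_solution T \<sigma> \<gamma> Y x\<^sub>0 X"
        unfolding variability_solution_def using Y v hol sol s P.\<gamma>_pos \<gamma> by blast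
      then show ?thesis using v by simp
    qed
    then show ?thesis using hol sol by blast
  qed
  show ?thesis
    using part1 part2 by blast
qed

end
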